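(* Let $k$ be a field of characteristic zero and $K=k(x_1,\dots,x_m)$. The algorithm HermiteOneForm (described in the context) is correct: given as input any closed $1$-form $\omega=f_1\,dx_1+\cdots+f_m\,dx_m$ with $f_1,\dots,f_m\in K$, all of its steps can be carried out as described, and it returns $g\in K$ and a simple form $r$ with coefficients in $K$ such that \[ \omega = dg + r . \]
   Context: $\partial_i=\partial/\partial x_i$ are the usual partial derivatives on $K$, extended uniquely to algebraic extensions; $dg=\sum_i\partial_i(g)\,dx_i$; $\omega=\sum_i f_i\,dx_i$ is closed if $\partial_i(f_j)=\partial_j(f_i)$ for all $i,j$. A rational function $f$ in $x_1,\dots,x_m$ is proper in $x_i$ if $f=a/b$ with $a,b$ coprime polynomials in $x_1,\dots,x_m$ and $\deg_{x_i}(a)<\deg_{x_i}(b)$ (with $\deg_{x_i}(0)=-\infty$, so $0$ is proper). A closed $1$-form $\sum_i f_i\,dx_i$ with $f_i\in K$ is a simple form if, for each $i=1,\dots,m$, $f_i$ is proper in $x_i$ and its (reduced) denominator is squarefree in $k[x_1,\dots,x_m]$. Hermite reduction: for a field $F$ of characteristic zero, each $f\in F(x)$ is uniquely (up to an additive constant in $g$) written $f=\frac{dg}{dx}+\frac{a}{b}$ with $g\in F(x)$, $a,b\in F[x]$ coprime, $\deg a<\deg b$, $b$ squarefree. Rothstein--Trager algorithm: for $A/B\in F(x)$ with $A,B$ coprime, $\deg A<\deg B$, $B$ squarefree, let $c_j\in\overline F$ be the distinct roots (in $z$) of the resultant $\mathrm{res}_x(B,\,A-z\,\frac{dB}{dx})$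 and let $b_j\in F(c_j)[x]$ be the monic gcd of $B$ and $A-c_j\frac{dB}{dx}$; then $A/B=\sum_j c_j\,\frac{db_j/dx}{b_j}$. Algorithm HermiteOneForm, input $\omega=f_1\,dx_1+\cdots+f_m\,dx_m$ closed with $f_i\in K$: (1) If $m=1$, apply Hermite reduction to get $f_1=\partial_1(g)+h$; return $g$ and $r:=h\,dx_1$. (2) If $m>1$, put $F=k(x_1,\dots,x_{m-1})$ and apply Hermite reduction with respect to $x_m$: $f_m=\partial_m(a_m)+\bar f_m$ with $a_m,\bar f_m\in K$, $\bar f_m$ proper in $x_m$ with denominator squarefree in $F[x_m]$. (3) Apply the Rothstein--Trager algorithm to $\bar f_m$ to construct $c_{m,j}\in\bar k$ and monic $b_{m,j}\in F(c_{m,j})[x_m]$ of positive degree in $x_m$ with $\bar f_m=\sum_j c_{m,j}\frac{\partial_m(b_{m,j})}{b_{m,j}}$. (4) For $i=1,\dots,m-1$ compute $\bar f_i:=\sum_j c_{m,j}\frac{\partial_i(b_{m,j})}{b_{m,j}}$ as an element of $K$; set $\bar r_m:=\bar f_1\,dx_1+\cdots+\bar f_m\,dx_m$ and $\omega_{m-1}:=\omega-da_m-\bar r_m$. (5) Apply HermiteOneForm to $\omega_{m-1}$, as a closed $1$-form in the $m-1$ variables $x_1,\dots,x_{m-1}$ over $F$, to obtain $\omega_{m-1}=dg_{m-1}+r_{m-1}$ with $g_{m-1}\in F$ and $r_{m-1}$ a simple form over $F$. (6) Return $g:=a_m+g_{m-1}$ and $r:=\bar r_m+r_{m-1}$. 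*)

theory Defs
  imports
    "HOL-Library.Poly_Mapping"
    "HOL-Computational_Algebra.Computational_Algebra"
    "HOL-Algebra.Algebraic_Closure_Type"
    "Subresultants.Resultant_Prelim"
begin

section \<open>Rational functions in the variables $x_1, \dots, x_m$\<close>

text \<open>
  The algorithm recurses on the number of variables, so that number cannot be fixed by a type.
  Everything therefore lives in the field \<open>k(x\<^sub>1, x\<^sub>2, \<dots>)\<close>, which is the type \<open>'a rat_fun\<close> with
  \<open>'a\<close> the field \<open>k\<close>; \<open>k[x\<^sub>1, \<dots>, x\<^sub>m]\<close> and \<open>k(x\<^sub>1, \<dots>, x\<^sub>m)\<close>
  are the sets \<open>mpols m\<close> and \<open>rat_funs m\<close>.
  Variables are counted from 0: the variable with index \<open>i\<close> is \<open>x\<^sub>i\<^sub>+\<^sub>1\<close>.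
\<close>

type_synonym 'a mpol = "(nat \<Rightarrow>\<^sub>0 nat) \<Rightarrow>\<^sub>0 'a"
type_synonym 'a rat_fun = "'a mpol fract"

text \<open>A 1-form \<open>f\<^sub>1 dx\<^sub>1 + \<dots> + f\<^sub>m dx\<^sub>m\<close> is its coefficient function; only the values at indices
  below \<open>m\<close> matter.\<close>
type_synonym 'a one_form = "nat \<Rightarrow> 'a rat_fun"

definition mpols :: "nat \<Rightarrow> 'a::field_char_0 mpol set" where
  "mpols m = {p. \<forall>t \<in> Poly_Mapping.keys p. Poly_Mapping.keys t \<subseteq> {..<m}}"

definition rat_funs :: "nat \<Rightarrow> 'a::field_char_0 rat_fun set" where
  "rat_funs m = {Fract a b | a b. a \<in> mpols m \<and> b \<in> mpols m \<and> b \<noteq> 0}"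

definition const :: "'a::field_char_0 \<Rightarrow> 'a rat_fun" where
  "const c = Fract (Poly_Mapping.single 0 c) 1"

definition x_var :: "nat \<Rightarrow> 'a::field_char_0 rat_fun" where
  "x_var i = Fract (Poly_Mapping.single (Poly_Mapping.single i 1) 1) 1"

text \<open>The degree in one variable; it is 0 for the zero polynomial, which is treated separately
  below wherever the convention \<open>deg 0 = -\<infinity>\<close> matters.\<close>
definition degree_in :: "nat \<Rightarrow> 'a::field_char_0 mpol \<Rightarrow> nat" where
  "degree_in i p = Max (insert 0 ((\<lambda>t. Poly_Mapping.lookup t i) ` Poly_Mapping.keys p))"


section \<open>Partial derivatives\<close>

text \<open>The truncated subtraction on exponents is harmless: the coefficient is 0 if the variable
  does not occur.\<close>
definition mpol_deriv :: "nat \<Rightarrow> 'a::field_char_0 mpol \<Rightarrow> 'a mpol" where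
  "mpol_deriv i p = (\<Sum>t \<in> Poly_Mapping.keys p.
     Poly_Mapping.single (t - Poly_Mapping.single i 1)
       (of_nat (Poly_Mapping.lookup t i) * Poly_Mapping.lookup p t))"

lemma mpol_deriv_superset:
  assumes "finite T" "Poly_Mapping.keys p \<subseteq> T"
  shows "mpol_deriv i p = (\<Sum>t \<in> T. Poly_Mapping.single (t - Poly_Mapping.single i 1)
       (of_nat (Poly_Mapping.lookup t i) * Poly_Mapping.lookup p t))"
  unfolding mpol_deriv_def using assms
  by (intro sum.mono_neutral_left) (auto simp: in_keys_iff)

lemma mpol_deriv_add: "mpol_deriv i (p + q) = mpol_deriv i p + mpol_deriv i q"
proof -
  let ?T = "Poly_Mapping.keys p \<union> Poly_Mapping.keys q"
  have "Poly_Mapping.keys (p + q) \<subseteq> ?T" by (rule Poly_Mapping.keys_add)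
  then show ?thesis
    by (simp add: mpol_deriv_superset[of ?T] lookup_add distrib_left single_add sum.distrib)
qed

lemma mpol_deriv_single:
  "mpol_deriv i (Poly_Mapping.single t c) =
     Poly_Mapping.single (t - Poly_Mapping.single i 1) (of_nat (Poly_Mapping.lookup t i) * c)"
  by (subst mpol_deriv_superset[of "{t}"]) (auto simp: in_keys_iff lookup_single)

lemma single_minus_add:
  fixes s t :: "nat \<Rightarrow>\<^sub>0 nat"
  assumes "Poly_Mapping.lookup s i \<noteq> 0"
  shows "s - Poly_Mapping.single i 1 + t = s + t - Poly_Mapping.single i 1"
proof (rule poly_mapping_eqI)
  fix j
  show "Poly_Mapping.lookup (s - Poly_Mapping.single i 1 + t) j =
      Poly_Mapping.lookup (s + t - Poly_Mapping.single i 1) j"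
    using assms by (cases "i = j") (simp_all add: lookup_add lookup_minus lookup_single)
qed

lemma mpol_deriv_mult_single:
  "mpol_deriv i (Poly_Mapping.single s c * Poly_Mapping.single t d) =
     mpol_deriv i (Poly_Mapping.single s c) * Poly_Mapping.single t d +
     Poly_Mapping.single s c * mpol_deriv i (Poly_Mapping.single t d)"
proof -
  let ?u = "Poly_Mapping.single i (1::nat)"
  have 1: "Poly_Mapping.single (s - ?u + t) (of_nat (Poly_Mapping.lookup s i) * c * d) =
    Poly_Mapping.single (s + t - ?u) (of_nat (Poly_Mapping.lookup s i) * c * d)"
    by (cases "Poly_Mapping.lookup s i = 0") (simp_all add: single_minus_add del: One_nat_def)
  have 2: "Poly_Mapping.single (s + (t - ?u)) (c * (of_nat (Poly_Mapping.lookup t i) * d)) =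
    Poly_Mapping.single (s + t - ?u) (c * (of_nat (Poly_Mapping.lookup t i) * d))"
    using single_minus_add[of t i s]
    by (cases "Poly_Mapping.lookup t i = 0") (simp_all add: add.commute del: One_nat_def)
  show ?thesis
    by (simp only: mult_single mpol_deriv_single 1 2 lookup_add flip: single_add)
      (simp add: algebra_simps)
qed

lemma mpol_induct:
  assumes "P 0" "\<And>p t c. P p \<Longrightarrow> P (p + Poly_Mapping.single t c)"
  shows "P (p :: 'a::field_char_0 mpol)"
proof -
  have "P (\<Sum>t \<in> T. Poly_Mapping.single t (Poly_Mapping.lookup p t))" if "finite T" for T
    using that
  proof induction
    case (insert t T)
    then show ?case
      using assms(2)[OF insert.IH, of t "Poly_Mapping.lookup p t"] by (simp add: add.commute)
  qed (simp add: assms)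
  moreover have "(\<Sum>t \<in> Poly_Mapping.keys p. Poly_Mapping.single t (Poly_Mapping.lookup p t)) = p"
    by (rule poly_mapping_eqI)
      (auto simp: Poly_Mapping.lookup_sum lookup_single when_def in_keys_iff sum.delta)
  ultimately show ?thesis
    by (metis Poly_Mapping.finite_keys)
qed

lemma mpol_deriv_mult: "mpol_deriv i (p * q) = mpol_deriv i p * q + p * mpol_deriv i q"
proof -
  have [simp]: "mpol_deriv i 0 = 0" by (simp add: mpol_deriv_def)
  have *: "mpol_deriv i (p * Poly_Mapping.single t d) =
      mpol_deriv i p * Poly_Mapping.single t d + p * mpol_deriv i (Poly_Mapping.single t d)" for t d
    by (induction p rule: mpol_induct)
      (simp_all add: distrib_right mpol_deriv_add mpol_deriv_mult_single algebra_simps)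
  show ?thesis
    by (induction q rule: mpol_induct) (simp_all add: distrib_left mpol_deriv_add * algebra_simps)
qed

definition pd :: "nat \<Rightarrow> 'a::field_char_0 rat_fun \<Rightarrow> 'a rat_fun" where
  "pd i f = (THE g. \<forall>a b. b \<noteq> 0 \<and> f = Fract a b \<longrightarrow>
     g = Fract (mpol_deriv i a * b - a * mpol_deriv i b) (b ^ 2))"

lemma pd_Fract:
  assumes "b \<noteq> 0"
  shows "pd i (Fract a b) = Fract (mpol_deriv i a * b - a * mpol_deriv i b) (b ^ 2)"
proof -
  let ?D = "mpol_deriv i"
  have *: "Fract (?D a * b - a * ?D b) (b ^ 2) = Fract (?D c * d - c * ?D d) (d ^ 2)"
    if "d \<noteq> 0" "Fract a b = Fract c d" for c d
  proof -
    have eq: "a * d = c * b" using that assms by (simp add: eq_fract)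
    have D: "?D a * d + a * ?D d = ?D c * b + c * ?D b"
      using arg_cong[OF eq, of ?D] by (simp add: mpol_deriv_mult)
    have "(?D a * b - a * ?D b) * d ^ 2 - (?D c * d - c * ?D d) * b ^ 2 =
        b * d * ((?D a * d + a * ?D d) - (?D c * b + c * ?D b))
        - (a * d - c * b) * (b * ?D d + d * ?D b)"
      by (simp add: algebra_simps power2_eq_square)
    then have "(?D a * b - a * ?D b) * d ^ 2 = (?D c * d - c * ?D d) * b ^ 2"
      using D eq by simp
    then show ?thesis using that assms by (simp add: eq_fract)
  qed
  show ?thesis
    unfolding pd_def by (rule the_equality) (use assms * in blast)+
qed

definition derivation :: "('b::field \<Rightarrow> 'b) \<Rightarrow> bool" where
  "derivation D \<longleftrightarrow> (\<forall>u v. D (u + v) = D u + D v) \<and> (\<forall>u v. D (u * v) = D u * v + u * D v)"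

text \<open>
  All algebraic extensions of the fields \<open>k(x\<^sub>1, \<dots>, x\<^sub>m)\<close> are taken inside the algebraic closure
  of \<open>k(x\<^sub>1, x\<^sub>2, \<dots>)\<close>, to which every partial derivative extends uniquely.
\<close>
type_synonym 'a alg_fun = "'a rat_fun alg_closure"

definition pd_ac :: "nat \<Rightarrow> 'a::field_char_0 alg_fun \<Rightarrow> 'a alg_fun" where
  "pd_ac i = (THE D. derivation D \<and> (\<forall>f. D (to_ac f) = to_ac (pd i f)))"

text \<open>The algebraic closure of \<open>k\<close> itself.\<close>
definition k_bar :: "'a::field_char_0 alg_fun set" where
  "k_bar = {c. \<exists>p :: 'a poly. p \<noteq> 0 \<and> poly (map_poly (\<lambda>a. to_ac (const a)) p) c = 0}"

definition is_subfield :: "'b::field set \<Rightarrow> bool" where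
  "is_subfield S \<longleftrightarrow> 1 \<in> S \<and> (\<forall>u\<in>S. \<forall>v\<in>S. u - v \<in> S \<and> u * v \<in> S) \<and> (\<forall>u\<in>S. inverse u \<in> S)"

text \<open>\<open>F(c)\<close>\<close>
definition adjoin :: "'a::field_char_0 rat_fun set \<Rightarrow> 'a alg_fun \<Rightarrow> 'a alg_fun set" where
  "adjoin F c = is_subfield hull (insert c (to_ac ` F))"


section \<open>Simple forms\<close>

text \<open>Divisibility is taken inside a subring \<open>R\<close> of the type, such as \<open>k[x\<^sub>1, \<dots>, x\<^sub>m]\<close> or \<open>F[x]\<close>.\<close>

definition dvd_in :: "'b::comm_ring_1 set \<Rightarrow> 'b \<Rightarrow> 'b \<Rightarrow> bool" where
  "dvd_in R a b \<longleftrightarrow> (\<exists>c\<in>R. b = a * c)"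

definition coprime_in :: "'b::comm_ring_1 set \<Rightarrow> 'b \<Rightarrow> 'b \<Rightarrow> bool" where
  "coprime_in R a b \<longleftrightarrow> (\<forall>c\<in>R. dvd_in R c a \<longrightarrow> dvd_in R c b \<longrightarrow> dvd_in R c 1)"

definition squarefree_in :: "'b::comm_ring_1 set \<Rightarrow> 'b \<Rightarrow> bool" where
  "squarefree_in R b \<longleftrightarrow> (\<forall>q\<in>R. dvd_in R (q ^ 2) b \<longrightarrow> dvd_in R q 1)"

definition reduced_fraction ::
  "nat \<Rightarrow> 'a::field_char_0 rat_fun \<Rightarrow> 'a mpol \<Rightarrow> 'a mpol \<Rightarrow> bool" where
  "reduced_fraction m f a b \<longleftrightarrow>
     a \<in> mpols m \<and> b \<in> mpols m \<and> b \<noteq> 0 \<and> coprime_in (mpols m) a b \<and> f = Fract a b"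

definition proper_in :: "nat \<Rightarrow> nat \<Rightarrow> 'a::field_char_0 rat_fun \<Rightarrow> bool" where
  "proper_in m i f \<longleftrightarrow>
     (\<exists>a b. reduced_fraction m f a b \<and> (a = 0 \<or> degree_in i a < degree_in i b))"

definition closed_form :: "nat \<Rightarrow> 'a::field_char_0 one_form \<Rightarrow> bool" where
  "closed_form m \<omega> \<longleftrightarrow>
     (\<forall>i<m. \<omega> i \<in> rat_funs m) \<and> (\<forall>i<m. \<forall>j<m. pd i (\<omega> j) = pd j (\<omega> i))"

definition simple_form :: "nat \<Rightarrow> 'a::field_char_0 one_form \<Rightarrow> bool" where
  "simple_form m \<omega> \<longleftrightarrow> closed_form m \<omega> \<and>
     (\<forall>i<m. proper_in m i (\<omega> i) \<and>
            (\<exists>a b. reduced_fraction m (\<omega> i) a b \<and> squarefree_in (mpols m) b))"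


section \<open>Hermite reduction and the Rothstein--Trager algorithm\<close>

definition polys_over :: "'b::zero set \<Rightarrow> 'b poly set" where
  "polys_over F = {p. \<forall>i. Polynomial.coeff p i \<in> F}"

text \<open>\<open>A / B\<close> as a function of the variable with index \<open>n\<close>.\<close>
definition quotient_at :: "nat \<Rightarrow> 'a::field_char_0 rat_fun poly \<Rightarrow> 'a rat_fun poly \<Rightarrow> 'a rat_fun" where
  "quotient_at n A B = poly A (x_var n) / poly B (x_var n)"

text \<open>
  \<open>(g, A, B)\<close> is an outcome of Hermite reduction of \<open>f\<close> with respect to the variable \<open>x\<close> of
  index \<open>n\<close> over \<open>F = rat_funs n\<close>, that is \<open>f = dg/dx + A/B\<close>. It is determined up to an additive
  constant in \<open>g\<close> and a common nonzero factor in \<open>F\<close> of \<open>A\<close> and \<open>B\<close>.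
\<close>
definition hermite_reduction :: "nat \<Rightarrow> 'a::field_char_0 rat_fun \<Rightarrow>
    'a rat_fun \<times> 'a rat_fun poly \<times> 'a rat_fun poly \<Rightarrow> bool" where
  "hermite_reduction n f = (\<lambda>(g, A, B).
     let Fx = polys_over (rat_funs n) in
       g \<in> rat_funs (Suc n) \<and> A \<in> Fx \<and> B \<in> Fx \<and> B \<noteq> 0 \<and> coprime_in Fx A B \<and>
       (A = 0 \<or> Polynomial.degree A < Polynomial.degree B) \<and> squarefree_in Fx B \<and>
       f = pd n g + quotient_at n A B)"

text \<open>\<open>res\<^sub>x(B, A - z dB/dx)\<close>: the inner polynomial variable is \<open>z\<close>, the outer one is \<open>x\<close>.
  Its roots are collected in an algebraically closed field that contains an algebraic closure
  of the field of coefficients.\<close>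
definition rt_resultant :: "'b::field poly \<Rightarrow> 'b poly \<Rightarrow> 'b poly" where
  "rt_resultant A B = resultant (map_poly (\<lambda>c. [:c:]) B)
     (map_poly (\<lambda>c. [:c:]) A - Polynomial.smult [:0, 1:] (map_poly (\<lambda>c. [:c:]) (pderiv B)))"

definition rt_roots :: "'b::field poly \<Rightarrow> 'b poly \<Rightarrow> 'b alg_closure set" where
  "rt_roots A B = {c. poly (map_poly to_ac (rt_resultant A B)) c = 0}"

text \<open>\<open>gcd\<close> is the monic one, and does not depend on the field over which it is formed.\<close>
definition rt_gcd :: "'b::field poly \<Rightarrow> 'b poly \<Rightarrow> 'b alg_closure \<Rightarrow> 'b alg_closure poly" where
  "rt_gcd A B c = gcd (map_poly to_ac B)
     (map_poly to_ac A - Polynomial.smult c (map_poly to_ac (pderiv B)))"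

text \<open>The sum of all \<open>c \<cdot> \<partial>\<^sub>i(b) / b\<close>, with \<open>b\<close> a function of the variable with index \<open>n\<close>.\<close>
definition log_deriv_sum :: "nat \<Rightarrow> nat \<Rightarrow> 'a::field_char_0 alg_fun set \<Rightarrow>
    ('a alg_fun \<Rightarrow> 'a alg_fun poly) \<Rightarrow> 'a alg_fun" where
  "log_deriv_sum n i C b =
     (\<Sum>c\<in>C. c * (pd_ac i (poly (b c) (to_ac (x_var n))) / poly (b c) (to_ac (x_var n))))"


section \<open>The algorithm\<close>

text \<open>
  A nondeterministic program is the set of its possible outcomes, where \<open>None\<close> stands for an
  execution that reaches a step which cannot be carried out as described.
\<close>
type_synonym 'r program = "'r option set"

definition pick :: "('b \<Rightarrow> bool) \<Rightarrow> ('b \<Rightarrow> 'r program) \<Rightarrow> 'r program" where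
  "pick P k = (if \<exists>x. P x then \<Union>x\<in>{x. P x}. k x else {None})"

definition ensure :: "bool \<Rightarrow> 'r program \<Rightarrow> 'r program" where
  "ensure P k = (if P then k else {None})"

definition call :: "'b program \<Rightarrow> ('b \<Rightarrow> 'r program) \<Rightarrow> 'r program" where
  "call p k = (\<Union>out\<in>p. case out of None \<Rightarrow> {None} | Some x \<Rightarrow> k x)"

text \<open>\<open>\<omega> = dg + r\<close> as forms in the first \<open>m\<close> variables\<close>
definition decomposes :: "nat \<Rightarrow> 'a::field_char_0 one_form \<Rightarrow> 'a rat_fun \<Rightarrow> 'a one_form \<Rightarrow> bool" where
  "decomposes m \<omega> g r \<longleftrightarrow> (\<forall>i<m. \<omega> i = pd i g + r i)"

text \<open>
  In the recursive case \<open>m = Suc n\<close>, so that \<open>F = rat_funs n\<close>, \<open>K = rat_funs m\<close>, and the last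
  variable has index \<open>n\<close>. The input has at least one variable; the case \<open>0\<close> is void.
\<close>
primrec hermite_one_form ::
  "nat \<Rightarrow> 'a::field_char_0 one_form \<Rightarrow> ('a rat_fun \<times> 'a one_form) program" where
  "hermite_one_form 0 \<omega> = {None}"
| "hermite_one_form (Suc n) \<omega> =
    (if n = 0 then
       pick (hermite_reduction 0 (\<omega> 0)) (\<lambda>(g, A, B).
       {Some (g, \<lambda>i. if i = 0 then quotient_at 0 A B else 0)})
     else
       pick (hermite_reduction n (\<omega> n)) (\<lambda>(a, A, B).
       let f_last = quotient_at n A B; C = rt_roots A B; b = rt_gcd A B in
       ensure (finite C \<and>
         (\<forall>c\<in>C. c \<in> k_bar \<and> b c \<in> polys_over (adjoin (rat_funs n) c) \<and>
                lead_coeff (b c) = 1 \<and> 0 < Polynomial.degree (b c)) \<and>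
         to_ac f_last = log_deriv_sum n n C b) (
       pick (\<lambda>f. \<forall>i<n. f i \<in> rat_funs (Suc n) \<and> to_ac (f i) = log_deriv_sum n i C b) (\<lambda>f.
       let r_last = (\<lambda>i. if i < n then f i else if i = n then f_last else 0);
           \<omega>' = (\<lambda>i. \<omega> i - pd i a - r_last i) in
       ensure (closed_form n \<omega>' \<and> \<omega>' n = 0) (
       call (hermite_one_form n \<omega>') (\<lambda>(g', r').
       ensure (g' \<in> rat_funs n \<and> simple_form n r' \<and> decomposes n \<omega>' g' r')
       {Some (a + g', \<lambda>i. r_last i + r' i)}))))))"

end

theory Submission
  imports Defs "Subresultants.Subresultant_Gcd"
begin

text \<open>
  The residues of the proper part \<open>h\<close> of \<open>f\<^sub>m\<close> with respect to \<open>x\<^sub>m\<close> are constants: by closedness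
  \<open>\<partial>\<^sub>i h\<close> is a derivative with respect to \<open>x\<^sub>m\<close>, hence has no simple poles, while the residues of
  \<open>h\<close> enter it with their derivatives as residues. Rothstein--Trager therefore writes \<open>h\<close> as
  \<open>\<Sum>\<^sub>j c\<^sub>j \<cdot> \<partial>\<^sub>m b\<^sub>j / b\<^sub>j\<close> with \<open>c\<^sub>j\<close> algebraic over \<open>k\<close>. The same comparison shows that
  \<open>w = f\<^sub>i - \<partial>\<^sub>i a\<^sub>m - \<Sum>\<^sub>j c\<^sub>j \<cdot> \<partial>\<^sub>i b\<^sub>j / b\<^sub>j\<close> does not involve \<open>x\<^sub>m\<close>. As \<open>b\<^sub>j\<close> is monic, the sum is
  proper in \<open>x\<^sub>m\<close>, so \<open>w\<close> is the polynomial part of \<open>f\<^sub>i - \<partial>\<^sub>i a\<^sub>m \<in> F(x\<^sub>m)\<close>; hence \<open>w\<close> lies in \<open>F\<close>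
  and the sum in \<open>K\<close>, without Galois theory.

  Clearing denominators in the \<open>b\<^sub>j\<close>, all remainders become logarithmic forms \<open>\<Sum> c \<cdot> dN / N\<close>
  with constants \<open>c\<close> and polynomials \<open>N\<close> over the algebraic closure of \<open>k\<close>. Such a form is simple:
  properness is a count of degrees, and a prime of the polynomial ring occurs at most once in the
  denominator because differentiating \<open>N\<close> lowers its multiplicity by at most one.
\<close>

text \<open>Two obstacles shape the development. No type stands for F, for K or for the algebraic
  closure of F, since the number of variables changes in the recursion. Membership is therefore
  tested by derivatives: the elements killed by all \<open>pd_ac j\<close> with
  \<open>n \<le> j\<close> act as the closure of F, the variable of index \<open>n\<close> is
  transcendental over them because its own derivative is 1, and polynomial identities over them are
  proved by evaluating at that variable.

  The other obstacle is squarefreeness. It becomes visible over the algebraic closure of k, where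
  the logarithmic form has its denominator, but it is claimed over k, and a prime p of
  k[x_1, ..., x_m] may split on the way up. A factor q of the split p might divide a numerator that
  p does not divide; a k-linear functional on the closure excludes this.

  The choices that the program leaves open, such as the element of F that may be added to the
  Hermite part, are arbitrary, so every outcome has to be treated.\<close>

hide_const (open) Polynomials.degree up_ring.coeff module.smult

section \<open>Degrees and derivatives of multivariate polynomials\<close>

declare lookup_eq_zero_in_keys_contradict [rule del]

text \<open>One template for three ring homomorphisms: \<open>graded\<close>, \<open>evl\<close> and
  \<open>lft\<close> differ only in the images of coefficients and monomials.\<close>

definition mpol_eval ::
  "('a::field_char_0 \<Rightarrow> 'b::comm_ring_1) \<Rightarrow> ((nat \<Rightarrow>\<^sub>0 nat) \<Rightarrow> 'b) \<Rightarrow> 'a mpol \<Rightarrow> 'b" where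
  "mpol_eval h e p = (\<Sum>t \<in> Poly_Mapping.keys p. h (Poly_Mapping.lookup p t) * e t)"

locale mpol_hom =
  fixes h :: "'a::field_char_0 \<Rightarrow> 'b::comm_ring_1" and e :: "(nat \<Rightarrow>\<^sub>0 nat) \<Rightarrow> 'b"
  assumes h_1: "h 1 = 1" and h_add: "h (c + d) = h c + h d" and h_mult: "h (c * d) = h c * h d"
    and e_0: "e 0 = 1" and e_add: "e (s + t) = e s * e t"
begin

lemma h_0: "h 0 = 0"
  using h_add[of 0 0] by simp

lemma eval_superset:
  assumes "finite T" "Poly_Mapping.keys p \<subseteq> T"
  shows "mpol_eval h e p = (\<Sum>t \<in> T. h (Poly_Mapping.lookup p t) * e t)"
  unfolding mpol_eval_def using assms
  by (intro sum.mono_neutral_left) (auto simp: in_keys_iff h_0)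

lemma eval_add: "mpol_eval h e (p + q) = mpol_eval h e p + mpol_eval h e q"
proof -
  let ?T = "Poly_Mapping.keys p \<union> Poly_Mapping.keys q"
  have "Poly_Mapping.keys (p + q) \<subseteq> ?T" by (rule Poly_Mapping.keys_add)
  then show ?thesis
    by (simp add: eval_superset[of ?T] lookup_add h_add distrib_right sum.distrib)
qed

lemma eval_single: "mpol_eval h e (Poly_Mapping.single t c) = h c * e t"
  by (subst eval_superset[of "{t}"]) (auto simp: in_keys_iff lookup_single)

lemma eval_0: "mpol_eval h e 0 = 0"
  by (simp add: mpol_eval_def)

lemma eval_1: "mpol_eval h e 1 = 1"
  using eval_single[of 0 1] by (simp add: h_1 e_0)

lemma eval_mult: "mpol_eval h e (p * q) = mpol_eval h e p * mpol_eval h e q"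
proof -
  have *: "mpol_eval h e (p * Poly_Mapping.single t d) =
      mpol_eval h e p * mpol_eval h e (Poly_Mapping.single t d)" for t d
    by (induction p rule: mpol_induct)
      (simp_all add: distrib_right eval_add eval_0 mult_single eval_single h_mult e_add
        algebra_simps)
  show ?thesis
    by (induction q rule: mpol_induct) (simp_all add: distrib_left eval_add eval_0 *)
qed

lemma eval_minus: "mpol_eval h e (- p) = - mpol_eval h e p"
  using eval_add[of p "- p"] by (simp add: eval_0 eq_neg_iff_add_eq_0 add.commute)

lemma eval_diff: "mpol_eval h e (p - q) = mpol_eval h e p - mpol_eval h e q"
  using eval_add[of p "- q"] by (simp add: eval_minus)

lemma eval_sum: "mpol_eval h e (sum f A) = (\<Sum>a\<in>A. mpol_eval h e (f a))"
  by (induction A rule: infinite_finite_induct) (simp_all add: eval_0 eval_add)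

lemma eval_power: "mpol_eval h e (p ^ n) = mpol_eval h e p ^ n"
  by (induction n) (simp_all add: eval_1 eval_mult)

end

section \<open>Weighted degrees of multivariate polynomials\<close>

definition additive_nat :: "((nat \<Rightarrow>\<^sub>0 nat) \<Rightarrow> nat) \<Rightarrow> bool" where
  "additive_nat w \<longleftrightarrow> (\<forall>s t. w (s + t) = w s + w t)"

lemma additive_nat_0: "additive_nat w \<Longrightarrow> w 0 = 0"
  unfolding additive_nat_def by (metis add_cancel_left_left add.right_neutral)

definition wdeg :: "((nat \<Rightarrow>\<^sub>0 nat) \<Rightarrow> nat) \<Rightarrow> 'a::field_char_0 mpol \<Rightarrow> nat" where
  "wdeg w p = Max (insert 0 (w ` Poly_Mapping.keys p))"

text \<open>A new variable z records weights: the monomial t is multiplied by z to the power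
  \<open>w t\<close>. Different monomials cannot cancel, so the degree in z is the weighted degree,
  and its additivity under products is inherited from univariate polynomials over a domain. Suitable
  weights give the degree in one variable and the total degree.\<close>

definition graded :: "((nat \<Rightarrow>\<^sub>0 nat) \<Rightarrow> nat) \<Rightarrow> 'a::field_char_0 mpol \<Rightarrow> 'a mpol poly" where
  "graded w = mpol_eval (\<lambda>c. [:Poly_Mapping.single 0 c:])
     (\<lambda>t. Polynomial.monom (Poly_Mapping.single t 1) (w t))"

lemma mpol_hom_graded:
  assumes "additive_nat w"
  shows "mpol_hom (\<lambda>c. [:Poly_Mapping.single 0 c:])
     (\<lambda>t. Polynomial.monom (Poly_Mapping.single t (1::'a::field_char_0)) (w t))"
  using assms additive_nat_0[OF assms] unfolding additive_nat_def
  by unfold_locales (simp_all add: single_add mult_monom mult_single monom_0 pCons_one mult.commute)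

lemma coeff_graded:
  "coeff (graded w p) n =
     (\<Sum>t \<in> Poly_Mapping.keys p. if w t = n then Poly_Mapping.single t (Poly_Mapping.lookup p t) else 0)"
  unfolding graded_def mpol_eval_def coeff_sum
  by (intro sum.cong) (simp_all add: mult_single)

lemma lookup_coeff_graded:
  "Poly_Mapping.lookup (coeff (graded w p) n) t =
     (if w t = n then Poly_Mapping.lookup p t else 0)"
proof -
  have "Poly_Mapping.lookup (coeff (graded w p) n) t =
     (\<Sum>s \<in> Poly_Mapping.keys p. if s = t then (if w t = n then Poly_Mapping.lookup p t else 0) else 0)"
    unfolding coeff_graded Poly_Mapping.lookup_sum
    by (intro sum.cong) (auto simp: lookup_single)
  also have "\<dots> = (if w t = n then Poly_Mapping.lookup p t else 0)"
    by (subst sum.delta) (auto simp: in_keys_iff)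
  finally show ?thesis .
qed

lemma degree_graded: "degree (graded w p) = wdeg w p"
proof (rule antisym)
  have fin: "finite (insert 0 (w ` Poly_Mapping.keys p))" by simp
  show "degree (graded w p) \<le> wdeg w p"
  proof (rule degree_le, intro allI impI poly_mapping_eqI)
    fix n t assume n: "wdeg w p < n"
    show "Poly_Mapping.lookup (coeff (graded w p) n) t = Poly_Mapping.lookup 0 t"
    proof (cases "t \<in> Poly_Mapping.keys p")
      case True
      then have "w t \<le> wdeg w p" unfolding wdeg_def using fin by (intro Max_ge) auto
      then show ?thesis using n by (simp add: lookup_coeff_graded)
    qed (simp add: lookup_coeff_graded in_keys_iff)
  qed
  show "wdeg w p \<le> degree (graded w p)"
    unfolding wdeg_def
  proof (intro Max.boundedI, goal_cases)
    case (3 a)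
    then show ?case
    proof
      assume "a \<in> w ` Poly_Mapping.keys p"
      then obtain t where t: "t \<in> Poly_Mapping.keys p" "a = w t" by auto
      then have "Poly_Mapping.lookup (coeff (graded w p) a) t \<noteq> 0"
        by (simp add: lookup_coeff_graded in_keys_iff)
      then have "coeff (graded w p) a \<noteq> 0" by auto
      then show ?thesis by (rule le_degree)
    qed simp
  qed auto
qed

lemma graded_eq_0_iff: "graded w p = 0 \<longleftrightarrow> p = 0"
proof
  assume *: "graded w p = 0"
  show "p = 0"
  proof (rule poly_mapping_eqI)
    fix t show "Poly_Mapping.lookup p t = Poly_Mapping.lookup 0 t"
      using lookup_coeff_graded[of w p "w t" t] by (simp add: *)
  qed
qed (simp add: graded_def mpol_eval_def)

lemma wdeg_mult:
  assumes "additive_nat w" "p \<noteq> 0" "q \<noteq> 0"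
  shows "wdeg w (p * q) = wdeg w p + wdeg w q"
proof -
  have "graded w (p * q) = graded w p * graded w q"
    unfolding graded_def by (rule mpol_hom.eval_mult[OF mpol_hom_graded[OF assms(1)]])
  then show ?thesis
    using assms by (metis degree_graded degree_mult_eq graded_eq_0_iff)
qed

lemma wdeg_less_iff:
  "wdeg w p < n \<longleftrightarrow> 0 < n \<and> (\<forall>t\<in>Poly_Mapping.keys p. w t < n)"
  unfolding wdeg_def by (subst Max_less_iff) auto

lemma wdeg_le_iff:
  "wdeg w p \<le> n \<longleftrightarrow> (\<forall>t\<in>Poly_Mapping.keys p. w t \<le> n)"
  unfolding wdeg_def by (subst Max_le_iff) auto

lemma degree_in_wdeg: "degree_in i = wdeg (\<lambda>t. Poly_Mapping.lookup t i)"
  by (rule ext) (simp add: degree_in_def wdeg_def)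

lemma additive_lookup: "additive_nat (\<lambda>t. Poly_Mapping.lookup t i)"
  by (simp add: additive_nat_def lookup_add)

definition exp_deg :: "(nat \<Rightarrow>\<^sub>0 nat) \<Rightarrow> nat" where
  "exp_deg t = (\<Sum>i \<in> Poly_Mapping.keys t. Poly_Mapping.lookup t i)"

lemma exp_deg_superset:
  assumes "finite T" "Poly_Mapping.keys t \<subseteq> T"
  shows "exp_deg t = (\<Sum>i \<in> T. Poly_Mapping.lookup t i)"
  unfolding exp_deg_def using assms
  by (intro sum.mono_neutral_left) (auto simp: in_keys_iff)

lemma additive_exp_deg: "additive_nat exp_deg"
  unfolding additive_nat_def
proof (intro allI)
  fix s t :: "nat \<Rightarrow>\<^sub>0 nat"
  let ?T = "Poly_Mapping.keys s \<union> Poly_Mapping.keys t"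
  have "Poly_Mapping.keys (s + t) \<subseteq> ?T" by (rule Poly_Mapping.keys_add)
  then show "exp_deg (s + t) = exp_deg s + exp_deg t"
    by (simp add: exp_deg_superset[of ?T] lookup_add sum.distrib)
qed

lemma exp_deg_eq_0_iff: "exp_deg t = 0 \<longleftrightarrow> t = 0"
proof
  assume "exp_deg t = 0"
  then have "\<forall>i\<in>Poly_Mapping.keys t. Poly_Mapping.lookup t i = 0"
    unfolding exp_deg_def by (subst (asm) sum_eq_0_iff) auto
  then show "t = 0"
    by (metis in_keys_iff lookup_zero poly_mapping_eqI)
qed (simp add: exp_deg_def)

abbreviation tdeg :: "'a::field_char_0 mpol \<Rightarrow> nat" where
  "tdeg \<equiv> wdeg exp_deg"

lemma tdeg_mult: "p \<noteq> 0 \<Longrightarrow> q \<noteq> 0 \<Longrightarrow> tdeg (p * q) = tdeg p + tdeg q"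
  by (rule wdeg_mult[OF additive_exp_deg])

lemma degree_in_mult: "p \<noteq> 0 \<Longrightarrow> q \<noteq> 0 \<Longrightarrow> degree_in i (p * q) = degree_in i p + degree_in i q"
  unfolding degree_in_wdeg by (rule wdeg_mult[OF additive_lookup])

lemma tdeg_eq_0_iff: "tdeg p = 0 \<longleftrightarrow> (\<exists>c. p = Poly_Mapping.single 0 c)"
proof
  assume "tdeg p = 0"
  then have "\<forall>t\<in>Poly_Mapping.keys p. t = 0"
    using wdeg_le_iff[of exp_deg p 0] by (auto simp: exp_deg_eq_0_iff)
  then have "p = Poly_Mapping.single 0 (Poly_Mapping.lookup p 0)"
    by (intro poly_mapping_eqI) (auto simp: lookup_single when_def in_keys_iff)
  then show "\<exists>c. p = Poly_Mapping.single 0 c" ..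
next
  assume "\<exists>c. p = Poly_Mapping.single 0 c"
  then show "tdeg p = 0"
    using wdeg_le_iff[of exp_deg p 0] by (auto simp: exp_deg_eq_0_iff split: if_splits)
qed

lemma mpol_unit_iff: "p dvd 1 \<longleftrightarrow> p \<noteq> 0 \<and> tdeg p = 0"
proof
  assume p: "p dvd 1"
  then obtain q where q: "1 = p * q" unfolding dvd_def by blast
  then have "p \<noteq> 0" "q \<noteq> 0" by auto
  moreover have "tdeg (1 :: 'a mpol) = 0"
    unfolding tdeg_eq_0_iff by (metis single_one)
  ultimately show "p \<noteq> 0 \<and> tdeg p = 0"
    using tdeg_mult[of p q] q by simp
next
  assume p: "p \<noteq> 0 \<and> tdeg p = 0"
  then obtain c where c: "p = Poly_Mapping.single 0 c" by (auto simp: tdeg_eq_0_iff)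
  then have "c \<noteq> 0" using p by auto
  then have "1 = p * Poly_Mapping.single 0 (inverse c)"
    by (simp add: c mult_single)
  then show "p dvd 1" by (rule dvdI)
qed

section \<open>The subrings k[x_1, ..., x_n]\<close>

lemma mpols_iff_lookup:
  "p \<in> mpols n \<longleftrightarrow> (\<forall>t\<in>Poly_Mapping.keys p. \<forall>i\<ge>n. Poly_Mapping.lookup t i = 0)"
proof -
  have "Poly_Mapping.keys t \<subseteq> {..<n} \<longleftrightarrow> (\<forall>i\<ge>n. Poly_Mapping.lookup t i = 0)"
    for t :: "nat \<Rightarrow>\<^sub>0 nat"
  proof
    assume *: "Poly_Mapping.keys t \<subseteq> {..<n}"
    show "\<forall>i\<ge>n. Poly_Mapping.lookup t i = 0"
    proof (intro allI impI)
      fix i assume "n \<le> i"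
      then have "i \<notin> Poly_Mapping.keys t" using * by auto
      then show "Poly_Mapping.lookup t i = 0" by (simp only: in_keys_iff not_not)
    qed
  next
    assume *: "\<forall>i\<ge>n. Poly_Mapping.lookup t i = 0"
    show "Poly_Mapping.keys t \<subseteq> {..<n}"
    proof
      fix i assume "i \<in> Poly_Mapping.keys t"
      then have "Poly_Mapping.lookup t i \<noteq> 0" by (simp only: in_keys_iff not_False_eq_True)
      then show "i \<in> {..<n}" using *[rule_format, of i] by (cases "n \<le> i") simp_all
    qed
  qed
  then show ?thesis unfolding mpols_def by blast
qed

lemma mpols_iff_degree_in: "p \<in> mpols n \<longleftrightarrow> (\<forall>i\<ge>n. degree_in i p = 0)"
proof -
  have "degree_in i p = 0 \<longleftrightarrow> (\<forall>t\<in>Poly_Mapping.keys p. Poly_Mapping.lookup t i = 0)" for i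
    unfolding degree_in_wdeg using wdeg_le_iff[of "\<lambda>t. Poly_Mapping.lookup t i" p 0]
    by (simp only: le_zero_eq)
  then show ?thesis unfolding mpols_iff_lookup by metis
qed

text \<open>The degree in each variable of index at least \<open>n\<close> is additive, so it is 0
  for both factors. This is what reconciles divisibility inside \<open>mpols n\<close> with
  divisibility in the ring of all polynomials.\<close>

lemma mpols_factor: "p * q \<in> mpols n \<Longrightarrow> p * q \<noteq> 0 \<Longrightarrow> p \<in> mpols n"
  unfolding mpols_iff_degree_in by (simp add: degree_in_mult)

lemma mpols_dvd: "p dvd q \<Longrightarrow> q \<in> mpols n \<Longrightarrow> q \<noteq> 0 \<Longrightarrow> p \<in> mpols n"
  unfolding dvd_def using mpols_factor by blast

lemma mpols_mono: "p \<in> mpols n \<Longrightarrow> n \<le> m \<Longrightarrow> p \<in> mpols m"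
  by (auto simp: mpols_iff_degree_in)

lemma mpols_0: "0 \<in> mpols n" by (simp add: mpols_def)

lemma mpols_single: "Poly_Mapping.keys t \<subseteq> {..<n} \<Longrightarrow> Poly_Mapping.single t c \<in> mpols n"
  by (auto simp: mpols_def split: if_splits)

lemma mpols_const: "Poly_Mapping.single 0 c \<in> mpols n"
  by (rule mpols_single) simp

lemma mpols_1: "1 \<in> mpols n"
  using mpols_const[of 1 n] by simp

lemma mpols_add: "p \<in> mpols n \<Longrightarrow> q \<in> mpols n \<Longrightarrow> p + q \<in> mpols n"
  unfolding mpols_def using Poly_Mapping.keys_add[of p q] by blast

lemma mpols_mult: "p \<in> mpols n \<Longrightarrow> q \<in> mpols n \<Longrightarrow> p * q \<in> mpols n"
  by (cases "p = 0 \<or> q = 0") (auto simp: mpols_iff_degree_in degree_in_mult)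

lemma mpols_uminus: "p \<in> mpols n \<Longrightarrow> - p \<in> mpols n"
proof -
  assume "p \<in> mpols n"
  then have "Poly_Mapping.single 0 (- 1) * p \<in> mpols n" by (intro mpols_mult mpols_const)
  then show ?thesis by (simp add: single_uminus)
qed

lemma mpols_diff: "p \<in> mpols n \<Longrightarrow> q \<in> mpols n \<Longrightarrow> p - q \<in> mpols n"
  using mpols_add[of p n "- q"] mpols_uminus[of q n] by simp

lemma mpols_sum: "(\<And>a. a \<in> A \<Longrightarrow> f a \<in> mpols n) \<Longrightarrow> sum f A \<in> mpols n"
  by (induction A rule: infinite_finite_induct) (auto simp: mpols_0 mpols_add)

lemma mpols_power: "p \<in> mpols n \<Longrightarrow> p ^ k \<in> mpols n"
  by (induction k) (auto simp: mpols_1 mpols_mult)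

lemma mpols_exhaust: "\<exists>n. p \<in> mpols n"
proof -
  have fin: "finite (\<Union>t\<in>Poly_Mapping.keys p. Poly_Mapping.keys t)" by simp
  then obtain n where "(\<Union>t\<in>Poly_Mapping.keys p. Poly_Mapping.keys t) \<subseteq> {..<n}"
    using finite_nat_iff_bounded by blast
  then show ?thesis unfolding mpols_def by blast
qed

section \<open>Derivatives lower degrees\<close>

lemma mpol_deriv_0: "mpol_deriv i 0 = 0" by (simp add: mpol_deriv_def)

lemma mpols_deriv: "p \<in> mpols n \<Longrightarrow> mpol_deriv i p \<in> mpols n"
  unfolding mpol_deriv_def
proof (intro mpols_sum mpols_single)
  fix t assume "p \<in> mpols n" "t \<in> Poly_Mapping.keys p"
  then have "Poly_Mapping.keys t \<subseteq> {..<n}" by (auto simp: mpols_def)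
  moreover have "Poly_Mapping.keys (t - Poly_Mapping.single i 1) \<subseteq> Poly_Mapping.keys t"
  proof
    fix j assume "j \<in> Poly_Mapping.keys (t - Poly_Mapping.single i 1)"
    then have "Poly_Mapping.lookup t j - Poly_Mapping.lookup (Poly_Mapping.single i 1) j \<noteq> 0"
      by (simp only: in_keys_iff lookup_minus not_False_eq_True)
    then have "Poly_Mapping.lookup t j \<noteq> 0" by linarith
    then show "j \<in> Poly_Mapping.keys t" by (simp only: in_keys_iff not_False_eq_True)
  qed
  ultimately show "Poly_Mapping.keys (t - Poly_Mapping.single i 1) \<subseteq> {..<n}" by blast
qed

text \<open>Exponents in which x_i occurs stay distinct when x_i is lowered by one, so nothing
  cancels, and in characteristic 0 the factor \<open>lookup t i\<close> does not kill a
  coefficient.\<close>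

lemma mpol_deriv_zero_iff_degree_in: "mpol_deriv i p = 0 \<longleftrightarrow> degree_in i p = 0"
proof
  assume d: "degree_in i p = 0"
  then have "\<forall>t\<in>Poly_Mapping.keys p. Poly_Mapping.lookup t i = 0"
    unfolding degree_in_wdeg using wdeg_le_iff[of _ p 0] by simp
  then show "mpol_deriv i p = 0"
    unfolding mpol_deriv_def by (intro sum.neutral) auto
next
  assume d: "mpol_deriv i p = 0"
  have "Poly_Mapping.lookup t i = 0" if t: "t \<in> Poly_Mapping.keys p" for t
  proof (rule ccontr)
    assume ti: "Poly_Mapping.lookup t i \<noteq> 0"
    let ?u = "Poly_Mapping.single i (1::nat)"
    have "Poly_Mapping.lookup (mpol_deriv i p) (t - ?u) =
      (\<Sum>s\<in>Poly_Mapping.keys p. if s = t then of_nat (Poly_Mapping.lookup t i) * Poly_Mapping.lookup p t else 0)"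
      unfolding mpol_deriv_def Poly_Mapping.lookup_sum
    proof (intro sum.cong refl)
      fix s assume s: "s \<in> Poly_Mapping.keys p"
      show "Poly_Mapping.lookup (Poly_Mapping.single (s - ?u)
          (of_nat (Poly_Mapping.lookup s i) * Poly_Mapping.lookup p s)) (t - ?u) =
        (if s = t then of_nat (Poly_Mapping.lookup t i) * Poly_Mapping.lookup p t else 0)"
      proof (cases "Poly_Mapping.lookup s i = 0")
        case True
        then show ?thesis using ti by auto
      next
        case False
        have "s = t" if "s - ?u = t - ?u"
        proof (rule poly_mapping_eqI)
          fix j
          have "Poly_Mapping.lookup (s - ?u) j = Poly_Mapping.lookup (t - ?u) j" using that by simp
          then show "Poly_Mapping.lookup s j = Poly_Mapping.lookup t j"
            using ti False by (cases "j = i") (auto simp: lookup_minus lookup_single)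
        qed
        then show ?thesis by (auto simp: lookup_single when_def)
      qed
    qed
    also have "\<dots> = of_nat (Poly_Mapping.lookup t i) * Poly_Mapping.lookup p t"
      using t by (subst sum.delta) auto
    also have "\<dots> \<noteq> 0" using ti t by (simp add: in_keys_iff)
    finally show False using d by simp
  qed
  then show "degree_in i p = 0"
    unfolding degree_in_wdeg using wdeg_le_iff[of _ p 0] by simp
qed

lemma tdeg_deriv_less:
  assumes "mpol_deriv i p \<noteq> 0"
  shows "tdeg (mpol_deriv i p) < tdeg p"
proof -
  have deg: "exp_deg (t - Poly_Mapping.single i 1) < exp_deg t" if "Poly_Mapping.lookup t i \<noteq> 0" for t
  proof -
    have "t = (t - Poly_Mapping.single i 1) + Poly_Mapping.single i 1"
      using single_minus_add[of t i "Poly_Mapping.single i 1"] that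
      by (simp del: One_nat_def)
    then have "exp_deg t = exp_deg (t - Poly_Mapping.single i 1) + exp_deg (Poly_Mapping.single i 1)"
      using additive_exp_deg unfolding additive_nat_def by metis
    then show ?thesis by (simp add: exp_deg_def)
  qed
  have pos: "0 < tdeg p"
  proof (rule ccontr)
    assume "\<not> 0 < tdeg p"
    then obtain c where "p = Poly_Mapping.single 0 c" using tdeg_eq_0_iff[of p] by auto
    then show False using assms by (simp add: mpol_deriv_single)
  qed
  show ?thesis
    unfolding wdeg_less_iff[of exp_deg "mpol_deriv i p"]
  proof (intro conjI ballI pos)
    fix t assume "t \<in> Poly_Mapping.keys (mpol_deriv i p)"
    then obtain s where s: "s \<in> Poly_Mapping.keys p" "t \<in> Poly_Mapping.keys (Poly_Mapping.single
       (s - Poly_Mapping.single i 1) (of_nat (Poly_Mapping.lookup s i) * Poly_Mapping.lookup p s))"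
      unfolding mpol_deriv_def by (metis (no_types, lifting) in_keys_iff lookup_sum sum.neutral)
    then have "t = s - Poly_Mapping.single i 1" "Poly_Mapping.lookup s i \<noteq> 0"
      by (auto split: if_splits)
    then have "exp_deg t < exp_deg s" using deg by simp
    also have "exp_deg s \<le> tdeg p" using wdeg_le_iff[of exp_deg p "tdeg p"] s(1) by simp
    finally show "exp_deg t < tdeg p" .
  qed
qed

lemma degree_in_deriv_less:
  assumes "mpol_deriv i p \<noteq> 0"
  shows "degree_in i (mpol_deriv i p) < degree_in i p"
proof -
  have pos: "0 < degree_in i p" using assms mpol_deriv_zero_iff_degree_in[of i p] by simp
  show ?thesis
    unfolding degree_in_wdeg wdeg_less_iff[of _ "mpol_deriv i p"]
  proof (intro conjI ballI pos[unfolded degree_in_wdeg])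
    fix t assume "t \<in> Poly_Mapping.keys (mpol_deriv i p)"
    then obtain s where s: "s \<in> Poly_Mapping.keys p" "t \<in> Poly_Mapping.keys (Poly_Mapping.single
       (s - Poly_Mapping.single i 1) (of_nat (Poly_Mapping.lookup s i) * Poly_Mapping.lookup p s))"
      unfolding mpol_deriv_def by (metis (no_types, lifting) in_keys_iff lookup_sum sum.neutral)
    then have "t = s - Poly_Mapping.single i 1" "Poly_Mapping.lookup s i \<noteq> 0"
      by (auto split: if_splits)
    then have "Poly_Mapping.lookup t i < Poly_Mapping.lookup s i" by (simp add: lookup_minus)
    also have "Poly_Mapping.lookup s i \<le> wdeg (\<lambda>t. Poly_Mapping.lookup t i) p"
      using wdeg_le_iff[of "\<lambda>t. Poly_Mapping.lookup t i" p] s(1) by blast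
    finally show "Poly_Mapping.lookup t i < wdeg (\<lambda>t. Poly_Mapping.lookup t i) p" .
  qed
qed

section \<open>Polynomials over subrings\<close>

locale ring_deriv =
  fixes D :: "'b::idom \<Rightarrow> 'b"
  assumes add: "D (u + v) = D u + D v" and mult: "D (u * v) = D u * v + u * D v"
begin

lemma zero: "D 0 = 0"
  using add[of 0 0] by (simp only: add_0_right add_cancel_right_right)

lemma one: "D 1 = 0"
  using mult[of 1 1] by (simp only: mult_1_right mult_1_left add_cancel_right_right)

lemma minus: "D (- u) = - D u"
  using add[of u "- u"] by (simp add: zero eq_neg_iff_add_eq_0 add.commute)

lemma diff: "D (u - v) = D u - D v"
  using add[of u "- v"] by (simp add: minus)

lemma of_nat: "D (of_nat n) = 0"
  by (induction n) (simp_all add: zero one add)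

lemma sum: "D (sum f A) = (\<Sum>a\<in>A. D (f a))"
  by (induction A rule: infinite_finite_induct) (simp_all add: zero add)

lemma poly: "D (poly P x) = poly (map_poly D P) x + poly (pderiv P) x * D x"
  by (induction P) (simp_all add: zero add mult map_poly_pCons pderiv_pCons algebra_simps)

lemma poly_const:
  assumes "\<And>i. D (coeff P i) = 0"
  shows "D (poly P x) = poly (pderiv P) x * D x"
proof -
  have "map_poly D P = 0" by (rule poly_eqI) (simp add: coeff_map_poly zero assms)
  then show ?thesis by (simp add: poly)
qed

end

lemma derivation_imp_ring_deriv: "derivation D \<Longrightarrow> ring_deriv D"
  by (simp add: derivation_def ring_deriv_def)

lemma ring_deriv_mpol_deriv: "ring_deriv (mpol_deriv i)"
  by standard (simp_all add: mpol_deriv_add mpol_deriv_mult)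

text \<open>Applying \<open>D\<close> to a relation for \<open>x\<close> gives the relation
  \<open>pderiv P\<close>, of smaller degree in characteristic 0, until only a constant is left.
  Nothing has to be known about the ring of coefficients beyond their being killed by
  \<open>D\<close>.\<close>

lemma poly_transcendental:
  fixes D :: "'b::{idom, ring_char_0} \<Rightarrow> 'b"
  assumes "ring_deriv D" "D x = 1" "\<And>i. D (coeff P i) = 0" "poly P x = 0"
  shows "P = 0"
  using assms(3,4)
proof (induction "degree P" arbitrary: P rule: less_induct)
  case less
  interpret ring_deriv D by fact
  have p: "poly (pderiv P) x = 0"
    using poly_const[of P x] less.prems assms(2) by (simp add: zero)
  have c: "D (coeff (pderiv P) i) = 0" for i
    by (simp add: coeff_pderiv mult less.prems(1) of_nat del: of_nat_Suc)
  have "degree P = 0"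
  proof (rule ccontr)
    assume d: "degree P \<noteq> 0"
    then have "degree (pderiv P) < degree P" by (simp add: degree_pderiv)
    then have "pderiv P = 0" using less.hyps p c by blast
    then show False using d by (simp add: pderiv_eq_0_iff)
  qed
  then obtain a where "P = [:a:]" by (rule degree_eq_zeroE)
  then show ?case using less.prems by simp
qed

definition is_subring :: "'b::comm_ring_1 set \<Rightarrow> bool" where
  "is_subring S \<longleftrightarrow> 1 \<in> S \<and> (\<forall>u\<in>S. \<forall>v\<in>S. u - v \<in> S \<and> u * v \<in> S)"

locale subring_set =
  fixes S :: "'b::idom set"
  assumes subring: "is_subring S"
begin

lemma one: "1 \<in> S" using subring by (simp add: is_subring_def)

lemma diff: "u \<in> S \<Longrightarrow> v \<in> S \<Longrightarrow> u - v \<in> S" using subring by (simp add: is_subring_def)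

lemma mult: "u \<in> S \<Longrightarrow> v \<in> S \<Longrightarrow> u * v \<in> S" using subring by (simp add: is_subring_def)

lemma zero: "0 \<in> S" using diff[OF one one] by simp

lemma minus: "u \<in> S \<Longrightarrow> - u \<in> S" using diff[OF zero] by fastforce

lemma add: "u \<in> S \<Longrightarrow> v \<in> S \<Longrightarrow> u + v \<in> S" using diff[of u "- v"] minus by simp

lemma of_nat: "of_nat n \<in> S" by (induction n) (simp_all add: zero one add)

lemma sum: "(\<And>a. a \<in> A \<Longrightarrow> f a \<in> S) \<Longrightarrow> sum f A \<in> S"
  by (induction A rule: infinite_finite_induct) (simp_all add: zero add)

lemma prod: "(\<And>a. a \<in> A \<Longrightarrow> f a \<in> S) \<Longrightarrow> prod f A \<in> S"
  by (induction A rule: infinite_finite_induct) (simp_all add: one mult)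

lemma power: "u \<in> S \<Longrightarrow> u ^ n \<in> S" by (induction n) (simp_all add: one mult)

lemma polys_coeff: "P \<in> polys_over S \<Longrightarrow> coeff P i \<in> S" by (simp add: polys_over_def)

lemma polys_add: "P \<in> polys_over S \<Longrightarrow> Q \<in> polys_over S \<Longrightarrow> P + Q \<in> polys_over S"
  by (simp add: polys_over_def add)

lemma polys_diff: "P \<in> polys_over S \<Longrightarrow> Q \<in> polys_over S \<Longrightarrow> P - Q \<in> polys_over S"
  by (simp add: polys_over_def diff)

lemma polys_minus: "P \<in> polys_over S \<Longrightarrow> - P \<in> polys_over S"
  by (simp add: polys_over_def minus)

lemma polys_mult: "P \<in> polys_over S \<Longrightarrow> Q \<in> polys_over S \<Longrightarrow> P * Q \<in> polys_over S"
  by (simp add: polys_over_def coeff_mult sum mult)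

lemma polys_smult: "c \<in> S \<Longrightarrow> P \<in> polys_over S \<Longrightarrow> smult c P \<in> polys_over S"
  by (simp add: polys_over_def mult)

lemma polys_monom: "c \<in> S \<Longrightarrow> Polynomial.monom c n \<in> polys_over S"
  by (simp add: polys_over_def zero)

lemma polys_0: "0 \<in> polys_over S"
  by (simp add: polys_over_def zero)

lemma polys_pCons: "c \<in> S \<Longrightarrow> P \<in> polys_over S \<Longrightarrow> pCons c P \<in> polys_over S"
  by (simp add: polys_over_def coeff_pCons split: nat.split)

lemma polys_1: "1 \<in> polys_over S"
  using polys_pCons[OF one polys_0] by (simp add: pCons_one)

lemma polys_pderiv: "P \<in> polys_over S \<Longrightarrow> pderiv P \<in> polys_over S"
  by (simp add: polys_over_def coeff_pderiv mult of_nat del: of_nat_Suc)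

lemma polys_sum: "(\<And>a. a \<in> A \<Longrightarrow> f a \<in> polys_over S) \<Longrightarrow> Groups_Big.sum f A \<in> polys_over S"
  by (induction A rule: infinite_finite_induct) (simp_all add: polys_0 polys_add)

lemma polys_prod: "(\<And>a. a \<in> A \<Longrightarrow> f a \<in> polys_over S) \<Longrightarrow> Groups_Big.prod f A \<in> polys_over S"
  by (induction A rule: infinite_finite_induct) (simp_all add: polys_1 polys_mult)

lemma polys_power: "P \<in> polys_over S \<Longrightarrow> P ^ n \<in> polys_over S"
  by (induction n) (simp_all add: polys_1 polys_mult)

lemma poly_in: "P \<in> polys_over S \<Longrightarrow> x \<in> S \<Longrightarrow> poly P x \<in> S"
  by (simp add: poly_altdef sum mult power polys_coeff)

end

text \<open>Scaling by the leading coefficient before each cancellation keeps quotient and remainder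
  over \<open>S\<close>, where that coefficient may fail to be invertible.\<close>

lemma pseudo_division:
  fixes D :: "'b::idom poly"
  assumes "is_subring S" "D \<in> polys_over S" "D \<noteq> 0" "P \<in> polys_over S"
  shows "\<exists>k Q R. Q \<in> polys_over S \<and> R \<in> polys_over S \<and>
    smult (lead_coeff D ^ k) P = D * Q + R \<and>
    (R = 0 \<or> degree R < degree D)"
  using assms(4)
proof (induction "degree P" arbitrary: P rule: less_induct)
  case less
  interpret subring_set S by standard fact
  let ?l = "lead_coeff D"
  have l: "?l \<in> S" using assms(2) by (rule polys_coeff)
  show ?case
  proof (cases "P = 0 \<or> degree P < degree D")
    case True
    then have "smult (?l ^ 0) P = D * 0 + P \<and> (P = 0 \<or> degree P < degree D)"
      by simp
    then show ?thesis using less.prems polys_0 by blast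
  next
    case False
    then have P: "P \<noteq> 0" and deg: "degree D \<le> degree P" by auto
    define M where "M = Polynomial.monom (lead_coeff P) (degree P - degree D)"
    define P' where "P' = smult ?l P - D * M"
    have M: "M \<in> polys_over S" unfolding M_def by (intro polys_monom polys_coeff less.prems)
    have P': "P' \<in> polys_over S" unfolding P'_def by (intro polys_diff polys_smult polys_mult l M assms less.prems)
    have dM: "degree (D * M) = degree P"
      proof -
      have "degree M = degree P - degree D"
        unfolding M_def by (rule degree_monom_eq) (simp add: P)
      moreover have "M \<noteq> 0" using P by (simp add: M_def monom_eq_0_iff)
      ultimately show ?thesis using deg assms(3) by (simp add: degree_mult_eq)
    qed
    have dl: "degree (smult ?l P) = degree P" using assms(3) by simp
    have lc: "lead_coeff (D * M) = lead_coeff (smult ?l P)"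
      by (simp only: lead_coeff_mult lead_coeff_smult M_def lead_coeff_monom)
    have c0: "coeff P' (degree P) = 0"
      using lc unfolding P'_def dM dl by simp
    have le: "degree P' \<le> degree P"
      unfolding P'_def by (rule degree_diff_le) (simp_all only: dM dl order_refl)
    have *: "P' = 0 \<or> degree P' < degree P"
      using c0 le by (metis leading_coeff_0_iff le_neq_implies_less)
    have "\<exists>k Q R. Q \<in> polys_over S \<and> R \<in> polys_over S \<and>
      smult (?l ^ k) P' = D * Q + R \<and>
      (R = 0 \<or> degree R < degree D)"
    proof (cases "P' = 0")
      case True
      then have "smult (?l ^ 0) P' = D * 0 + 0" by simp
      then show ?thesis using polys_0 by blast
    next
      case False
      then show ?thesis using less.hyps[OF _ P'] * by blast
    qed
    then obtain k Q R where kQR: "Q \<in> polys_over S" "R \<in> polys_over S"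
      "smult (?l ^ k) P' = D * Q + R" "R = 0 \<or> degree R < degree D"
      by blast
    have "smult (?l ^ Suc k) P = smult (?l ^ k) P' + smult (?l ^ k) (D * M)"
      by (simp add: P'_def smult_diff_right mult.commute)
    also have "\<dots> = D * (Q + smult (?l ^ k) M) + R"
      by (simp add: kQR(3) algebra_simps)
    finally show ?thesis
      using kQR polys_add[OF kQR(1) polys_smult[OF power[OF l] M]] by blast
  qed
qed

section \<open>k[x_1, ..., x_(n+1)] as univariate polynomials over k[x_1, ..., x_n]\<close>

lemma is_subring_mpols: "is_subring (mpols n)"
  by (simp add: is_subring_def mpols_1 mpols_diff mpols_mult)

abbreviation mvar :: "nat \<Rightarrow> 'a::field_char_0 mpol" where
  "mvar n \<equiv> Poly_Mapping.single (Poly_Mapping.single n 1) 1"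

lemma mvar_power: "mvar n ^ k = Poly_Mapping.single (Poly_Mapping.single n k) 1"
  by (induction k) (simp_all add: mult_single single_add[symmetric])

lemma mvar_in_mpols: "n < m \<Longrightarrow> mvar n \<in> mpols m"
  by (rule mpols_single) simp

lemma mpol_deriv_mvar: "mpol_deriv i (mvar n) = (if i = n then 1 else 0)"
  by (simp add: mpol_deriv_single lookup_single)

lemma mpols_deriv_0: "p \<in> mpols n \<Longrightarrow> n \<le> i \<Longrightarrow> mpol_deriv i p = 0"
  by (simp add: mpol_deriv_zero_iff_degree_in mpols_iff_degree_in)

lemma mpols_SucE:
  assumes "p \<in> mpols (Suc n)"
  obtains P where "P \<in> polys_over (mpols n)" "p = poly P (mvar n)"
proof -
  interpret subring_set "mpols n :: 'a mpol set" by standard (rule is_subring_mpols)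
  \<comment> \<open>The monomial \<open>t\<close> with its power of the variable of index
    \<open>n\<close> removed; that power becomes the univariate exponent.\<close>
  define rest where "rest t = t - Poly_Mapping.single n (Poly_Mapping.lookup t n)" for t :: "nat \<Rightarrow>\<^sub>0 nat"
  have rest_eq: "rest t + Poly_Mapping.single n (Poly_Mapping.lookup t n) = t" for t
    by (rule poly_mapping_eqI) (auto simp: rest_def lookup_add lookup_minus lookup_single when_def)
  define P where "P = (\<Sum>t\<in>Poly_Mapping.keys p. Polynomial.monom
    (Poly_Mapping.single (rest t) (Poly_Mapping.lookup p t)) (Poly_Mapping.lookup t n))"
  show ?thesis
  proof
    show "P \<in> polys_over (mpols n)"
      unfolding P_def
    proof (intro polys_sum polys_monom)
      fix t assume t: "t \<in> Poly_Mapping.keys p"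
      have "Poly_Mapping.lookup (rest t) i = 0" if "n \<le> i" for i
        using assms t that unfolding mpols_iff_lookup rest_def
        by (cases "i = n") (simp_all add: lookup_minus lookup_single)
      then show "Poly_Mapping.single (rest t) (Poly_Mapping.lookup p t) \<in> mpols n"
        unfolding mpols_iff_lookup by simp
    qed
    have "p = (\<Sum>t\<in>Poly_Mapping.keys p. Poly_Mapping.single t (Poly_Mapping.lookup p t))"
      by (rule poly_mapping_eqI)
        (auto simp: Poly_Mapping.lookup_sum lookup_single when_def in_keys_iff sum.delta)
    also have "\<dots> = poly P (mvar n)"
      unfolding P_def poly_sum poly_monom mvar_power mult_single rest_eq by simp
    finally show "p = poly P (mvar n)" .
  qed
qed

lemma poly_mvar_in_mpols: "P \<in> polys_over (mpols n) \<Longrightarrow> poly P (mvar n) \<in> mpols (Suc n)"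
proof -
  assume P: "P \<in> polys_over (mpols n)"
  interpret subring_set "mpols (Suc n) :: 'a mpol set" by standard (rule is_subring_mpols)
  have "P \<in> polys_over (mpols (Suc n))" using P by (auto simp: polys_over_def intro: mpols_mono)
  then show ?thesis by (rule poly_in) (rule mvar_in_mpols, simp)
qed

lemma poly_mvar_eq_0: "P \<in> polys_over (mpols n) \<Longrightarrow> poly P (mvar n) = 0 \<Longrightarrow> P = 0"
  by (rule poly_transcendental[OF ring_deriv_mpol_deriv[of n], of "mvar n"])
    (simp_all only: mpol_deriv_mvar refl if_True polys_over_def mem_Collect_eq mpols_deriv_0[OF _ order_refl])

lemma poly_mvar_inj:
  assumes "P \<in> polys_over (mpols n)" "Q \<in> polys_over (mpols n)" "poly P (mvar n) = poly Q (mvar n)"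
  shows "P = Q"
proof -
  interpret subring_set "mpols n :: 'a mpol set" by standard (rule is_subring_mpols)
  have "P - Q = 0"
    by (rule poly_mvar_eq_0[of _ n]) (simp_all only: polys_diff assms poly_diff diff_self)
  then show ?thesis by simp
qed

section \<open>Prime factors in multivariate polynomial rings\<close>

lemma irreducible_factor_exists:
  fixes p :: "'a::field_char_0 mpol"
  assumes "p \<noteq> 0" "\<not> p dvd 1"
  shows "\<exists>q. irreducible q \<and> q dvd p"
  using assms
proof (induction "tdeg p" arbitrary: p rule: less_induct)
  case less
  show ?case
  proof (cases "irreducible p")
    case False
    then obtain a b where ab: "p = a * b" "\<not> a dvd 1" "\<not> b dvd 1"
      using less.prems unfolding irreducible_def by metis
    have "a \<noteq> 0" "b \<noteq> 0" using ab less.prems by auto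
    then have "tdeg a < tdeg p" using ab tdeg_mult[of a b] mpol_unit_iff[of b] by simp
    then obtain q where "irreducible q" "q dvd a" using less.hyps \<open>a \<noteq> 0\<close> ab by blast
    then show ?thesis using ab(1) dvd_mult2 by metis
  qed auto
qed

lemma tdeg_factor_less:
  fixes q :: "'a::field_char_0 mpol"
  assumes "q * r \<noteq> 0" "\<not> q dvd 1"
  shows "tdeg r < tdeg (q * r)"
  using assms tdeg_mult[of q r] mpol_unit_iff[of q] by simp

text \<open>By \<open>mpols_factor\<close> the cofactor is again a polynomial in the variable of
  index \<open>n\<close> over \<open>mpols n\<close>, so coefficients may be compared.\<close>

lemma mpol_dvd_poly_iff:
  assumes "r \<in> mpols n" "r \<noteq> 0" "P \<in> polys_over (mpols n)"
  shows "r dvd poly P (mvar n) \<longleftrightarrow> (\<forall>i. r dvd coeff P i)"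
proof
  interpret subring_set "mpols n :: 'a mpol set" by standard (rule is_subring_mpols)
  assume dvd: "r dvd poly P (mvar n)"
  show "\<forall>i. r dvd coeff P i"
  proof (cases "poly P (mvar n) = 0")
    case True
    then show ?thesis using poly_mvar_eq_0[OF assms(3)] by simp
  next
    case False
    obtain c where c: "poly P (mvar n) = r * c" using dvd by (rule dvdE)
    have "c * r \<in> mpols (Suc n)" using poly_mvar_in_mpols[OF assms(3)] c by (simp add: mult.commute)
    then have "c \<in> mpols (Suc n)" using mpols_factor[of c r] False c by (simp add: mult.commute)
    then obtain C where C: "C \<in> polys_over (mpols n)" "c = poly C (mvar n)" by (rule mpols_SucE)
    have "P = smult r C"
      using c C(2) by (intro poly_mvar_inj[OF assms(3)] polys_smult assms C(1)) simp
    then show ?thesis by simp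
  qed
next
  assume "\<forall>i. r dvd coeff P i"
  then show "r dvd poly P (mvar n)" unfolding poly_altdef by (intro dvd_sum dvd_mult2) simp
qed

text \<open>Gauss's argument, with x the variable of index \<open>n\<close> and "constant" meaning
  free of x. A nonzero combination \<open>d\<close> of p and a of least degree in x divides both up
  to constant factors. If \<open>d\<close> is constant, then p divides a constant multiple of b;
  otherwise p divides a constant multiple of a, because \<open>d\<close> agrees with p up to
  constants. The constants are removed prime by prime.\<close>

lemma irreducible_imp_prime_step:
  fixes n :: nat
  assumes IH: "\<And>p a b :: 'a::field_char_0 mpol. irreducible p \<Longrightarrow> p \<in> mpols n \<Longrightarrow> a \<in> mpols n \<Longrightarrow>
    b \<in> mpols n \<Longrightarrow> p dvd a * b \<Longrightarrow> p dvd a \<or> p dvd b"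
  assumes p: "irreducible (p :: 'a mpol)" "p \<in> mpols (Suc n)" and ab: "a \<in> mpols (Suc n)" "b \<in> mpols (Suc n)"
    and dvd: "p dvd a * b"
  shows "p dvd a \<or> p dvd b"
proof -
  interpret subring_set "mpols n :: 'a mpol set" by standard (rule is_subring_mpols)
  have prime_const: "r dvd A \<or> r dvd B"
    if r: "irreducible r" "r \<in> mpols n" and A: "A \<in> mpols (Suc n)" and B: "B \<in> mpols (Suc n)"
      and rAB: "r dvd A * B" for r A B :: "'a mpol"
  proof (rule ccontr)
    assume not: "\<not> (r dvd A \<or> r dvd B)"
    have r0: "r \<noteq> 0" using r by (simp add: irreducible_def)
    obtain P where P: "P \<in> polys_over (mpols n)" "A = poly P (mvar n)" using A by (rule mpols_SucE)
    obtain Q where Q: "Q \<in> polys_over (mpols n)" "B = poly Q (mvar n)" using B by (rule mpols_SucE)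
    \<comment> \<open>The first coefficients of \<open>P\<close> and \<open>Q\<close> that
      \<open>r\<close> does not divide. In the coefficient of \<open>P * Q\<close> at
      \<open>i + j\<close> every other summand has a factor divisible by \<open>r\<close>, so
      \<open>r\<close> divides the remaining product of two constants.\<close>
    define i where "i = (LEAST i. \<not> r dvd coeff P i)"
    define j where "j = (LEAST j. \<not> r dvd coeff Q j)"
    have exi: "\<exists>i. \<not> r dvd coeff P i"
      using not mpol_dvd_poly_iff[OF r(2) r0 P(1)] P(2) by blast
    have exj: "\<exists>j. \<not> r dvd coeff Q j"
      using not mpol_dvd_poly_iff[OF r(2) r0 Q(1)] Q(2) by blast
    have i: "\<not> r dvd coeff P i" unfolding i_def using exi by (rule LeastI_ex)
    have j: "\<not> r dvd coeff Q j" unfolding j_def using exj by (rule LeastI_ex)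
    have il: "r dvd coeff P k" if "k < i" for k using not_less_Least that unfolding i_def by blast
    have jl: "r dvd coeff Q k" if "k < j" for k using not_less_Least that unfolding j_def by blast
    have "r dvd poly (P * Q) (mvar n)" using rAB P(2) Q(2) by simp
    then have "r dvd coeff (P * Q) (i + j)"
      using mpol_dvd_poly_iff[OF r(2) r0 polys_mult[OF P(1) Q(1)]] by blast
    also have "coeff (P * Q) (i + j) = (\<Sum>k\<in>{..i+j}. coeff P k * coeff Q (i + j - k))"
      by (simp add: coeff_mult)
    also have "\<dots> = coeff P i * coeff Q j
       + (\<Sum>k\<in>{..i+j} - {i}. coeff P k * coeff Q (i + j - k))"
      by (subst sum.remove[of _ i]) simp_all
    finally have *: "r dvd coeff P i * coeff Q j
       + (\<Sum>k\<in>{..i+j} - {i}. coeff P k * coeff Q (i + j - k))" .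
    have "r dvd (\<Sum>k\<in>{..i+j} - {i}. coeff P k * coeff Q (i + j - k))"
    proof (rule dvd_sum)
      fix k assume k: "k \<in> {..i+j} - {i}"
      show "r dvd coeff P k * coeff Q (i + j - k)"
      proof (cases "k < i")
        case True
        then show ?thesis using il by (simp add: dvd_mult2)
      next
        case False
        then have "i + j - k < j" using k by auto
        then show ?thesis using jl by (simp add: dvd_mult)
      qed
    qed
    then have "r dvd coeff P i * coeff Q j"
      using * dvd_add_left_iff by blast
    then show False using IH[OF r polys_coeff[OF P(1)] polys_coeff[OF Q(1)]] i j by blast
  qed
  \<comment> \<open>A prime factor \<open>q\<close> of the constant \<open>r\<close> divides
    \<open>p * B\<close> but not \<open>p\<close>, since otherwise the irreducible \<open>p\<close>
    would be an associate of \<open>q\<close> and hence constant. So \<open>q\<close> divides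
    \<open>B\<close> and cancels.\<close>
  have cancel_const: "p dvd A"
    if "p \<notin> mpols n" "r \<in> mpols n" "r \<noteq> 0" "A \<in> mpols (Suc n)" "p dvd r * A" for r A
    using that(2-)
  proof (induction "tdeg r" arbitrary: r A rule: less_induct)
    case less
    show ?case
    proof (cases "r dvd 1 \<or> A = 0")
      case True
      then show ?thesis
      proof
        assume "r dvd 1"
        then obtain s where s: "1 = r * s" by (rule dvdE)
        have "A = s * (r * A)" using s by (metis mult.assoc mult.commute mult_1_left)
        then show ?thesis using less.prems(4) by (metis dvd_mult)
      qed simp
    next
      case False
      then obtain q where q: "irreducible q" "q dvd r" using irreducible_factor_exists less.prems by blast
      obtain r' where r': "r = q * r'" using q(2) by (rule dvdE)
      have qn: "q \<in> mpols n" using mpols_dvd[OF q(2)] less.prems by blast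
      have nu: "\<not> q dvd 1" "q \<noteq> 0" using q(1) by (simp_all add: irreducible_def)
      obtain B where B: "r * A = p * B" using less.prems(4) by (rule dvdE)
      have rA: "r * A \<in> mpols (Suc n)" using less.prems by (intro mpols_mult) (simp_all add: mpols_mono[of r n])
      have B': "B \<in> mpols (Suc n)"
      proof (rule mpols_dvd[OF _ rA])
        show "B dvd r * A" using B by simp
        show "r * A \<noteq> 0" using False less.prems by simp
      qed
      have "q dvd p * B" using B r' by (metis dvd_triv_left mult.assoc)
      then have "q dvd p \<or> q dvd B" using prime_const[OF q(1) qn p(2) B'] by blast
      moreover have "\<not> q dvd p"
      proof
        assume "q dvd p"
        then obtain s where s: "p = q * s" by (rule dvdE)
        then have "s dvd 1" using p(1) nu unfolding irreducible_def by blast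
        then obtain s' where "1 = s * s'" by (rule dvdE)
        then have "q = p * s'" using s by (metis mult.assoc mult_1_right)
        then have "p \<in> mpols n" using mpols_factor[of p s' n] qn nu by simp
        then show False using that(1) by contradiction
      qed
      ultimately obtain C where C: "B = q * C" using dvdE by blast
      have "q * (r' * A) = q * (p * C)" using B C r' by (simp add: mult_ac)
      then have "r' * A = p * C" using nu by simp
      then have d: "p dvd r' * A" by simp
      have r'0: "r' \<noteq> 0" using r' less.prems by auto
      have "tdeg r' < tdeg r" using tdeg_factor_less[of q r'] nu r' less.prems by simp
      moreover have "r' \<in> mpols n" using mpols_dvd[of r' r n] r' less.prems by simp
      ultimately show ?thesis using less.hyps r'0 less.prems d by blast
    qed
  qed
  \<comment> \<open>Turns a factorization of a constant multiple of \<open>p\<close> into one of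
    \<open>p\<close>: each prime of \<open>r\<close> is taken out of \<open>d\<close>, where it is
    collected in \<rho>, or out of \<open>u\<close>.\<close>
  have strip_const: "\<exists>\<rho> d' u'. \<rho> \<in> mpols n \<and> \<rho> \<noteq> 0 \<and> d = \<rho> * d' \<and> p = d' * u'"
    if "r \<in> mpols n" "r \<noteq> 0" "d \<in> mpols (Suc n)" "u \<in> mpols (Suc n)" "d * u = r * p" for r d u
    using that
  proof (induction "tdeg r" arbitrary: r d u rule: less_induct)
    case less
    have p0: "p \<noteq> 0" using p(1) by (simp add: irreducible_def)
    have du0: "d \<noteq> 0" "u \<noteq> 0" using less.prems p0 by auto
    show ?case
    proof (cases "r dvd 1")
      case True
      then obtain s where s: "1 = r * s" by (rule dvdE)
      have "d * (u * s) = (r * s) * p" using less.prems(5) by (simp only: mult.assoc[symmetric]) (simp only: mult_ac)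
      then have "p = d * (u * s)" by (simp only: s[symmetric] mult_1_left)
      then show ?thesis using mpols_1[of n] by (intro exI[of _ 1] exI[of _ d] exI[of _ "u * s"]) simp
    next
      case False
      then obtain q where q: "irreducible q" "q dvd r" using irreducible_factor_exists less.prems by blast
      obtain r' where r': "r = q * r'" using q(2) by (rule dvdE)
      have qn: "q \<in> mpols n" using mpols_dvd[OF q(2)] less.prems by blast
      have nu: "\<not> q dvd 1" "q \<noteq> 0" using q(1) by (simp_all add: irreducible_def)
      have r'0: "r' \<noteq> 0" using r' less.prems by auto
      have lt: "tdeg r' < tdeg r" using tdeg_factor_less[of q r'] nu r' less.prems by simp
      have r'n: "r' \<in> mpols n" using mpols_dvd[of r' r n] r' less.prems by simp
      have "q dvd d * u" using less.prems(5) r' by (metis dvd_triv_left mult.assoc)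
      then have "q dvd d \<or> q dvd u" using prime_const[OF q(1) qn less.prems(3,4)] by blast
      then show ?thesis
      proof
        assume "q dvd d"
        then obtain d1 where d1: "d = q * d1" by (rule dvdE)
        have "q * (d1 * u) = q * (r' * p)" using less.prems(5) d1 r' by (simp add: mult_ac)
        then have e: "d1 * u = r' * p" using nu by simp
        have d1S: "d1 \<in> mpols (Suc n)" using mpols_dvd[of d1 d "Suc n"] d1 less.prems du0 by simp
        obtain \<rho> d' u' where *: "\<rho> \<in> mpols n" "\<rho> \<noteq> 0" "d1 = \<rho> * d'" "p = d' * u'"
          using less.hyps[OF lt r'n r'0 d1S less.prems(4) e] by blast
        have "q * \<rho> \<in> mpols n" "q * \<rho> \<noteq> 0" "d = (q * \<rho>) * d'"
          using * qn nu d1 by (simp_all add: mpols_mult mult.assoc)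
        then show ?thesis using *(4) by blast
      next
        assume "q dvd u"
        then obtain u1 where u1: "u = q * u1" by (rule dvdE)
        have "q * (d * u1) = q * (r' * p)" using less.prems(5) u1 r' by (simp add: mult_ac)
        then have e: "d * u1 = r' * p" using nu by simp
        have u1S: "u1 \<in> mpols (Suc n)" using mpols_dvd[of u1 u "Suc n"] u1 less.prems du0 by simp
        show ?thesis using less.hyps[OF lt r'n r'0 less.prems(3) u1S e] .
      qed
    qed
  qed
  show ?thesis
  proof (cases "p \<in> mpols n")
    case True
    then show ?thesis using prime_const p ab dvd by blast
  next
    case pn: False
    obtain P where P: "P \<in> polys_over (mpols n)" "p = poly P (mvar n)" using p(2) by (rule mpols_SucE)
    obtain A where A: "A \<in> polys_over (mpols n)" "a = poly A (mvar n)" using ab(1) by (rule mpols_SucE)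
    have P0: "P \<noteq> 0" using P p(1) by (auto simp: irreducible_def)
    \<comment> \<open>The ideal of \<open>P\<close> and \<open>A\<close>. Over the ring of constants
      its nonzero element of least degree divides a member only after that member is scaled by a
      power of the leading coefficient.\<close>
    define I where "I d \<longleftrightarrow> d \<in> polys_over (mpols n) \<and>
      (\<exists>s\<in>polys_over (mpols n). \<exists>t\<in>polys_over (mpols n). d = s * P + t * A)" for d
    have "P = 1 * P + 0 * A" "A = 0 * P + 1 * A" by simp_all
    then have "I P" and IA: "I A" unfolding I_def using P(1) A(1) polys_0 polys_1 by blast+
    then obtain d where d: "I d" "d \<noteq> 0" and min: "\<And>e. I e \<Longrightarrow> e \<noteq> 0 \<Longrightarrow> degree d \<le> degree e"
      using ex_has_least_nat[of "\<lambda>d. I d \<and> d \<noteq> 0" P degree] P0 by blast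
    obtain s t where st: "s \<in> polys_over (mpols n)" "t \<in> polys_over (mpols n)" "d = s * P + t * A"
      using d(1) unfolding I_def by blast
    have dR: "d \<in> polys_over (mpols n)" using d(1) unfolding I_def by blast
    have div: "\<exists>r q. r \<in> mpols n \<and> r \<noteq> 0 \<and> q \<in> polys_over (mpols n) \<and> smult r g = d * q"
      if g: "g \<in> polys_over (mpols n)" "I g" for g
    proof -
      obtain k q R where kq: "q \<in> polys_over (mpols n)" "R \<in> polys_over (mpols n)"
        "smult (lead_coeff d ^ k) g = d * q + R" "R = 0 \<or> degree R < degree d"
        using pseudo_division[OF is_subring_mpols dR d(2) g(1)] by blast
      let ?r = "lead_coeff d ^ k"
      have rn: "?r \<in> mpols n" by (intro power polys_coeff dR)
      obtain s1 t1 where st1: "s1 \<in> polys_over (mpols n)" "t1 \<in> polys_over (mpols n)" "g = s1 * P + t1 * A"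
        using g(2) unfolding I_def by blast
      have "R = smult ?r g - d * q" using kq(3) by simp
      also have "\<dots> = (smult ?r s1 - q * s) * P + (smult ?r t1 - q * t) * A"
        by (simp add: st1(3) st(3) algebra_simps smult_add_right)
      finally have e: "R = (smult ?r s1 - q * s) * P + (smult ?r t1 - q * t) * A" .
      have "\<exists>t\<in>polys_over (mpols n). R = (smult ?r s1 - q * s) * P + t * A"
        by (rule bexI[where x = "smult ?r t1 - q * t"], rule e)
          (intro polys_diff polys_smult polys_mult rn st1 st kq(1))
      then have "\<exists>s\<in>polys_over (mpols n). \<exists>t\<in>polys_over (mpols n). R = s * P + t * A"
        by (rule bexI[where x = "smult ?r s1 - q * s" and
              P = "\<lambda>s. \<exists>t\<in>polys_over (mpols n). R = s * P + t * A"])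
          (intro polys_diff polys_smult polys_mult rn st1 st kq(1))
      then have "I R" unfolding I_def using kq(2) by (rule conjI[rotated])
      then have "R = 0" using kq(4) min[of R] leD by blast
      then show ?thesis using kq rn d(2) by (intro exI[of _ ?r] exI[of _ q]) simp
    qed
    obtain r q where rq: "r \<in> mpols n" "r \<noteq> 0" "q \<in> polys_over (mpols n)" "smult r P = d * q"
      using div[OF P(1) \<open>I P\<close>] by blast
    obtain r2 q2 where rq2: "r2 \<in> mpols n" "r2 \<noteq> 0" "q2 \<in> polys_over (mpols n)" "smult r2 A = d * q2"
      using div[OF A(1) IA] by blast
    let ?d = "poly d (mvar n)"
    have e1: "?d * poly q (mvar n) = r * p" using arg_cong[OF rq(4), of "\<lambda>f. poly f (mvar n)"] P(2) by simp
    have e2: "?d * poly q2 (mvar n) = r2 * a" using arg_cong[OF rq2(4), of "\<lambda>f. poly f (mvar n)"] A(2) by simp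
    have e3: "?d = poly s (mvar n) * p + poly t (mvar n) * a" using st(3) P(2) A(2) by simp
    show ?thesis
    proof (cases "degree d = 0")
      case True
      then obtain c where c: "d = [:c:]" by (rule degree_eq_zeroE)
      have cn: "c \<in> mpols n" using polys_coeff[OF dR, of 0] c by simp
      have c0: "c \<noteq> 0" using d(2) c by simp
      have "c * b = p * (poly s (mvar n) * b) + poly t (mvar n) * (a * b)"
        using e3 c by (simp add: algebra_simps)
      moreover have "p dvd p * (poly s (mvar n) * b) + poly t (mvar n) * (a * b)"
        by (rule dvd_add[OF dvd_triv_left dvd_mult[OF dvd]])
      ultimately have "p dvd c * b" by metis
      then show ?thesis using cancel_const[OF pn cn c0 ab(2)] by blast
    next
      case deg: False
      obtain \<rho> d' u' where *: "\<rho> \<in> mpols n" "\<rho> \<noteq> 0" "?d = \<rho> * d'" "p = d' * u'"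
        using strip_const[OF rq(1,2) poly_mvar_in_mpols[OF dR] poly_mvar_in_mpols[OF rq(3)] e1] by blast
      \<comment> \<open>With \<open>d'\<close> a unit, the value of \<open>d\<close> would divide
        the constant \<rho> and be free of the last variable, against the positive degree of
        \<open>d\<close>.\<close>
      have "\<not> d' dvd 1"
      proof
        assume "d' dvd 1"
        then have "?d dvd \<rho>" using *(3) by (metis dvd_refl mult_dvd_mono mult.right_neutral)
        then have dn: "?d \<in> mpols n" using mpols_dvd *(1,2) by blast
        have "d = [:?d:]"
          by (rule poly_mvar_inj[OF dR polys_pCons[OF dn polys_0]]) simp
        then show False using deg by (metis degree_pCons_0)
      qed
      then have "u' dvd 1" using p(1) *(4) unfolding irreducible_def by blast
      then obtain v where v: "1 = u' * v" by (rule dvdE)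
      have "d' = p * v" using v *(4) by (metis mult.assoc mult_1_right)
      then have "p dvd ?d" using *(3) by (simp add: dvd_mult)
      then have "p dvd r2 * a" using e2 by (metis dvd_mult2)
      then show ?thesis using cancel_const[OF pn rq2(1,2) ab(1)] by blast
    qed
  qed
qed

theorem irreducible_imp_prime_elem:
  fixes p :: "'a::field_char_0 mpol"
  assumes "irreducible p"
  shows "prime_elem p"
proof -
  have *: "irreducible p \<Longrightarrow> p \<in> mpols n \<Longrightarrow> a \<in> mpols n \<Longrightarrow> b \<in> mpols n \<Longrightarrow> p dvd a * b \<Longrightarrow>
    p dvd a \<or> p dvd b" for n and p a b :: "'a mpol"
  proof (induction n arbitrary: p a b)
    case 0
    have "\<exists>c. p = Poly_Mapping.single 0 c"
    proof -
      have "t = 0" if "t \<in> Poly_Mapping.keys p" for t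
        using 0 that unfolding mpols_iff_lookup by (intro poly_mapping_eqI) simp
      then have "tdeg p = 0" unfolding wdeg_le_iff[of exp_deg p 0, simplified] by (simp add: exp_deg_eq_0_iff)
      then show ?thesis by (simp add: tdeg_eq_0_iff)
    qed
    then show ?case using 0 mpol_unit_iff[of p] by (auto simp: irreducible_def tdeg_eq_0_iff)
  next
    case (Suc n)
    show ?case by (rule irreducible_imp_prime_step[of n p a b]) (use Suc in blast)+
  qed
  show ?thesis
    unfolding prime_elem_def
  proof (intro conjI allI impI)
    fix a b assume ab: "p dvd a * b"
    obtain i j k where "p \<in> mpols i" "a \<in> mpols j" "b \<in> mpols k" using mpols_exhaust by metis
    then have "p \<in> mpols (max i (max j k))" "a \<in> mpols (max i (max j k))" "b \<in> mpols (max i (max j k))"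
      using mpols_mono[of p i "max i (max j k)"] mpols_mono[of a j "max i (max j k)"]
        mpols_mono[of b k "max i (max j k)"] by simp_all
    then show "p dvd a \<or> p dvd b" using * assms ab by blast
  qed (use assms in \<open>auto simp: irreducible_def\<close>)
qed

lemma prime_factor_exists:
  fixes p :: "'a::field_char_0 mpol"
  assumes "p \<noteq> 0" "\<not> p dvd 1"
  shows "\<exists>q. prime_elem q \<and> q dvd p"
  using irreducible_factor_exists[OF assms] irreducible_imp_prime_elem by blast

section \<open>Extending derivations to algebraic elements\<close>

locale subfield_set =
  fixes S :: "'b::field set"
  assumes subfield: "is_subfield S"

sublocale subfield_set \<subseteq> subring_set S
  using subfield by unfold_locales (simp add: is_subfield_def is_subring_def)

context subfield_set
begin

lemma inverse: "u \<in> S \<Longrightarrow> Fields.inverse u \<in> S"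
  using subfield by (simp add: is_subfield_def)

lemma divide: "u \<in> S \<Longrightarrow> v \<in> S \<Longrightarrow> u / v \<in> S"
  by (simp add: divide_inverse inverse mult)

lemma polys_division:
  assumes "P \<in> polys_over S" "D \<in> polys_over S" "D \<noteq> 0"
  obtains Q R where "Q \<in> polys_over S" "R \<in> polys_over S" "P = D * Q + R"
    "R = 0 \<or> degree R < degree D"
proof -
  obtain k Q R where *: "Q \<in> polys_over S" "R \<in> polys_over S"
    "smult (lead_coeff D ^ k) P = D * Q + R" "R = 0 \<or> degree R < degree D"
    using pseudo_division[OF subring assms(2,3,1)] by blast
  define c where "c = Fields.inverse (lead_coeff D ^ k)"
  have c: "c \<in> S" unfolding c_def by (intro inverse power polys_coeff assms)
  have "c * lead_coeff D ^ k = 1" using assms(3) by (simp add: c_def)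
  then have "P = smult c (smult (lead_coeff D ^ k) P)" by simp
  also have "\<dots> = D * smult c Q + smult c R"
    by (simp add: *(3) smult_add_right)
  finally have e: "P = D * smult c Q + smult c R" .
  show ?thesis
  proof (rule that[OF _ _ e])
    show "smult c R = 0 \<or> degree (smult c R) < degree D"
      using *(4) by auto
  qed (intro polys_smult c *)+
qed

text \<open>Division with remainder is unique in the whole polynomial ring, so the quotient found
  over \<open>S\<close> is the given cofactor.\<close>

lemma polys_cofactor:
  assumes "D * C \<in> polys_over S" "D \<in> polys_over S" "D \<noteq> 0"
  shows "C \<in> polys_over S"
proof -
  obtain Q R where *: "Q \<in> polys_over S" "R \<in> polys_over S" "D * C = D * Q + R"
    "R = 0 \<or> degree R < degree D"
    using polys_division[OF assms] by blast
  have e: "R = D * (C - Q)" using *(3) by (simp add: algebra_simps)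
  have "C - Q = 0"
  proof (rule ccontr)
    assume "C - Q \<noteq> 0"
    then have "R \<noteq> 0" "degree R = degree D + degree (C - Q)"
      using assms(3) unfolding e by (simp_all only: mult_eq_0_iff degree_mult_eq not_False_eq_True simp_thms)
    then show False using *(4) by simp
  qed
  then show ?thesis using *(1) by simp
qed

lemma dvd_in_polys_iff:
  assumes "P \<in> polys_over S" "D \<in> polys_over S"
  shows "dvd_in (polys_over S) D P \<longleftrightarrow> D dvd P"
proof
  assume "D dvd P"
  then obtain C where C: "P = D * C" by (rule dvdE)
  show "dvd_in (polys_over S) D P"
  proof (cases "D = 0")
    case True
    then show ?thesis using C polys_0 unfolding dvd_in_def by auto
  next
    case False
    then have "C \<in> polys_over S" using polys_cofactor[of D C] assms C by simp
    then show ?thesis using C unfolding dvd_in_def by blast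
  qed
qed (auto simp: dvd_in_def)

lemma polys_bezout:
  assumes "A \<in> polys_over S" "B \<in> polys_over S" "A \<noteq> 0 \<or> B \<noteq> 0"
  obtains G s t where "G \<in> polys_over S" "s \<in> polys_over S" "t \<in> polys_over S" "G \<noteq> 0"
    "G = s * A + t * B" "G dvd A" "G dvd B"
proof -
  define I where "I G \<longleftrightarrow> (\<exists>s t. s \<in> polys_over S \<and> t \<in> polys_over S \<and> G = s * A + t * B)" for G
  have IA: "I A" unfolding I_def by (intro exI[of _ 1] exI[of _ 0]) (simp add: polys_1 polys_0)
  have IB: "I B" unfolding I_def by (intro exI[of _ 0] exI[of _ 1]) (simp add: polys_1 polys_0)
  have ex: "\<exists>G. I G \<and> G \<noteq> 0" using assms(3) IA IB by blast
  obtain G where G: "I G \<and> G \<noteq> 0"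
    and min: "\<forall>H. I H \<and> H \<noteq> 0 \<longrightarrow> degree G \<le> degree H"
    using ex ex_has_least_nat[of "\<lambda>G. I G \<and> G \<noteq> 0" _ degree] by metis
  obtain s t where st: "s \<in> polys_over S" "t \<in> polys_over S" "G = s * A + t * B"
    using G unfolding I_def by auto
  have GS: "G \<in> polys_over S" unfolding st(3) by (intro polys_add polys_mult st assms)
  have dvd: "G dvd H" if IH: "I H" and HS: "H \<in> polys_over S" for H
  proof -
    obtain Q R where *: "Q \<in> polys_over S" "R \<in> polys_over S" "H = G * Q + R"
      "R = 0 \<or> degree R < degree G"
      by (rule polys_division[OF HS GS conjunct2[OF G]])
    obtain s1 t1 where st1: "s1 \<in> polys_over S" "t1 \<in> polys_over S" "H = s1 * A + t1 * B"
      using IH unfolding I_def by auto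
    have "R = H - G * Q" using *(3) by simp
    also have "\<dots> = (s1 - s * Q) * A + (t1 - t * Q) * B" unfolding st1(3) st(3) by (simp add: algebra_simps)
    finally have "I R"
      unfolding I_def by (intro exI[of _ "s1 - s * Q"] exI[of _ "t1 - t * Q"])
        (simp add: polys_diff polys_mult st st1 *)
    then have "R = 0" using *(4) min leD by auto
    then show ?thesis using *(3) by simp
  qed
  show ?thesis using that[OF GS st(1,2) _ st(3) dvd[OF IA assms(1)] dvd[OF IB assms(2)]] G by simp
qed

end

section \<open>Derivations on subfields\<close>

definition algebraic_over :: "'b::field set \<Rightarrow> 'b \<Rightarrow> bool" where
  "algebraic_over S u \<longleftrightarrow> (\<exists>P\<in>polys_over S. P \<noteq> 0 \<and> poly P u = 0)"

text \<open>\<open>D\<close> is a total function whose values matter on \<open>S\<close> alone, so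
  that derivations on growing subfields share one type. The values may lie outside
  \<open>S\<close>.\<close>

definition partial_deriv :: "'b::field set \<Rightarrow> ('b \<Rightarrow> 'b) \<Rightarrow> bool" where
  "partial_deriv S D \<longleftrightarrow> is_subfield S \<and>
     (\<forall>u\<in>S. \<forall>v\<in>S. D (u + v) = D u + D v \<and> D (u * v) = D u * v + u * D v)"

locale partial_deriv_loc =
  fixes S :: "'b::field_char_0 set" and D
  assumes pderivation: "partial_deriv S D"

sublocale partial_deriv_loc \<subseteq> subfield_set S
  using pderivation by unfold_locales (simp add: partial_deriv_def)

context partial_deriv_loc
begin

lemma D_add: "u \<in> S \<Longrightarrow> v \<in> S \<Longrightarrow> D (u + v) = D u + D v"
  using pderivation by (simp add: partial_deriv_def)

lemma D_mult: "u \<in> S \<Longrightarrow> v \<in> S \<Longrightarrow> D (u * v) = D u * v + u * D v"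
  using pderivation by (simp add: partial_deriv_def)

lemma D_0: "D 0 = 0"
  using D_add[OF zero zero] by (simp only: add_0_right add_cancel_right_right)

lemma D_sum: "(\<And>a. a \<in> A \<Longrightarrow> f a \<in> S) \<Longrightarrow> D (Groups_Big.sum f A) = (\<Sum>a\<in>A. D (f a))"
  by (induction A rule: infinite_finite_induct) (simp_all add: D_0 D_add sum)

lemma map_poly_D_add:
  assumes "P \<in> polys_over S" "Q \<in> polys_over S"
  shows "map_poly D (P + Q) = map_poly D P + map_poly D Q"
  by (rule poly_eqI) (simp add: coeff_map_poly D_0 D_add polys_coeff assms)

lemma map_poly_D_mult:
  assumes "P \<in> polys_over S" "Q \<in> polys_over S"
  shows "map_poly D (P * Q) = map_poly D P * Q + P * map_poly D Q"
proof (rule poly_eqI)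
  fix n
  have "D (\<Sum>k\<le>n. coeff P k * coeff Q (n - k)) =
    (\<Sum>k\<le>n. D (coeff P k) * coeff Q (n - k) + coeff P k * D (coeff Q (n - k)))"
    by (subst D_sum) (simp_all add: mult D_mult polys_coeff assms)
  then show "coeff (map_poly D (P * Q)) n =
      coeff (map_poly D P * Q + P * map_poly D Q) n"
    by (simp add: coeff_map_poly D_0 coeff_mult sum.distrib)
qed

lemma D_poly:
  assumes "P \<in> polys_over S" "x \<in> S"
  shows "D (poly P x) = poly (map_poly D P) x + poly (pderiv P) x * D x"
  using assms(1)
proof (induction P)
  case (pCons a P)
  have a: "a \<in> S" using polys_coeff[OF pCons.prems, of 0] by simp
  have P: "P \<in> polys_over S"
    unfolding polys_over_def using polys_coeff[OF pCons.prems, of "Suc _"] by simp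
  have "D (poly (pCons a P) x) = D a + (D x * poly P x + x * D (poly P x))"
    by (simp add: D_add D_mult a assms(2) mult poly_in[OF P assms(2)])
  then show ?case
    by (simp add: pCons.IH[OF P] Polynomial.map_poly_pCons[of D, OF D_0] pderiv_pCons algebra_simps)
qed (simp add: D_0)

text \<open>The value at \<open>poly P u\<close> that the Leibniz rule forces on an extension of
  \<open>D\<close> with value \<open>d\<close> at \<open>u\<close>.\<close>

definition twisted :: "'b \<Rightarrow> 'b \<Rightarrow> 'b poly \<Rightarrow> 'b" where
  "twisted u d P = poly (map_poly D P) u + poly (pderiv P) u * d"

lemma twisted_add:
  "P \<in> polys_over S \<Longrightarrow> Q \<in> polys_over S \<Longrightarrow> twisted u d (P + Q) = twisted u d P + twisted u d Q"
  by (simp add: twisted_def map_poly_D_add pderiv_add algebra_simps)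

lemma twisted_mult:
  "P \<in> polys_over S \<Longrightarrow> Q \<in> polys_over S \<Longrightarrow>
    twisted u d (P * Q) = twisted u d P * poly Q u + poly P u * twisted u d Q"
  by (simp add: twisted_def map_poly_D_mult pderiv_mult algebra_simps)

lemma twisted_const: "twisted u d [:a:] = D a"
  by (simp add: twisted_def D_0 Polynomial.map_poly_pCons[of D, OF D_0])

text \<open>If the forced value vanishes at the minimal polynomial \<open>M\<close>, it vanishes at
  all polynomials with root \<open>u\<close>, and \<open>twisted\<close> descends to a map on
  \<open>S[u]\<close>.\<close>

lemma simple_extension:
  assumes "algebraic_over S u"
  obtains S' D' where "partial_deriv S' D'" "S \<subseteq> S'" "u \<in> S'" "\<And>s. s \<in> S \<Longrightarrow> D' s = D s"
proof -
  have ex: "\<exists>P. P \<in> polys_over S \<and> P \<noteq> 0 \<and> poly P u = 0"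
    using assms unfolding algebraic_over_def by auto
  obtain M where M: "M \<in> polys_over S \<and> M \<noteq> 0 \<and> poly M u = 0" and
    min: "\<forall>P. P \<in> polys_over S \<and> P \<noteq> 0 \<and> poly P u = 0 \<longrightarrow> degree M \<le> degree P"
    using ex ex_has_least_nat[of "\<lambda>P. P \<in> polys_over S \<and> P \<noteq> 0 \<and> poly P u = 0" _ degree]
    by metis
  have MS: "M \<in> polys_over S" "M \<noteq> 0" "poly M u = 0" using M by auto
  have dM: "degree M \<noteq> 0"
  proof
    assume "degree M = 0"
    then obtain a where "M = [:a:]" by (rule degree_eq_zeroE)
    then show False using MS by simp
  qed
  have M'0: "poly (pderiv M) u \<noteq> 0"
  proof
    assume "poly (pderiv M) u = 0"
    moreover have "pderiv M \<noteq> 0" using dM by (simp add: pderiv_eq_0_iff)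
    ultimately have "degree M \<le> degree (pderiv M)"
      using min polys_pderiv[OF MS(1)] by simp
    then show False using dM by (simp add: degree_pderiv)
  qed
  \<comment> \<open>The solution of \<open>twisted u d M = 0\<close>. The denominator is nonzero
    because \<open>pderiv M\<close> is a nonzero polynomial of smaller degree than the minimal
    \<open>M\<close>.\<close>
  define d where "d = - poly (map_poly D M) u / poly (pderiv M) u"
  let ?E = "twisted u d"
  have EM: "?E M = 0" unfolding twisted_def d_def using M'0 by simp
  have E0: "?E P = 0" if P: "P \<in> polys_over S" "poly P u = 0" for P
  proof -
    obtain Q R where *: "Q \<in> polys_over S" "R \<in> polys_over S" "P = M * Q + R"
      "R = 0 \<or> degree R < degree M"
      using polys_division[OF P(1) MS(1,2)] by blast
    have "poly R u = 0" using *(3) P(2) MS(3) by simp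
    then have "R = 0" using min *(2,4) leD by auto
    then have "P = M * Q" using *(3) by simp
    then show ?thesis using twisted_mult[OF MS(1) *(1)] EM MS(3) by simp
  qed
  have uminus: "?E (- P) = - ?E P" if "P \<in> polys_over S" for P
  proof -
    have "?E (P + - P) = ?E P + ?E (- P)" by (intro twisted_add that polys_minus)
    moreover have "?E (P + - P) = 0" by (simp add: twisted_def)
    ultimately show ?thesis by (metis minus_unique)
  qed
  have wd: "?E P = ?E Q" if P: "P \<in> polys_over S" "Q \<in> polys_over S" "poly P u = poly Q u" for P Q
  proof -
    have "?E (P + - Q) = 0" by (rule E0) (simp_all add: polys_add polys_minus polys_diff P)
    then show ?thesis by (simp only: twisted_add P polys_minus uminus) simp
  qed
  define S' where "S' = {poly P u | P. P \<in> polys_over S}"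
  define D' where "D' w = ?E (SOME P. P \<in> polys_over S \<and> poly P u = w)" for w
  have D': "D' (poly P u) = ?E P" if "P \<in> polys_over S" for P
  proof -
    have "(SOME Q. Q \<in> polys_over S \<and> poly Q u = poly P u) \<in> polys_over S \<and>
       poly (SOME Q. Q \<in> polys_over S \<and> poly Q u = poly P u) u = poly P u"
      using someI[of "\<lambda>Q. Q \<in> polys_over S \<and> poly Q u = poly P u" P] that by simp
    then show ?thesis unfolding D'_def by (elim conjE) (rule wd[OF _ that])
  qed
  \<comment> \<open>The gcd \<open>G\<close> of \<open>P\<close> and \<open>M\<close> does not
    vanish at \<open>u\<close>, so its cofactor \<open>H\<close> in \<open>M\<close> does.
    Minimality of \<open>M\<close> makes \<open>G\<close> constant, and the Bezout identity
    evaluated at \<open>u\<close> yields the inverse.\<close>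
  have inv: "Fields.inverse (poly P u) \<in> S'" if P: "P \<in> polys_over S" for P
  proof (cases "poly P u = 0")
    case True
    then have "Fields.inverse (poly P u) = poly 0 u" by simp
    then show ?thesis unfolding S'_def using polys_0 by blast
  next
    case False
    obtain G s t where G: "G \<in> polys_over S" "s \<in> polys_over S" "t \<in> polys_over S" "G \<noteq> 0"
      "G = s * P + t * M" "G dvd P" "G dvd M"
      using polys_bezout[OF P MS(1)] MS(2) by blast
    obtain H where H: "M = G * H" using G(7) by (rule dvdE)
    have HS: "H \<in> polys_over S" using MS(1) unfolding H by (rule polys_cofactor[OF _ G(1,4)])
    have "poly G u \<noteq> 0" using G(6) False by (metis dvd_def mult_eq_0_iff poly_mult)
    moreover have "poly G u * poly H u = 0" using MS(3) unfolding H by simp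
    ultimately have "poly H u = 0" by simp
    have "H \<noteq> 0" using MS(2) unfolding H by simp
    have "degree M \<le> degree H"
      using min HS \<open>poly H u = 0\<close> \<open>H \<noteq> 0\<close> by blast
    moreover have "degree M = degree G + degree H"
      unfolding H by (rule degree_mult_eq[OF G(4) \<open>H \<noteq> 0\<close>])
    ultimately have "degree G = 0" by simp
    then obtain g where g: "G = [:g:]" by (rule degree_eq_zeroE)
    have gS: "g \<in> S" using polys_coeff[OF G(1), of 0] g by simp
    have "poly s u * poly P u = g" using arg_cong[OF G(5), of "\<lambda>f. poly f u"] g MS(3) by simp
    moreover have "g \<noteq> 0" using g G(4) by simp
    ultimately have "Fields.inverse (poly P u) = poly (smult (Fields.inverse g) s) u"
      using False by (simp add: field_simps)
    then show ?thesis unfolding S'_def using polys_smult[OF inverse[OF gS] G(2)] by blast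
  qed
  have "is_subfield S'"
    unfolding is_subfield_def
  proof (intro conjI ballI)
    have "1 = poly 1 u" by simp
    then show "1 \<in> S'" unfolding S'_def using polys_1 by blast
  next
    fix v w assume "v \<in> S'" "w \<in> S'"
    then obtain P Q where PQ: "P \<in> polys_over S" "Q \<in> polys_over S" "v = poly P u" "w = poly Q u"
      unfolding S'_def by blast
    have "v - w = poly (P - Q) u" "v * w = poly (P * Q) u" using PQ by simp_all
    then show "v - w \<in> S'" "v * w \<in> S'" unfolding S'_def using polys_diff[OF PQ(1,2)] polys_mult[OF PQ(1,2)] by blast+
  next
    fix v assume "v \<in> S'"
    then show "Fields.inverse v \<in> S'" using inv unfolding S'_def by blast
  qed
  moreover have "D' (v + w) = D' v + D' w \<and> D' (v * w) = D' v * w + v * D' w" if "v \<in> S'" "w \<in> S'" for v w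
  proof -
    obtain P Q where PQ: "P \<in> polys_over S" "Q \<in> polys_over S" "v = poly P u" "w = poly Q u"
      using \<open>v \<in> S'\<close> \<open>w \<in> S'\<close> unfolding S'_def by blast
    have "v + w = poly (P + Q) u" "v * w = poly (P * Q) u" using PQ by simp_all
    then show ?thesis
      using D' PQ twisted_add[OF PQ(1,2)] twisted_mult[OF PQ(1,2)] polys_add[OF PQ(1,2)] polys_mult[OF PQ(1,2)]
      by (simp only:)
  qed
  ultimately have 1: "partial_deriv S' D'" unfolding partial_deriv_def by blast
  have const: "[:s:] \<in> polys_over S" "poly [:s:] u = s" if "s \<in> S" for s
    using polys_pCons[OF that polys_0] by simp_all
  have 2: "S \<subseteq> S'"
  proof
    fix s assume "s \<in> S"
    then show "s \<in> S'" unfolding S'_def using const[of s] by (intro CollectI exI[of _ "[:s:]"]) simp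
  qed
  have 3: "u \<in> S'"
  proof -
    have "[:0, 1:] \<in> polys_over S" by (intro polys_pCons zero one polys_0)
    moreover have "poly [:0, 1:] u = u" by simp
    ultimately show ?thesis unfolding S'_def by (intro CollectI exI[of _ "[:0, 1:]"]) simp
  qed
  have 4: "D' s = D s" if "s \<in> S" for s
    using D'[OF const(1)[OF that]] by (simp add: twisted_const)
  show ?thesis using that[OF 1 2 3 4] .
qed

text \<open>Differentiating the minimal relation of \<open>u\<close> determines the value at
  \<open>u\<close>. As it is the same for all extensions \<open>S'\<close>, \<open>D'\<close>,
  extensions to different subfields can be glued.\<close>

lemma derivation_unique:
  assumes "algebraic_over S u"
  shows "\<exists>d. \<forall>S' D'. partial_deriv S' D' \<and> S \<subseteq> S' \<and> u \<in> S' \<and> (\<forall>s\<in>S. D' s = D s) \<longrightarrow> D' u = d"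
proof -
  have ex: "\<exists>P. P \<in> polys_over S \<and> P \<noteq> 0 \<and> poly P u = 0"
    using assms unfolding algebraic_over_def by auto
  obtain M where M: "M \<in> polys_over S \<and> M \<noteq> 0 \<and> poly M u = 0" and
    min: "\<forall>P. P \<in> polys_over S \<and> P \<noteq> 0 \<and> poly P u = 0 \<longrightarrow> degree M \<le> degree P"
    using ex ex_has_least_nat[of "\<lambda>P. P \<in> polys_over S \<and> P \<noteq> 0 \<and> poly P u = 0" _ degree]
    by metis
  have dM: "degree M \<noteq> 0"
  proof
    assume "degree M = 0"
    then obtain a where "M = [:a:]" by (rule degree_eq_zeroE)
    then show False using M by simp
  qed
  have M'0: "poly (pderiv M) u \<noteq> 0"
  proof
    assume "poly (pderiv M) u = 0"
    moreover have "pderiv M \<noteq> 0" using dM by (simp add: pderiv_eq_0_iff)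
    ultimately have "degree M \<le> degree (pderiv M)"
      using min polys_pderiv[of M] M by simp
    then show False using dM by (simp add: degree_pderiv)
  qed
  have "D' u = - poly (map_poly D M) u / poly (pderiv M) u"
    if D': "partial_deriv S' D'" "S \<subseteq> S'" "u \<in> S'" "\<forall>s\<in>S. D' s = D s" for S' D'
  proof -
    interpret D': partial_deriv_loc S' D' by standard fact
    have "M \<in> polys_over S'" using M D'(2) by (auto simp: polys_over_def)
    then have "D' (poly M u) = poly (map_poly D' M) u + poly (pderiv M) u * D' u"
      using D'(3) by (rule D'.D_poly)
    moreover have "map_poly D' M = map_poly D M"
      by (rule poly_eqI) (use M D'(4) in \<open>simp add: coeff_map_poly D_0 D'.D_0 polys_over_def\<close>)
    ultimately have "0 = poly (map_poly D M) u + poly (pderiv M) u * D' u"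
      using M by (simp add: D'.D_0)
    then show ?thesis using M'0 by (simp add: field_simps eq_neg_iff_add_eq_0 add.commute)
  qed
  then show ?thesis by blast
qed

text \<open>Gluing replaces Zorn's lemma: \<open>E u\<close> is the value at \<open>u\<close> common
  to all extensions defined there, and the derivation laws involve two elements at a time.\<close>

theorem derivation_extends:
  assumes alg: "\<And>u. algebraic_over S u"
  shows "\<exists>!E. derivation E \<and> (\<forall>s\<in>S. E s = D s)"
proof -
  define ext where "ext u S' D' \<longleftrightarrow> partial_deriv S' D' \<and> S \<subseteq> S' \<and> u \<in> S' \<and> (\<forall>s\<in>S. D' s = D s)"
    for u S' D'
  have "\<forall>u. \<exists>d. \<forall>S' D'. ext u S' D' \<longrightarrow> D' u = d"
    unfolding ext_def using derivation_unique[OF alg] by blast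
  then obtain E where E: "\<And>u S' D'. ext u S' D' \<Longrightarrow> D' u = E u" by metis
  have UNIV: "is_subfield (UNIV :: 'b set)" by (simp add: is_subfield_def)
  \<comment> \<open>Two simple extensions in succession reach a subfield that contains both
    \<open>u\<close> and \<open>v\<close>.\<close>
  have two: "\<exists>S' D'. ext u S' D' \<and> v \<in> S'" for u v
  proof -
    obtain S1 D1 where 1: "partial_deriv S1 D1" "S \<subseteq> S1" "u \<in> S1" "\<And>s. s \<in> S \<Longrightarrow> D1 s = D s"
      using simple_extension[OF alg] by blast
    interpret D1: partial_deriv_loc S1 D1 by standard fact
    have "algebraic_over S1 v" using alg[of v] 1(2) unfolding algebraic_over_def polys_over_def by blast
    then obtain S2 D2 where 2: "partial_deriv S2 D2" "S1 \<subseteq> S2" "v \<in> S2" "\<And>s. s \<in> S1 \<Longrightarrow> D2 s = D1 s"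
      using D1.simple_extension by blast
    have "ext u S2 D2" unfolding ext_def using 1 2 by auto
    then show ?thesis using 2(3) by blast
  qed
  have "derivation E"
    unfolding derivation_def
  proof (intro conjI allI)
    fix u v
    obtain S' D' where *: "ext u S' D'" "v \<in> S'" using two by blast
    then have pd: "partial_deriv S' D'" "u \<in> S'" by (simp_all add: ext_def)
    interpret D': partial_deriv_loc S' D' by standard fact
    have e: "D' w = E w" if "w \<in> S'" for w
      by (rule E[of w S' D']) (use * that in \<open>simp add: ext_def\<close>)
    show "E (u + v) = E u + E v"
      using D'.D_add[OF pd(2) *(2)] e[OF D'.add[OF pd(2) *(2)]] e[OF pd(2)] e[OF *(2)] by simp
    show "E (u * v) = E u * v + u * E v"
      using D'.D_mult[OF pd(2) *(2)] e[OF D'.mult[OF pd(2) *(2)]] e[OF pd(2)] e[OF *(2)] by simp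
  qed
  moreover have "\<forall>s\<in>S. E s = D s"
  proof
    fix s assume "s \<in> S"
    then have "ext s S D" using pderivation by (simp add: ext_def)
    then show "E s = D s" using E by metis
  qed
  moreover have "E' = E" if "derivation E'" "\<forall>s\<in>S. E' s = D s" for E'
  proof
    fix u
    have "ext u UNIV E'" using that UNIV by (simp add: ext_def partial_deriv_def derivation_def)
    then show "E' u = E u" by (rule E)
  qed
  ultimately show ?thesis by (intro ex1I[of _ E]) (erule conjE | assumption | rule conjI)+
qed

end

section \<open>Rational functions\<close>

instance fract :: ("{idom, ring_char_0}") field_char_0
proof
  show "inj (of_nat :: nat \<Rightarrow> 'a fract)"
    by (rule injI) (simp add: of_nat_fract eq_fract)
qed

lemma Fract_0: "Fract 0 b = 0"
  using eq_fract(3)[of b 1] by (simp add: Zero_fract_def)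

lemma Fract_1_add: "Fract (a + b) 1 = Fract a 1 + (Fract b 1 :: 'b::idom fract)"
  by simp

lemma Fract_1_divide: "Fract a b = Fract a 1 / (Fract b 1 :: 'b::idom fract)"
  by simp

lemma Fract_1_eq_0_iff: "Fract a 1 = (0 :: 'b::idom fract) \<longleftrightarrow> a = 0"
  by (simp add: Zero_fract_def eq_fract(1))

lemma ring_deriv_pd: "ring_deriv (pd i)"
proof
  fix u v :: "'a rat_fun"
  obtain a b where u: "u = Fract a b" "b \<noteq> 0" by (rule Fract_cases)
  obtain c d where v: "v = Fract c d" "d \<noteq> 0" by (rule Fract_cases)
  have bd: "b * d \<noteq> 0" using u v by simp
  show "pd i (u + v) = pd i u + pd i v"
    using u v bd by (simp add: pd_Fract eq_fract mpol_deriv_add mpol_deriv_mult power2_eq_square algebra_simps)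
  show "pd i (u * v) = pd i u * v + u * pd i v"
    using u v bd by (simp add: pd_Fract eq_fract mpol_deriv_add mpol_deriv_mult power2_eq_square algebra_simps)
qed

lemma derivation_pd: "derivation (pd i)"
  using ring_deriv_pd[of i] by (simp add: derivation_def ring_deriv_def)

lemma pd_Fract_1: "pd i (Fract p 1) = Fract (mpol_deriv i p) 1"
proof -
  have "mpol_deriv i (1 :: 'a mpol) = 0" by (rule ring_deriv.one[OF ring_deriv_mpol_deriv])
  then show ?thesis by (simp add: pd_Fract)
qed

lemma derivation_divide:
  fixes D :: "'b::field \<Rightarrow> 'b"
  assumes "ring_deriv D" "v \<noteq> 0"
  shows "D (u / v) = (D u * v - u * D v) / v ^ 2"
proof -
  interpret ring_deriv D by fact
  have "D u = D (u / v * v)" using assms(2) by simp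
  also have "\<dots> = D (u / v) * v + u / v * D v" by (rule mult)
  finally show ?thesis using assms(2) by (simp add: field_simps power2_eq_square)
qed

definition kernel :: "('b::field \<Rightarrow> 'b) \<Rightarrow> 'b set" where
  "kernel D = {u. D u = 0}"

lemma is_subfield_kernel:
  assumes "ring_deriv D"
  shows "is_subfield (kernel D)"
proof -
  interpret ring_deriv D by fact
  have "D (inverse u) = 0" if "D u = 0" for u
    using derivation_divide[OF assms, of u 1] that by (cases "u = 0") (simp_all add: zero one divide_inverse)
  then show ?thesis by (simp add: is_subfield_def kernel_def one diff mult)
qed

lemma is_subfield_Inter: "(\<And>S. S \<in> A \<Longrightarrow> is_subfield S) \<Longrightarrow> is_subfield (\<Inter>A)"
  by (simp add: is_subfield_def)

lemma is_subfield_rat_funs: "is_subfield (rat_funs n :: 'a::field_char_0 rat_fun set)"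
  unfolding is_subfield_def
proof (intro conjI ballI)
  show "1 \<in> rat_funs n" unfolding rat_funs_def One_fract_def using mpols_1 by force
next
  fix u v :: "'a rat_fun" assume "u \<in> rat_funs n" "v \<in> rat_funs n"
  then obtain a b c d where *: "u = Fract a b" "v = Fract c d" "a \<in> mpols n" "b \<in> mpols n" "b \<noteq> 0"
    "c \<in> mpols n" "d \<in> mpols n" "d \<noteq> 0" unfolding rat_funs_def by blast
  have "u - v = Fract (a * d - c * b) (b * d)" "u * v = Fract (a * c) (b * d)" using * by simp_all
  moreover have "a * d - c * b \<in> mpols n" "a * c \<in> mpols n" "b * d \<in> mpols n" "b * d \<noteq> 0"
    using * by (simp_all add: mpols_diff mpols_mult)
  ultimately show "u - v \<in> rat_funs n" "u * v \<in> rat_funs n" unfolding rat_funs_def by blast+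
next
  fix u :: "'a rat_fun" assume "u \<in> rat_funs n"
  then obtain a b where *: "u = Fract a b" "a \<in> mpols n" "b \<in> mpols n" "b \<noteq> 0"
    unfolding rat_funs_def by blast
  show "inverse u \<in> rat_funs n"
  proof (cases "a = 0")
    case True
    then have "inverse u = Fract 0 1" using * by (simp add: Fract_0 flip: Zero_fract_def)
    then show ?thesis unfolding rat_funs_def using mpols_0 mpols_1 by (metis (mono_tags, lifting) mem_Collect_eq one_neq_zero)
  next
    case False
    have "inverse u = Fract b a" using * by simp
    then show ?thesis unfolding rat_funs_def using * False by blast
  qed
qed

lemma Fract_1_in_rat_funs: "p \<in> mpols n \<Longrightarrow> Fract p 1 \<in> rat_funs n"
  unfolding rat_funs_def using mpols_1 one_neq_zero by blast

lemma rat_funs_mono: "n \<le> m \<Longrightarrow> f \<in> rat_funs n \<Longrightarrow> f \<in> rat_funs m"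
  unfolding rat_funs_def using mpols_mono by blast

lemma const_in_rat_funs: "const c \<in> rat_funs n"
  unfolding const_def by (rule Fract_1_in_rat_funs[OF mpols_const])

lemma x_var_in_rat_funs: "i < n \<Longrightarrow> x_var i \<in> rat_funs n"
  unfolding x_var_def by (rule Fract_1_in_rat_funs[OF mvar_in_mpols])

lemma pd_in_rat_funs: "f \<in> rat_funs n \<Longrightarrow> pd i f \<in> rat_funs n"
proof -
  assume "f \<in> rat_funs n"
  then obtain a b where *: "f = Fract a b" "a \<in> mpols n" "b \<in> mpols n" "b \<noteq> 0"
    unfolding rat_funs_def by blast
  have "mpol_deriv i a * b - a * mpol_deriv i b \<in> mpols n" "b ^ 2 \<in> mpols n" "b ^ 2 \<noteq> 0"
    using * by (simp_all add: mpols_diff mpols_mult mpols_deriv mpols_power)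
  then show ?thesis unfolding rat_funs_def using * pd_Fract[OF *(4)] by blast
qed

lemma pd_rat_funs_0: "f \<in> rat_funs n \<Longrightarrow> n \<le> i \<Longrightarrow> pd i f = 0"
proof -
  assume "f \<in> rat_funs n" and i: "n \<le> i"
  then obtain a b where *: "f = Fract a b" "a \<in> mpols n" "b \<in> mpols n" "b \<noteq> 0"
    unfolding rat_funs_def by blast
  then show ?thesis using i by (simp add: pd_Fract mpols_deriv_0 Fract_0)
qed

lemma pd_x_var: "pd i (x_var j) = (if i = j then 1 else 0)"
  unfolding x_var_def pd_Fract_1 by (simp only: mpol_deriv_mvar) (simp add: One_fract_def Fract_0)

lemma const_add: "const (a + b) = const a + const b"
  by (simp add: const_def single_add)

lemma const_mult: "const (a * b) = const a * const b"
  by (simp add: const_def mult_single)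

lemma const_0: "const 0 = 0"
  by (simp add: const_def Fract_0)

lemma const_1: "const 1 = 1"
  by (simp add: const_def One_fract_def)

lemma const_eq_0_iff: "const a = 0 \<longleftrightarrow> a = 0"
  unfolding const_def Fract_1_eq_0_iff using single_zero by (metis lookup_single_eq lookup_zero)

lemma const_inverse: "const (inverse a) = inverse (const a)"
proof (cases "a = 0")
  case False
  have "const a * const (inverse a) = 1" using False by (simp add: const_1 flip: const_mult)
  then show ?thesis by (metis inverse_unique)
qed (simp add: const_0)

lemma const_diff: "const (a - b) = const a - const b"
  by (simp add: const_def single_diff)

lemma mpol_deriv_commute: "mpol_deriv i (mpol_deriv j p) = mpol_deriv j (mpol_deriv i p)"
proof (induction p rule: mpol_induct)
  case (2 p t c)
  have "t - Poly_Mapping.single j 1 - Poly_Mapping.single i 1 = t - Poly_Mapping.single i 1 - Poly_Mapping.single j (1::nat)"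
    by (rule poly_mapping_eqI) (simp add: lookup_minus)
  then show ?case
    using 2 by (cases "i = j") (simp_all add: mpol_deriv_add mpol_deriv_single lookup_minus lookup_single mult_ac)
qed (simp add: mpol_deriv_0)

text \<open>The commutator is a derivation too, so its vanishing spreads from polynomials to
  fractions and from there to algebraic elements.\<close>

lemma ring_deriv_commutator:
  assumes "ring_deriv D" "ring_deriv E"
  shows "ring_deriv (\<lambda>u. D (E u) - E (D u))"
proof -
  interpret D: ring_deriv D by fact
  interpret E: ring_deriv E by fact
  show ?thesis
    by standard (simp_all add: D.add E.add D.mult E.mult algebra_simps)
qed

lemma pd_commute: "pd i (pd j f) = pd j (pd i f)"
proof -
  let ?E = "\<lambda>u. pd i (pd j u) - pd j (pd i u)"
  have E: "ring_deriv ?E" by (intro ring_deriv_commutator ring_deriv_pd)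
  obtain a b where ab: "f = Fract a b" "b \<noteq> 0" by (rule Fract_cases)
  have 0: "?E (Fract p 1) = 0" for p by (simp add: pd_Fract_1 mpol_deriv_commute[of i j])
  have "?E (Fract a 1 / Fract b 1) = (?E (Fract a 1) * Fract b 1 - Fract a 1 * ?E (Fract b 1)) / (Fract b 1)^2"
    by (rule derivation_divide[OF E]) (simp only: Fract_1_eq_0_iff ab(2) not_False_eq_True)
  then have "?E f = 0" unfolding ab(1) Fract_1_divide[of a b] 0 by simp
  then show ?thesis by simp
qed

lemma rat_funs_SucE:
  assumes "f \<in> rat_funs (Suc n)"
  obtains P Q where "P \<in> polys_over (rat_funs n)" "Q \<in> polys_over (rat_funs n)" "Q \<noteq> 0"
    "poly Q (x_var n) \<noteq> 0" "f = poly P (x_var n) / poly Q (x_var n)"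
proof -
  obtain a b where ab: "f = Fract a b" "a \<in> mpols (Suc n)" "b \<in> mpols (Suc n)" "b \<noteq> 0"
    using assms unfolding rat_funs_def by blast
  obtain A where A: "A \<in> polys_over (mpols n)" "a = poly A (mvar n)" using ab(2) by (rule mpols_SucE)
  obtain B where B: "B \<in> polys_over (mpols n)" "b = poly B (mvar n)" using ab(3) by (rule mpols_SucE)
  let ?h = "\<lambda>p. Fract p 1"
  have h: "poly (map_poly ?h P) (x_var n) = Fract (poly P (mvar n)) 1" for P
    by (induction P) (simp_all only: map_poly_0 poly_0 Fract_0 Polynomial.map_poly_pCons[of ?h, OF Fract_0]
      poly_pCons x_var_def mult_fract Fract_1_add mult_1)
  have in_polys: "map_poly ?h P \<in> polys_over (rat_funs n)" if "P \<in> polys_over (mpols n)" for P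
    using that by (simp add: polys_over_def coeff_map_poly Fract_0 Fract_1_in_rat_funs)
  have nz: "poly (map_poly ?h B) (x_var n) \<noteq> 0"
    unfolding h B(2)[symmetric] Fract_1_eq_0_iff by (rule ab(4))
  show ?thesis
  proof (rule that[OF in_polys[OF A(1)] in_polys[OF B(1)] _ nz])
    show "map_poly ?h B \<noteq> 0" using nz by auto
    show "f = poly (map_poly ?h A) (x_var n) / poly (map_poly ?h B) (x_var n)"
      unfolding h A(2)[symmetric] B(2)[symmetric] ab(1) by (rule Fract_1_divide)
  qed
qed

text \<open>A denominator of least total degree stands in for a reduced fraction.\<close>

lemma lowest_terms:
  obtains a b where "f = Fract a b" "b \<noteq> 0" "\<And>c d. f = Fract c d \<Longrightarrow> d \<noteq> 0 \<Longrightarrow> tdeg b \<le> tdeg d"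
proof -
  obtain a b where "f = Fract a b" "b \<noteq> 0" by (rule Fract_cases)
  then have ex: "\<exists>b. \<exists>a. f = Fract a b \<and> b \<noteq> 0" by blast
  obtain b where "\<exists>a. f = Fract a b \<and> b \<noteq> 0" "\<forall>d. (\<exists>c. f = Fract c d \<and> d \<noteq> 0) \<longrightarrow> tdeg b \<le> tdeg d"
    using ex ex_has_least_nat[of "\<lambda>b. \<exists>a. f = Fract a b \<and> b \<noteq> 0" _ tdeg] by metis
  then show ?thesis using that by metis
qed

lemma mpol_deriv_all_0: "(\<And>i. mpol_deriv i p = 0) \<Longrightarrow> p \<in> mpols 0"
  by (simp add: mpols_iff_degree_in mpol_deriv_zero_iff_degree_in)

lemma mpols_zeroE:
  assumes "p \<in> mpols 0"
  obtains c where "p = Poly_Mapping.single 0 c"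
proof -
  have "t = 0" if "t \<in> Poly_Mapping.keys p" for t
    using assms that unfolding mpols_iff_lookup by (intro poly_mapping_eqI) simp
  then have "tdeg p \<le> 0" unfolding wdeg_le_iff by (simp add: exp_deg_eq_0_iff)
  then show ?thesis using that tdeg_eq_0_iff[of p] by auto
qed

text \<open>If all derivatives of a/b vanish, then a/b is also the quotient of the derivatives of a
  and b whenever the latter is nonzero. That denominator has smaller total degree, so all
  derivatives of b, and then of a, are 0.\<close>

lemma pd_all_0_imp_const:
  assumes "\<And>i. pd i f = 0"
  obtains c where "f = const c"
proof -
  obtain a b where ab: "f = Fract a b" "b \<noteq> 0" and
    min: "\<And>c d. f = Fract c d \<Longrightarrow> d \<noteq> 0 \<Longrightarrow> tdeg b \<le> tdeg d" by (rule lowest_terms) blast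
  have e: "mpol_deriv i a * b = a * mpol_deriv i b" for i
  proof -
    have "Fract (mpol_deriv i a * b - a * mpol_deriv i b) (b ^ 2) = Fract 0 1"
      using assms[of i] ab by (simp add: pd_Fract flip: Zero_fract_def)
    then show ?thesis using ab(2) by (simp add: eq_fract)
  qed
  have b0: "mpol_deriv i b = 0" for i
  proof (rule ccontr)
    assume nz: "mpol_deriv i b \<noteq> 0"
    have "f = Fract (mpol_deriv i a) (mpol_deriv i b)"
      unfolding ab(1) by (rule eq_fract(1)[OF ab(2) nz, THEN iffD2]) (rule e[symmetric])
    then have "tdeg b \<le> tdeg (mpol_deriv i b)" using min nz by blast
    then show False using tdeg_deriv_less[OF nz] by simp
  qed
  have a0: "mpol_deriv i a = 0" for i using e[of i] b0[of i] ab(2) by simp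
  obtain c where c: "a = Poly_Mapping.single 0 c" using mpols_zeroE[OF mpol_deriv_all_0[OF a0]] by blast
  obtain d where d: "b = Poly_Mapping.single 0 d" using mpols_zeroE[OF mpol_deriv_all_0[OF b0]] by blast
  have "f = const c / const d" unfolding ab(1) c d const_def by (rule Fract_1_divide)
  also have "\<dots> = const (c / d)" by (simp add: divide_inverse const_mult const_inverse)
  finally show ?thesis by (rule that)
qed

text \<open>Cancelling a common factor of positive total degree would lower the least total degree
  of a denominator in \<open>mpols m\<close>.\<close>

lemma reduced_fraction_exists:
  assumes "f \<in> rat_funs m"
  obtains a b where "reduced_fraction m f a b"
proof -
  define den where "den b \<longleftrightarrow> (\<exists>a. f = Fract a b \<and> b \<noteq> 0 \<and> a \<in> mpols m \<and> b \<in> mpols m)" for b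
  obtain b0 where "den b0" using assms unfolding rat_funs_def den_def by blast
  then obtain b where b: "den b" and min: "\<forall>d. den d \<longrightarrow> tdeg b \<le> tdeg d"
    using ex_has_least_nat[of den b0 tdeg] by metis
  then obtain a where ab: "f = Fract a b" "b \<noteq> 0" "a \<in> mpols m" "b \<in> mpols m"
    unfolding den_def by blast
  have "dvd_in (mpols m) c 1" if c: "c \<in> mpols m" "dvd_in (mpols m) c a" "dvd_in (mpols m) c b" for c
  proof -
    obtain a' b' where *: "a = c * a'" "b = c * b'" "a' \<in> mpols m" "b' \<in> mpols m"
      using c unfolding dvd_in_def by blast
    have nz: "c \<noteq> 0" "b' \<noteq> 0" using * ab(2) by auto
    have "f = Fract a' b'" unfolding ab(1) *(1,2) using nz by (simp add: eq_fract mult_ac)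
    then have "tdeg b \<le> tdeg b'" using min * nz unfolding den_def by blast
    then have "tdeg c = 0" using tdeg_mult[OF nz] *(2) by simp
    then have "c dvd 1" using nz by (simp add: mpol_unit_iff)
    then obtain e where e: "1 = c * e" by (rule dvdE)
    have ec: "e * c = 1" using e by (simp add: mult.commute)
    have "e \<in> mpols m" by (rule mpols_factor[of e c]) (simp_all only: ec mpols_1 one_neq_zero not_False_eq_True)
    then show ?thesis unfolding dvd_in_def using e by blast
  qed
  then have "coprime_in (mpols m) a b" unfolding coprime_in_def by blast
  then have "reduced_fraction m f a b" using ab by (simp only: reduced_fraction_def simp_thms)
  then show ?thesis by (rule that)
qed

section \<open>Constants of the algebraic closure\<close>

lemma is_subfield_image:
  fixes h :: "'b::field \<Rightarrow> 'c::field"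
  assumes "is_subfield S" "h 1 = 1" "\<And>a b. h (a - b) = h a - h b" "\<And>a b. h (a * b) = h a * h b"
    "\<And>a. h (inverse a) = inverse (h a)"
  shows "is_subfield (h ` S)"
proof -
  have "1 \<in> h ` S" using assms(1,2) unfolding is_subfield_def by (metis imageI)
  moreover have "h a - h b \<in> h ` S" "h a * h b \<in> h ` S" if "a \<in> S" "b \<in> S" for a b
    using assms(1) that unfolding is_subfield_def by (auto simp flip: assms(3,4))
  moreover have "inverse (h a) \<in> h ` S" if "a \<in> S" for a
    using assms(1) that unfolding is_subfield_def by (auto simp flip: assms(5))
  ultimately show ?thesis unfolding is_subfield_def by (intro conjI ballI) (auto elim!: imageE)
qed

lemma is_subfield_range:
  fixes h :: "'b::field \<Rightarrow> 'c::field"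
  assumes "h 1 = 1" "\<And>a b. h (a - b) = h a - h b" "\<And>a b. h (a * b) = h a * h b"
    "\<And>a. h (inverse a) = inverse (h a)"
  shows "is_subfield (range h)"
  by (rule is_subfield_image[OF _ assms]) (simp add: is_subfield_def)

lemma algebraic_over_range_to_ac: "algebraic_over (range to_ac) u"
proof -
  obtain p where p: "p \<noteq> 0" "poly (map_poly to_ac p) u = 0" by (rule alg_closure_algebraic)
  have "map_poly to_ac p \<in> polys_over (range to_ac)" by (simp add: polys_over_def coeff_map_poly)
  moreover have "map_poly to_ac p \<noteq> 0"
  proof
    assume "map_poly to_ac p = 0"
    then have "to_ac (coeff p i) = 0" for i
      using coeff_map_poly[of to_ac p i] by simp
    then show False using p(1) by (simp add: poly_eq_iff)
  qed
  ultimately show ?thesis using p(2) unfolding algebraic_over_def by blast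
qed

section \<open>The partial derivatives on the algebraic closure\<close>

lemma ex1_extension:
  fixes D :: "'b::field_char_0 \<Rightarrow> 'b"
  assumes "derivation D"
  shows "\<exists>!E. derivation E \<and> (\<forall>f. E (to_ac f) = to_ac (D f))"
proof -
  \<comment> \<open>The derivation is transported to the image of \<open>to_ac\<close>, where
    \<open>of_ac\<close> inverts \<open>to_ac\<close>; the values elsewhere are immaterial.\<close>
  have pd: "partial_deriv (range to_ac) (\<lambda>w. to_ac (D (of_ac w)))"
    unfolding partial_deriv_def
  proof (intro conjI ballI)
    show "is_subfield (range (to_ac :: 'b \<Rightarrow> _))" by (rule is_subfield_range) simp_all
  next
    fix u v :: "'b alg_closure" assume "u \<in> range to_ac" "v \<in> range to_ac"
    then obtain a b where *: "u = to_ac a" "v = to_ac b" by blast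
    show "to_ac (D (of_ac (u + v))) = to_ac (D (of_ac u)) + to_ac (D (of_ac v))"
      using assms unfolding * to_ac_add[symmetric] of_ac_to_ac by (simp add: derivation_def)
    show "to_ac (D (of_ac (u * v))) = to_ac (D (of_ac u)) * v + u * to_ac (D (of_ac v))"
      using assms unfolding * to_ac_mult[symmetric] of_ac_to_ac by (simp add: derivation_def)
  qed
  interpret partial_deriv_loc "range to_ac" "\<lambda>w. to_ac (D (of_ac w))" by standard (rule pd)
  show ?thesis using derivation_extends[OF algebraic_over_range_to_ac] by simp
qed

lemma pd_ac_props:
  fixes i :: nat
  defines "D \<equiv> pd_ac i :: 'a::field_char_0 alg_fun \<Rightarrow> 'a alg_fun"
  shows "derivation D \<and> (\<forall>f. D (to_ac f) = to_ac (pd i f))"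
  unfolding D_def pd_ac_def by (rule theI'[OF ex1_extension[OF derivation_pd]])

lemma ring_deriv_pd_ac: "ring_deriv (pd_ac i)"
  using pd_ac_props derivation_imp_ring_deriv by blast

lemma pd_ac_to_ac: "pd_ac i (to_ac f) = to_ac (pd i f)"
  using pd_ac_props by blast

text \<open>Both \<open>D\<close> and the zero map extend the zero derivation of \<open>S\<close>,
  and the value of an extension at an algebraic element is unique.\<close>

lemma algebraic_imp_deriv_0:
  fixes D :: "'b::field_char_0 \<Rightarrow> 'b"
  assumes "ring_deriv D" "is_subfield S" "\<And>s. s \<in> S \<Longrightarrow> D s = 0" "algebraic_over S u"
  shows "D u = 0"
proof -
  interpret D: ring_deriv D by fact
  have 1: "partial_deriv S (\<lambda>_. 0)" using assms(2) by (simp add: partial_deriv_def)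
  interpret partial_deriv_loc S "\<lambda>_. 0" by standard (rule 1)
  have UNIV: "is_subfield (UNIV :: 'b set)" by (simp add: is_subfield_def)
  obtain d where d: "\<And>S' D'. partial_deriv S' D' \<and> S \<subseteq> S' \<and> u \<in> S' \<and> (\<forall>s\<in>S. D' s = 0) \<Longrightarrow> D' u = d"
    using derivation_unique[OF assms(4)] by blast
  have "D u = d" by (rule d[of UNIV]) (simp add: partial_deriv_def UNIV D.add D.mult assms(3))
  moreover have "(\<lambda>_. 0) u = d" by (rule d[of UNIV]) (simp add: partial_deriv_def UNIV)
  ultimately show ?thesis by simp
qed

lemma pd_ac_commute:
  fixes u :: "'a::field_char_0 alg_fun"
  shows "pd_ac i (pd_ac j u) = pd_ac j (pd_ac i u)"
proof -
  let ?E = "\<lambda>u :: 'a alg_fun. pd_ac i (pd_ac j u) - pd_ac j (pd_ac i u)"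
  have "is_subfield (range (to_ac :: 'a rat_fun \<Rightarrow> _))" by (rule is_subfield_range) simp_all
  moreover have "?E s = 0" if "s \<in> range to_ac" for s
    using that by (auto simp: pd_ac_to_ac pd_commute[of i j])
  ultimately have "?E u = 0"
    by (rule algebraic_imp_deriv_0[OF ring_deriv_commutator[OF ring_deriv_pd_ac ring_deriv_pd_ac]])
      (assumption | rule algebraic_over_range_to_ac)+
  then show ?thesis by simp
qed

section \<open>The algebraic closure of k as the field of constants\<close>

abbreviation kconst :: "'a::field_char_0 \<Rightarrow> 'a alg_fun" where
  "kconst c \<equiv> to_ac (const c)"

lemma pd_ac_kconst: "pd_ac i (kconst c) = 0"
  by (simp add: pd_ac_to_ac pd_rat_funs_0[OF const_in_rat_funs[of c 0]])

lemma is_subfield_range_kconst: "is_subfield (range kconst)"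
  by (rule is_subfield_range) (simp_all add: const_1 const_diff const_mult const_inverse)

text \<open>Equal to \<open>k_bar\<close> by \<open>k_bar_eq\<close>. As an intersection of kernels
  of derivations it is visibly a field, and membership can be read off from derivatives.\<close>

definition constants :: "'a::field_char_0 alg_fun set" where
  "constants = (\<Inter>i. kernel (pd_ac i))"

lemma constants_iff: "c \<in> constants \<longleftrightarrow> (\<forall>i. pd_ac i c = 0)"
  by (simp add: constants_def kernel_def)

lemma is_subfield_constants: "is_subfield constants"
  unfolding constants_def
  by (rule is_subfield_Inter) (auto intro: is_subfield_kernel ring_deriv_pd_ac)

lemma k_bar_imp_constants: "c \<in> k_bar \<Longrightarrow> c \<in> constants"
proof -
  assume "c \<in> k_bar"
  then obtain p :: "'a poly" where p: "p \<noteq> 0" "poly (map_poly kconst p) c = 0" unfolding k_bar_def by blast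
  have "map_poly kconst p \<in> polys_over (range kconst)"
    by (simp add: polys_over_def coeff_map_poly const_0)
  moreover have "map_poly kconst p \<noteq> 0"
  proof
    assume "map_poly kconst p = 0"
    then have "kconst (coeff p i) = 0" for i
      using coeff_map_poly[of kconst p i] by (simp add: const_0)
    then show False using p(1) by (simp add: poly_eq_iff const_eq_0_iff)
  qed
  ultimately have "algebraic_over (range kconst) c" using p(2) unfolding algebraic_over_def by blast
  then have "pd_ac i c = 0" for i
    by (rule algebraic_imp_deriv_0[OF ring_deriv_pd_ac is_subfield_range_kconst, rotated]) (auto simp: pd_ac_kconst)
  then show ?thesis by (simp add: constants_iff)
qed

text \<open>Differentiate the coefficients of the monic minimal polynomial of \<open>c\<close> over
  k(x_1, x_2, ...): \<open>c\<close> remains a root and the leading coefficient disappears, so the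
  result is 0. All coefficients thus have zero derivatives and lie in k.\<close>

lemma constants_imp_k_bar:
  assumes c: "c \<in> constants"
  shows "c \<in> k_bar"
proof -
  let ?S = "range to_ac :: 'a alg_fun set"
  interpret subfield_set ?S by standard (rule is_subfield_range; simp)
  define ann where "ann P \<longleftrightarrow> P \<in> polys_over ?S \<and> P \<noteq> 0 \<and> poly P c = 0" for P
  obtain P0 where "ann P0" using algebraic_over_range_to_ac[of c] unfolding algebraic_over_def ann_def by blast
  then obtain P where P: "ann P" and min: "\<forall>Q. ann Q \<longrightarrow> degree P \<le> degree Q"
    using ex_has_least_nat[of ann P0 degree] by metis
  define M where "M = smult (Fields.inverse (lead_coeff P)) P"
  have P': "P \<in> polys_over ?S" "P \<noteq> 0" "poly P c = 0" using P by (simp_all add: ann_def)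
  have MS: "M \<in> polys_over ?S" unfolding M_def by (intro polys_smult inverse polys_coeff P')
  have M0: "poly M c = 0" "degree M = degree P" "lead_coeff M = 1"
    using P' by (simp_all add: M_def)
  have coeff0: "pd_ac i (coeff M j) = 0" for i j
  proof -
    interpret D: ring_deriv "pd_ac i" by (rule ring_deriv_pd_ac)
    let ?N = "map_poly (pd_ac i) M"
    have "pd_ac i (poly M c) = poly ?N c + poly (pderiv M) c * pd_ac i c" by (rule D.poly)
    then have N0: "poly ?N c = 0" using c M0 by (simp add: constants_iff D.zero)
    have NS: "?N \<in> polys_over ?S"
      unfolding polys_over_def
    proof (intro CollectI allI)
      fix k
      obtain f where "coeff M k = to_ac f" using polys_coeff[OF MS, of k] by blast
      then show "coeff ?N k \<in> ?S" by (simp add: coeff_map_poly D.zero pd_ac_to_ac)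
    qed
    have "?N = 0"
    proof (rule ccontr)
      assume nz: "?N \<noteq> 0"
      then have le: "degree P \<le> degree ?N" using min NS N0 by (simp add: ann_def)
      have "coeff ?N (degree P) = 0"
        using M0(2,3) by (simp add: coeff_map_poly D.zero D.one)
      moreover have "degree ?N \<le> degree P"
        unfolding M0(2)[symmetric] by (rule degree_map_poly_le)
      ultimately show False using le nz by (metis antisym leading_coeff_0_iff)
    qed
    then have "coeff ?N j = 0" by simp
    then show ?thesis by (simp add: coeff_map_poly D.zero)
  qed
  have "\<exists>a. coeff M j = kconst a" for j
  proof -
    obtain f where f: "coeff M j = to_ac f" using polys_coeff[OF MS, of j] by blast
    have "pd i f = 0" for i using coeff0[of i j] f by (simp add: pd_ac_to_ac)
    then show ?thesis using pd_all_0_imp_const[of f] f by metis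
  qed
  then obtain a where a: "\<And>j. coeff M j = kconst (a j)" by metis
  define p where "p = (\<Sum>j\<le>degree M. Polynomial.monom (a j) j)"
  have pc: "coeff p j = (if j \<le> degree M then a j else 0)" for j
    unfolding p_def by (simp add: coeff_sum)
  have "map_poly kconst p = M"
  proof (rule poly_eqI)
    fix j
    show "coeff (map_poly kconst p) j = coeff M j"
      using a[of j] coeff_eq_0[of M j] by (auto simp: coeff_map_poly const_0 pc)
  qed
  then have "poly (map_poly kconst p) c = 0" "p \<noteq> 0" using M0 by auto
  then show ?thesis unfolding k_bar_def by blast
qed

lemma k_bar_eq: "k_bar = constants"
  using k_bar_imp_constants constants_imp_k_bar by blast

text \<open>Polynomials over the closure have formal variables beside the elements x_i of their
  coefficient field; \<open>evl\<close> identifies the two. It is not injective in general, but it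
  is on polynomials with constant coefficients, the set \<open>kmpols\<close>.\<close>

definition evl :: "'a::field_char_0 alg_fun mpol \<Rightarrow> 'a alg_fun" where
  "evl = mpol_eval (\<lambda>c. c) (\<lambda>t. \<Prod>i\<in>Poly_Mapping.keys t. to_ac (x_var i) ^ Poly_Mapping.lookup t i)"

definition lft :: "'a::field_char_0 mpol \<Rightarrow> 'a alg_fun mpol" where
  "lft = mpol_eval (\<lambda>c. Poly_Mapping.single 0 (kconst c)) (\<lambda>t. Poly_Mapping.single t 1)"

lemma mpol_hom_evl:
  "mpol_hom (\<lambda>c. c) (\<lambda>t. \<Prod>i\<in>Poly_Mapping.keys t. to_ac (x_var i :: 'a::field_char_0 rat_fun) ^ Poly_Mapping.lookup t i)"
proof
  fix s t :: "nat \<Rightarrow>\<^sub>0 nat"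
  let ?x = "\<lambda>i. to_ac (x_var i :: 'a rat_fun)"
  let ?T = "Poly_Mapping.keys s \<union> Poly_Mapping.keys t"
  have sup: "(\<Prod>i\<in>Poly_Mapping.keys u. ?x i ^ Poly_Mapping.lookup u i) = (\<Prod>i\<in>?T. ?x i ^ Poly_Mapping.lookup u i)"
    if "Poly_Mapping.keys u \<subseteq> ?T" for u
    by (rule prod.mono_neutral_left) (use that in \<open>auto simp: in_keys_iff\<close>)
  have "(\<Prod>i\<in>Poly_Mapping.keys (s + t). ?x i ^ Poly_Mapping.lookup (s + t) i)
      = (\<Prod>i\<in>?T. ?x i ^ Poly_Mapping.lookup (s + t) i)"
    by (rule sup[OF Poly_Mapping.keys_add])
  also have "\<dots> = (\<Prod>i\<in>?T. ?x i ^ Poly_Mapping.lookup s i) * (\<Prod>i\<in>?T. ?x i ^ Poly_Mapping.lookup t i)"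
    by (simp only: lookup_add power_add prod.distrib)
  also have "\<dots> = (\<Prod>i\<in>Poly_Mapping.keys s. ?x i ^ Poly_Mapping.lookup s i) *
      (\<Prod>i\<in>Poly_Mapping.keys t. ?x i ^ Poly_Mapping.lookup t i)"
    by (simp only: sup[OF Un_upper1] sup[OF Un_upper2])
  finally show "(\<Prod>i\<in>Poly_Mapping.keys (s + t). ?x i ^ Poly_Mapping.lookup (s + t) i) =
    (\<Prod>i\<in>Poly_Mapping.keys s. ?x i ^ Poly_Mapping.lookup s i) * (\<Prod>i\<in>Poly_Mapping.keys t. ?x i ^ Poly_Mapping.lookup t i)" .
qed simp_all

lemma mpol_hom_lft: "mpol_hom (\<lambda>c. Poly_Mapping.single 0 (kconst c)) (\<lambda>t. Poly_Mapping.single t (1 :: 'a::field_char_0 alg_fun))"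
proof
  show "Poly_Mapping.single 0 (kconst (1::'a)) = (1 :: 'a alg_fun mpol)" by (simp add: const_1)
qed (simp_all add: const_add const_mult single_add mult_single)

interpretation evl: mpol_hom "\<lambda>c. c"
  "\<lambda>t. \<Prod>i\<in>Poly_Mapping.keys t. to_ac (x_var i :: 'a::field_char_0 rat_fun) ^ Poly_Mapping.lookup t i"
  rewrites "mpol_eval (\<lambda>c. c) (\<lambda>t. \<Prod>i\<in>Poly_Mapping.keys t. to_ac (x_var i) ^ Poly_Mapping.lookup t i) = evl"
  by (rule mpol_hom_evl) (simp add: evl_def)

interpretation lft: mpol_hom "\<lambda>c. Poly_Mapping.single 0 (kconst c)" "\<lambda>t. Poly_Mapping.single t (1 :: 'a::field_char_0 alg_fun)"
  rewrites "mpol_eval (\<lambda>c. Poly_Mapping.single 0 (kconst c)) (\<lambda>t. Poly_Mapping.single t 1) = lft"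
  by (rule mpol_hom_lft) (simp add: lft_def)

lemma mpol_sum_singles:
  "p = (\<Sum>t\<in>Poly_Mapping.keys p. Poly_Mapping.single t (Poly_Mapping.lookup p t))"
  by (rule poly_mapping_eqI)
    (auto simp: Poly_Mapping.lookup_sum lookup_single when_def in_keys_iff sum.delta)

lemma lft_single: "lft (Poly_Mapping.single t c) = Poly_Mapping.single t (kconst c)"
  unfolding lft.eval_single by (simp add: mult_single)

lemma lookup_lft: "Poly_Mapping.lookup (lft p) t = kconst (Poly_Mapping.lookup p t)"
  by (induction p rule: mpol_induct)
    (auto simp: lft.eval_0 lft.eval_add lft_single lookup_add lookup_single when_def const_0 const_add)

lemma keys_lft: "Poly_Mapping.keys (lft p) = Poly_Mapping.keys p"
  by (intro equalityI subsetI) (simp_all add: in_keys_iff lookup_lft const_eq_0_iff)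

lemma wdeg_lft: "wdeg w (lft p) = wdeg w p"
  by (simp add: wdeg_def keys_lft)

lemma lft_eq_0_iff: "lft p = 0 \<longleftrightarrow> p = 0"
proof
  assume "lft p = 0"
  then have "Poly_Mapping.lookup p t = 0" for t using lookup_lft[of p t] by (simp add: const_eq_0_iff)
  then show "p = 0" by (intro poly_mapping_eqI) simp
qed (simp add: lft.eval_0)

definition exp_eval :: "(nat \<Rightarrow>\<^sub>0 nat) \<Rightarrow> 'a::field_char_0 alg_fun" where
  "exp_eval t = (\<Prod>i\<in>Poly_Mapping.keys t. to_ac (x_var i) ^ Poly_Mapping.lookup t i)"

lemma evl_single: "evl (Poly_Mapping.single t c) = c * exp_eval t"
  unfolding evl.eval_single exp_eval_def ..

lemma evl_const: "evl (Poly_Mapping.single 0 c) = c"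
  by (simp add: evl_single exp_eval_def)

lemma single_prod_mvar:
  "Poly_Mapping.single t (1::'a::field_char_0) = (\<Prod>i\<in>Poly_Mapping.keys t. mvar i ^ Poly_Mapping.lookup t i)"
proof -
  have *: "(\<Prod>i\<in>T. mvar i ^ Poly_Mapping.lookup t i) =
      Poly_Mapping.single (\<Sum>i\<in>T. Poly_Mapping.single i (Poly_Mapping.lookup t i)) (1::'a)" if "finite T" for T
    using that by induction (simp_all only: prod.insert prod.empty sum.insert sum.empty mvar_power mult_single mult_1 single_one not_False_eq_True)
  have "(\<Sum>i\<in>Poly_Mapping.keys t. Poly_Mapping.single i (Poly_Mapping.lookup t i)) = t"
    by (rule poly_mapping_eqI)
      (auto simp: Poly_Mapping.lookup_sum lookup_single when_def in_keys_iff sum.delta)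
  then show ?thesis using * by simp
qed

lemma Fract_1_prod: "Fract (prod f A) 1 = (\<Prod>a\<in>A. Fract (f a) 1 :: 'b::idom fract)"
proof (induction A rule: infinite_finite_induct)
  case (insert a A)
  have "Fract (f a * prod f A) 1 = Fract (f a) 1 * Fract (prod f A) 1" by (simp only: mult_fract mult_1)
  then show ?case using insert by (simp only: prod.insert not_False_eq_True)
qed (simp_all add: One_fract_def)

lemma Fract_1_power: "Fract (p ^ n) 1 = (Fract p 1 :: 'b::idom fract) ^ n"
proof (induction n)
  case (Suc n)
  have "Fract (p * p ^ n) 1 = Fract p 1 * Fract (p ^ n) 1" by (simp only: mult_fract mult_1)
  then show ?case unfolding power_Suc Suc .
qed (simp add: One_fract_def)

lemma exp_eval_eq:
  "exp_eval t = to_ac (Fract (Poly_Mapping.single t (1 :: 'a::field_char_0)) 1)"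
proof -
  have "Fract (\<Prod>i\<in>Poly_Mapping.keys t. mvar i ^ Poly_Mapping.lookup t i) 1
      = (\<Prod>i\<in>Poly_Mapping.keys t. x_var i ^ Poly_Mapping.lookup t i :: 'a rat_fun)"
    by (simp only: Fract_1_prod Fract_1_power x_var_def)
  then have "Fract (Poly_Mapping.single t 1) 1
      = (\<Prod>i\<in>Poly_Mapping.keys t. x_var i ^ Poly_Mapping.lookup t i :: 'a rat_fun)"
    by (simp only: single_prod_mvar[of t, symmetric])
  then show ?thesis unfolding exp_eval_def by (simp only: to_ac_prod to_ac_power)
qed

lemma evl_lft: "evl (lft p) = to_ac (Fract p 1)"
proof (induction p rule: mpol_induct)
  case (2 p t c)
  have "Fract (Poly_Mapping.single t c) 1 = const c * Fract (Poly_Mapping.single t 1) 1"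
    by (simp add: const_def mult_single)
  moreover have "Fract (p + Poly_Mapping.single t c) 1 = Fract p 1 + Fract (Poly_Mapping.single t c) 1"
    by (rule Fract_1_add)
  ultimately show ?case
    using 2 by (simp only: lft.eval_add evl.eval_add lft_single evl_single exp_eval_eq to_ac_add to_ac_mult)
qed (simp add: lft.eval_0 evl.eval_0 Fract_0)

text \<open>The ring \<open>k_bar[x_1, x_2, ...]\<close>, kept inside the polynomials over the full
  closure because \<open>k_bar\<close> is a set. Prime factors are taken in the larger ring, whose
  coefficients form a field type.\<close>

definition kmpols :: "'a::field_char_0 alg_fun mpol set" where
  "kmpols = {p. \<forall>t. Poly_Mapping.lookup p t \<in> constants}"

interpretation constants: subfield_set "constants :: 'a::field_char_0 alg_fun set"
  by standard (rule is_subfield_constants)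

lemma kmpols_single: "c \<in> constants \<Longrightarrow> Poly_Mapping.single t c \<in> kmpols"
  by (simp add: kmpols_def lookup_single when_def constants.zero)

lemma kmpols_sum: "(\<And>a. a \<in> A \<Longrightarrow> f a \<in> kmpols) \<Longrightarrow> sum f A \<in> kmpols"
  by (simp add: kmpols_def Poly_Mapping.lookup_sum constants.sum)

lemma kmpols_mult: "p \<in> kmpols \<Longrightarrow> q \<in> kmpols \<Longrightarrow> p * q \<in> kmpols"
proof -
  assume "p \<in> kmpols" "q \<in> kmpols"
  then have c: "Poly_Mapping.lookup p t \<in> constants" "Poly_Mapping.lookup q t \<in> constants" for t
    by (simp_all add: kmpols_def)
  have "(\<Sum>t\<in>Poly_Mapping.keys p. Poly_Mapping.single t (Poly_Mapping.lookup p t)) *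
      (\<Sum>t\<in>Poly_Mapping.keys q. Poly_Mapping.single t (Poly_Mapping.lookup q t)) \<in> kmpols"
    unfolding sum_product mult_single by (intro kmpols_sum kmpols_single constants.mult c)
  then show ?thesis by (simp only: mpol_sum_singles[symmetric])
qed

lemma is_subring_kmpols: "is_subring kmpols"
  unfolding is_subring_def
proof (intro conjI ballI)
  show "1 \<in> kmpols" using kmpols_single[OF constants.one, of 0] by simp
qed (simp_all add: kmpols_mult, simp add: kmpols_def lookup_minus constants.diff)

interpretation kmpols: subring_set "kmpols :: 'a::field_char_0 alg_fun mpol set"
  by standard (rule is_subring_kmpols)

lemma kmpols_deriv: "p \<in> kmpols \<Longrightarrow> mpol_deriv i p \<in> kmpols"
  unfolding mpol_deriv_def
  by (intro kmpols_sum kmpols_single constants.mult constants.of_nat) (simp add: kmpols_def)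

lemma kconst_in_constants: "kconst c \<in> constants"
  by (simp add: constants_iff pd_ac_kconst)

lemma lft_in_kmpols: "lft p \<in> kmpols"
  by (simp add: kmpols_def lookup_lft kconst_in_constants)

lemma const_of_nat: "const (of_nat n) = of_nat n"
  by (induction n) (simp_all add: const_0 const_1 const_add)

lemma pd_ac_exp_eval:
  "pd_ac i (exp_eval t) = of_nat (Poly_Mapping.lookup t i) * exp_eval (t - Poly_Mapping.single i 1)"
proof -
  have "pd_ac i (exp_eval t) = evl (lft (mpol_deriv i (Poly_Mapping.single t 1)))"
    unfolding exp_eval_eq pd_ac_to_ac pd_Fract_1 evl_lft ..
  then show ?thesis
    by (simp add: mpol_deriv_single lft_single evl_single const_of_nat del: One_nat_def)
qed

lemma pd_ac_evl:
  assumes "p \<in> kmpols"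
  shows "pd_ac i (evl p) = evl (mpol_deriv i p)"
proof -
  interpret D: ring_deriv "pd_ac i" by (rule ring_deriv_pd_ac)
  have c: "pd_ac i (Poly_Mapping.lookup p t) = 0" for t using assms by (simp add: kmpols_def constants_iff)
  have "evl p = (\<Sum>t\<in>Poly_Mapping.keys p. Poly_Mapping.lookup p t * exp_eval t)"
    unfolding evl_def mpol_eval_def exp_eval_def ..
  then have "pd_ac i (evl p) = (\<Sum>t\<in>Poly_Mapping.keys p. pd_ac i (Poly_Mapping.lookup p t * exp_eval t))"
    by (simp only: D.sum)
  also have "\<dots> = (\<Sum>t\<in>Poly_Mapping.keys p. evl (Poly_Mapping.single (t - Poly_Mapping.single i 1)
       (of_nat (Poly_Mapping.lookup t i) * Poly_Mapping.lookup p t)))"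
    by (intro sum.cong refl) (simp add: D.mult c pd_ac_exp_eval evl_single del: One_nat_def)
  also have "\<dots> = evl (mpol_deriv i p)" unfolding mpol_deriv_def evl.eval_sum ..
  finally show ?thesis .
qed

text \<open>The derivatives of \<open>p\<close> are again in \<open>kmpols\<close>, are sent to 0
  and have smaller total degree. By induction they vanish, so \<open>p\<close> is a constant, which
  \<open>evl\<close> does not change.\<close>

lemma evl_inj:
  assumes "p \<in> kmpols" "evl p = 0"
  shows "p = 0"
  using assms
proof (induction "tdeg p" arbitrary: p rule: less_induct)
  case less
  have "mpol_deriv i p = 0" for i
  proof (rule ccontr)
    assume nz: "mpol_deriv i p \<noteq> 0"
    have "evl (mpol_deriv i p) = 0"
      using pd_ac_evl[OF less.prems(1), of i] less.prems(2) by (simp add: ring_deriv.zero[OF ring_deriv_pd_ac])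
    then show False using less.hyps[OF tdeg_deriv_less[OF nz] kmpols_deriv[OF less.prems(1)]] nz by simp
  qed
  then obtain c where c: "p = Poly_Mapping.single 0 c" using mpols_zeroE[OF mpol_deriv_all_0] by blast
  then show ?case using less.prems(2) by (simp add: evl_const)
qed

text \<open>The field \<open>k_bar(x_1, x_2, ...)\<close>. Arguments of logarithms are kept in it so
  that their denominators can be cleared.\<close>

definition kfracs :: "'a::field_char_0 alg_fun set" where
  "kfracs = {evl p / evl q | p q. p \<in> kmpols \<and> q \<in> kmpols \<and> evl q \<noteq> 0}"

lemma is_subfield_kfracs: "is_subfield kfracs"
  unfolding is_subfield_def
proof (intro conjI ballI)
  have "evl 1 / evl 1 = 1" by (simp add: evl.eval_1)
  then show "1 \<in> kfracs" unfolding kfracs_def using kmpols.one evl.eval_1 one_neq_zero by (metis (mono_tags, lifting) mem_Collect_eq)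
next
  fix u v :: "'a alg_fun" assume "u \<in> kfracs" "v \<in> kfracs"
  then obtain a b c d where *: "u = evl a / evl b" "v = evl c / evl d" "a \<in> kmpols" "b \<in> kmpols" "evl b \<noteq> 0"
    "c \<in> kmpols" "d \<in> kmpols" "evl d \<noteq> 0" unfolding kfracs_def by blast
  have "u - v = evl (a * d - c * b) / evl (b * d)" "u * v = evl (a * c) / evl (b * d)"
    using * by (simp_all add: evl.eval_mult evl.eval_diff diff_frac_eq mult.commute)
  moreover have "a * d - c * b \<in> kmpols" "a * c \<in> kmpols" "b * d \<in> kmpols" "evl (b * d) \<noteq> 0"
    using * by (simp_all add: kmpols.diff kmpols.mult evl.eval_mult)
  ultimately show "u - v \<in> kfracs" "u * v \<in> kfracs" unfolding kfracs_def by blast+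
next
  fix u :: "'a alg_fun" assume "u \<in> kfracs"
  then obtain a b where *: "u = evl a / evl b" "a \<in> kmpols" "b \<in> kmpols" "evl b \<noteq> 0"
    unfolding kfracs_def by blast
  show "inverse u \<in> kfracs"
  proof (cases "evl a = 0")
    case True
    then have "inverse u = u" using * by simp
    then show ?thesis using \<open>u \<in> kfracs\<close> by simp
  next
    case False
    have "inverse u = evl b / evl a" using * by simp
    then show ?thesis unfolding kfracs_def using * False by blast
  qed
qed

lemma evl_in_kfracs: "p \<in> kmpols \<Longrightarrow> evl p \<in> kfracs"
proof -
  assume "p \<in> kmpols"
  moreover have "evl p = evl p / evl 1" "evl 1 \<noteq> 0" by (simp_all add: evl.eval_1)
  ultimately show ?thesis unfolding kfracs_def using kmpols.one by blast
qed

lemma constants_in_kfracs: "c \<in> constants \<Longrightarrow> c \<in> kfracs"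
  using evl_in_kfracs[OF kmpols_single[of c 0]] by (simp add: evl_const)

lemma to_ac_in_kfracs: "to_ac f \<in> kfracs"
proof -
  obtain a b where f: "f = Fract a b" "b \<noteq> 0" by (rule Fract_cases)
  have "to_ac f = evl (lft a) / evl (lft b)" unfolding f(1) Fract_1_divide[of a b] evl_lft by (simp only: to_ac_divide)
  moreover have "evl (lft b) \<noteq> 0" using evl_inj[OF lft_in_kmpols, of b] f(2) lft_eq_0_iff by blast
  ultimately show ?thesis unfolding kfracs_def using lft_in_kmpols by blast
qed

text \<open>The coordinate at \<open>e\<close> with respect to a basis of the closure over k that
  contains \<open>e\<close>.\<close>

lemma k_linear_functional:
  fixes e :: "'a::field_char_0 alg_fun"
  assumes "e \<noteq> 0"
  obtains \<phi> :: "'a alg_fun \<Rightarrow> 'a" where "\<And>u v. \<phi> (u + v) = \<phi> u + \<phi> v"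
    "\<And>c u. \<phi> (kconst c * u) = c * \<phi> u" "\<phi> e \<noteq> 0"
proof -
  interpret V: vector_space "\<lambda>c u. kconst c * u :: 'a alg_fun"
    by standard (simp_all add: const_add const_mult const_1 algebra_simps)
  have ind: "\<not> V.dependent {e}" using assms by simp
  let ?B = "V.extend_basis {e}"
  have B: "\<not> V.dependent ?B" by (rule V.independent_extend_basis[OF ind])
  have sp: "u \<in> V.span ?B" for u using V.span_extend_basis[OF ind] by simp
  have e: "e \<in> ?B" using V.extend_basis_superset[OF ind] by simp
  show ?thesis
  proof (rule that[of "\<lambda>u. V.representation ?B u e"])
    show "V.representation ?B (u + v) e = V.representation ?B u e + V.representation ?B v e" for u v
      by (simp add: V.representation_add[OF B sp sp])
    show "V.representation ?B (kconst c * u) e = c * V.representation ?B u e" for c u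
      by (simp add: V.representation_scale[OF B sp])
    show "V.representation ?B e e \<noteq> 0"
      by (simp add: V.representation_basis[OF B e])
  qed
qed

text \<open>A \<open>k\<close>-linear functional on the extension field, applied to all coefficients, is linear over
  \<open>k[x\<^sub>1, x\<^sub>2, \<dots>]\<close>; it carries a relation \<open>a p' = p a'\<close> back to \<open>k\<close> without raising degrees.\<close>
lemma prime_not_dvd_descends:
  fixes a p :: "'a::field_char_0 mpol"
  assumes p: "prime_elem p" "\<not> p dvd a" and q: "q dvd lft a" "q dvd lft p"
  shows "q dvd 1"
proof -
  obtain a' where a': "lft a = q * a'" using q(1) by (rule dvdE)
  obtain p' where p': "lft p = q * p'" using q(2) by (rule dvdE)
  have p0: "p \<noteq> 0" using p(1) by (simp add: prime_elem_def)
  then have nz: "q \<noteq> 0" "p' \<noteq> 0" using p' lft_eq_0_iff[of p] by auto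
  \<comment> \<open>The functional will be chosen so as not to kill this one coefficient; then the
    image of \<open>p'\<close> is nonzero.\<close>
  then obtain t where t: "Poly_Mapping.lookup p' t \<noteq> 0" by (metis lookup_zero poly_mapping_eqI)
  obtain \<phi> :: "'a alg_fun \<Rightarrow> 'a" where \<phi>: "\<And>u v. \<phi> (u + v) = \<phi> u + \<phi> v"
    "\<And>c u. \<phi> (kconst c * u) = c * \<phi> u" "\<phi> (Poly_Mapping.lookup p' t) \<noteq> 0"
    using k_linear_functional[OF t] by metis
  have \<phi>0: "\<phi> 0 = 0" using \<phi>(1)[of 0 0] by (simp only: add_0_right add_cancel_right_right)
  define \<Phi> where "\<Phi> r = Poly_Mapping.map \<phi> r" for r :: "'a alg_fun mpol"
  have look: "Poly_Mapping.lookup (\<Phi> r) s = \<phi> (Poly_Mapping.lookup r s)" for r s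
    unfolding \<Phi>_def by (simp add: Poly_Mapping.map.rep_eq when_def \<phi>0)
  have \<Phi>0: "\<Phi> 0 = 0" by (rule poly_mapping_eqI) (simp add: look \<phi>0)
  have \<Phi>_add: "\<Phi> (r + s) = \<Phi> r + \<Phi> s" for r s
    by (rule poly_mapping_eqI) (simp add: look lookup_add \<phi>)
  have \<Phi>_single: "\<Phi> (Poly_Mapping.single s c) = Poly_Mapping.single s (\<phi> c)" for s c
    by (rule poly_mapping_eqI) (simp add: look lookup_single when_def \<phi>0)
  have *: "\<Phi> (lft (Poly_Mapping.single s c) * r) = Poly_Mapping.single s c * \<Phi> r" for s c r
    by (induction r rule: mpol_induct)
      (simp_all add: \<Phi>0 \<Phi>_add \<Phi>_single lft_single distrib_left mult_single \<phi>)
  have \<Phi>_mult: "\<Phi> (lft b * r) = b * \<Phi> r" for b r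
    by (induction b rule: mpol_induct)
      (simp_all add: lft.eval_0 lft.eval_add distrib_right \<Phi>0 \<Phi>_add *)
  have "lft a * p' = lft p * a'" using a' p' by (simp add: mult_ac)
  then have "a * \<Phi> p' = p * \<Phi> a'" using \<Phi>_mult[of a p'] \<Phi>_mult[of p a'] by simp
  then have "p dvd a * \<Phi> p'" by simp
  \<comment> \<open>The degree of \<open>\<Phi> p'\<close> is at most that of \<open>p'\<close>,
    which is the degree of \<open>p\<close> minus that of \<open>q\<close>. A nonzero multiple of
    \<open>p\<close> of such a degree leaves no room for a nonconstant \<open>q\<close>.\<close>
  then have "p dvd \<Phi> p'" using p by (simp add: prime_elem_dvd_mult_iff)
  then obtain r where r: "\<Phi> p' = p * r" by (rule dvdE)
  have nz': "\<Phi> p' \<noteq> 0" using \<phi>(3) look[of p' t] by auto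
  then have "tdeg p \<le> tdeg (\<Phi> p')" using tdeg_mult[of p r] r by auto
  also have "\<dots> \<le> tdeg p'"
  proof -
    have "Poly_Mapping.keys (\<Phi> p') \<subseteq> Poly_Mapping.keys p'"
    proof
      fix s assume "s \<in> Poly_Mapping.keys (\<Phi> p')"
      then have "\<phi> (Poly_Mapping.lookup p' s) \<noteq> 0" by (simp add: in_keys_iff look)
      then have "Poly_Mapping.lookup p' s \<noteq> 0" using \<phi>0 by metis
      then show "s \<in> Poly_Mapping.keys p'" by (simp add: in_keys_iff)
    qed
    moreover have "\<forall>t\<in>Poly_Mapping.keys p'. exp_deg t \<le> tdeg p'" using wdeg_le_iff[of exp_deg p' "tdeg p'"] by blast
    ultimately show ?thesis unfolding wdeg_le_iff[of exp_deg "\<Phi> p'"] by blast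
  qed
  finally have "tdeg q = 0" using tdeg_mult[OF nz] p' wdeg_lft[of exp_deg p] by simp
  then show ?thesis using nz by (simp add: mpol_unit_iff)
qed

section \<open>Logarithmic forms\<close>

lemma prime_multiplicity_exists:
  fixes q p :: "'a::field_char_0 mpol"
  assumes "\<not> q dvd 1" "p \<noteq> 0"
  obtains e r where "p = q ^ e * r" "\<not> q dvd r"
proof -
  have "\<exists>e r. p = q ^ e * r \<and> \<not> q dvd r"
    using assms(2)
  proof (induction "tdeg p" arbitrary: p rule: less_induct)
    case less
    show ?case
    proof (cases "q dvd p")
      case False
      then show ?thesis by (intro exI[of _ 0] exI[of _ p]) simp
    next
      case True
      then obtain p1 where p1: "p = q * p1" by (rule dvdE)
      then have "tdeg p1 < tdeg p" "p1 \<noteq> 0" using tdeg_factor_less[of q p1] assms(1) less.prems by auto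
      then obtain e r where "p1 = q ^ e * r" "\<not> q dvd r" using less.hyps by blast
      then have "p = q ^ Suc e * r" "\<not> q dvd r" using p1 by (simp_all add: mult.assoc)
      then show ?thesis by blast
    qed
  qed
  then show ?thesis using that by blast
qed

text \<open>\<open>log_num i ds / log_den ds\<close> is the sum of the \<open>c \<cdot> \<partial>\<^sub>i(N) / N\<close> over \<open>(c, N)\<close> in \<open>ds\<close>, unreduced.\<close>
definition log_den :: "('b::field_char_0 \<times> 'b mpol) list \<Rightarrow> 'b mpol" where
  "log_den ds = prod_list (map snd ds)"

fun log_num :: "nat \<Rightarrow> ('b::field_char_0 \<times> 'b mpol) list \<Rightarrow> 'b mpol" where
  "log_num i [] = 0"
| "log_num i ((c, N) # ds) =
     Poly_Mapping.single 0 c * mpol_deriv i N * log_den ds + N * log_num i ds"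

lemma log_den_Cons: "log_den ((c, N) # ds) = N * log_den ds"
  by (simp add: log_den_def)

lemma log_den_nonzero: "0 \<notin> snd ` set ds \<Longrightarrow> log_den ds \<noteq> 0"
  by (simp add: log_den_def prod_list_zero_iff)

lemma degree_in_add_less:
  assumes "p = 0 \<or> degree_in i p < n" "q = 0 \<or> degree_in i q < n"
  shows "p + q = 0 \<or> degree_in i (p + q) < n"
proof (cases "p = 0 \<or> q = 0")
  case False
  then have "degree_in i p < n" "degree_in i q < n" using assms by auto
  then have "degree_in i (p + q) < n"
    using Poly_Mapping.keys_add[of p q] unfolding degree_in_wdeg wdeg_less_iff by blast
  then show ?thesis ..
qed (use assms in auto)

text \<open>In each summand one factor of the denominator is replaced by its derivative, of smaller
  degree in x_i.\<close>

lemma degree_in_log_num: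
  assumes "0 \<notin> snd ` set ds"
  shows "log_num i ds = 0 \<or> degree_in i (log_num i ds) < degree_in i (log_den ds)"
  using assms
proof (induction ds)
  case (Cons d ds)
  obtain c N where d: "d = (c, N)" by (cases d)
  have N: "N \<noteq> 0" and P: "log_den ds \<noteq> 0"
    using Cons.prems d log_den_nonzero[of ds] by simp_all
  have IH: "log_num i ds = 0 \<or> degree_in i (log_num i ds) < degree_in i (log_den ds)"
    using Cons.IH Cons.prems by simp
  let ?n = "degree_in i (N * log_den ds)"
  have n: "?n = degree_in i N + degree_in i (log_den ds)" by (rule degree_in_mult[OF N P])
  have c0: "degree_in i (Poly_Mapping.single 0 c) = 0"
    using mpols_const[of c 0] by (simp add: mpols_iff_degree_in)
  have "Poly_Mapping.single 0 c * mpol_deriv i N * log_den ds = 0 \<or>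
      degree_in i (Poly_Mapping.single 0 c * mpol_deriv i N * log_den ds) < ?n"
  proof (cases "Poly_Mapping.single 0 c = (0 :: 'a mpol) \<or> mpol_deriv i N = 0")
    case False
    then have "degree_in i (Poly_Mapping.single 0 c * mpol_deriv i N * log_den ds)
        = degree_in i (mpol_deriv i N) + degree_in i (log_den ds)"
      using P by (simp add: degree_in_mult c0)
    then show ?thesis using degree_in_deriv_less[of i N] False n by simp
  qed auto
  moreover have "N * log_num i ds = 0 \<or> degree_in i (N * log_num i ds) < ?n"
    using IH N n by (cases "log_num i ds = 0") (simp_all add: degree_in_mult)
  ultimately show ?case unfolding d log_num.simps log_den_Cons by (rule degree_in_add_less)
qed simp

text \<open>The factor \<open>q\<close> in front of the numerator makes up for the single power of
  \<open>q\<close> that differentiation may cost. The numerator times \<open>q\<close> is then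
  divisible by the full power of \<open>q\<close> in the denominator, so \<open>q\<close> occurs at
  most once after cancellation.\<close>

lemma log_num_multiplicity:
  fixes q :: "'b::field_char_0 mpol"
  assumes q: "prime_elem q" and nz: "0 \<notin> snd ` set ds"
  shows "\<exists>e M S. log_den ds = q ^ e * M \<and> \<not> q dvd M \<and> q * log_num i ds = q ^ e * S"
  using nz
proof (induction ds)
  case Nil
  have "\<not> q dvd 1" using q by (simp add: prime_elem_def)
  then show ?case by (intro exI[of _ 0] exI[of _ 1]) (simp add: log_den_def)
next
  case (Cons d ds)
  obtain c N where d: "d = (c, N)" by (cases d)
  have N0: "N \<noteq> 0" using Cons.prems d by simp
  have qu: "\<not> q dvd 1" using q by (simp add: prime_elem_def)
  obtain e M S where IH: "log_den ds = q ^ e * M" "\<not> q dvd M" "q * log_num i ds = q ^ e * S"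
    using Cons.IH Cons.prems by (metis image_insert insert_iff list.simps(15))
  obtain f R where R: "N = q ^ f * R" "\<not> q dvd R" using prime_multiplicity_exists[OF qu N0] .
  \<comment> \<open>In this form the claim also covers \<open>f = 0\<close>, where an exponent
    \<open>f - 1\<close> would need a case distinction.\<close>
  have "\<exists>T. q * mpol_deriv i (q ^ f) = q ^ f * T"
  proof (induction f)
    case 0
    then show ?case by (intro exI[of _ 0]) (simp add: ring_deriv.one[OF ring_deriv_mpol_deriv])
  next
    case (Suc f)
    then obtain T where T: "q * mpol_deriv i (q ^ f) = q ^ f * T" by blast
    have "q * mpol_deriv i (q ^ Suc f) = q * mpol_deriv i q * q ^ f + q * (q * mpol_deriv i (q ^ f))"
      by (simp add: mpol_deriv_mult algebra_simps)
    also have "\<dots> = q ^ Suc f * (mpol_deriv i q + T)"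
      unfolding T by (simp add: algebra_simps)
    finally show ?case ..
  qed
  then obtain T where T: "q * mpol_deriv i (q ^ f) = q ^ f * T" by blast
  have "q * mpol_deriv i N = q * mpol_deriv i (q ^ f) * R + q ^ f * (q * mpol_deriv i R)"
    unfolding R(1) by (simp add: mpol_deriv_mult algebra_simps)
  also have "\<dots> = q ^ f * (T * R + q * mpol_deriv i R)"
    unfolding T by (simp add: algebra_simps)
  finally have qN: "q * mpol_deriv i N = q ^ f * (T * R + q * mpol_deriv i R)" .
  have "q * log_num i (d # ds) = Poly_Mapping.single 0 c * (q * mpol_deriv i N) * log_den ds + N * (q * log_num i ds)"
    unfolding d by (simp add: algebra_simps)
  also have "\<dots> = q ^ (f + e) * (Poly_Mapping.single 0 c * (T * R + q * mpol_deriv i R) * M + R * S)"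
    unfolding qN IH(1,3) by (subst R(1)) (simp add: power_add algebra_simps)
  finally have 1: "q * log_num i (d # ds) =
      q ^ (f + e) * (Poly_Mapping.single 0 c * (T * R + q * mpol_deriv i R) * M + R * S)" .
  have 2: "log_den (d # ds) = q ^ (f + e) * (R * M)"
    unfolding d log_den_Cons IH(1) R(1) by (simp add: power_add algebra_simps)
  have 3: "\<not> q dvd R * M" using q R(2) IH(2) by (simp add: prime_elem_dvd_mult_iff)
  show ?case using 1 2 3 by blast
qed

section \<open>Logarithmic forms with constant coefficients\<close>

definition log_form :: "('a::field_char_0 alg_fun \<times> 'a alg_fun) list \<Rightarrow> nat \<Rightarrow> 'a alg_fun" where
  "log_form us i = (\<Sum>(c, u)\<leftarrow>us. c * (pd_ac i u / u))"

definition log_data :: "('a::field_char_0 alg_fun \<times> 'a alg_fun) list \<Rightarrow> bool" where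
  "log_data us \<longleftrightarrow> (\<forall>(c, u)\<in>set us. c \<in> constants \<and> u \<in> kfracs \<and> u \<noteq> 0)"

lemma log_form_Cons: "log_form ((c, u) # us) i = c * (pd_ac i u / u) + log_form us i"
  by (simp add: log_form_def)

lemma log_form_append: "log_form (us @ vs) i = log_form us i + log_form vs i"
  by (simp add: log_form_def)

text \<open>The logarithmic derivative of a quotient is a difference, so an entry
  \<open>(c, N/d)\<close> becomes the two entries \<open>(c, N)\<close> and
  \<open>(- c, d)\<close>.\<close>

lemma log_form_polynomial:
  assumes "log_data us"
  shows "\<exists>ds. (\<forall>(c, N)\<in>set ds. c \<in> constants \<and> N \<in> kmpols \<and> N \<noteq> 0) \<and>
    (\<forall>i. log_form us i = log_form (map (\<lambda>(c, N). (c, evl N)) ds) i)"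
  using assms
proof (induction us)
  case Nil
  then show ?case by (intro exI[of _ "[]"]) simp
next
  case (Cons a us)
  obtain c u where a: "a = (c, u)" by (cases a)
  have cu: "c \<in> constants" "u \<in> kfracs" "u \<noteq> 0" using Cons.prems a by (auto simp: log_data_def)
  have "log_data us" using Cons.prems by (auto simp: log_data_def)
  then obtain ds where ds: "\<forall>(c, N)\<in>set ds. c \<in> constants \<and> N \<in> kmpols \<and> N \<noteq> 0"
    "\<And>i. log_form us i = log_form (map (\<lambda>(c, N). (c, evl N)) ds) i" using Cons.IH by blast
  obtain N d where Nd: "u = evl N / evl d" "N \<in> kmpols" "d \<in> kmpols" "evl d \<noteq> 0"
    using cu(2) unfolding kfracs_def by blast
  have nz: "evl N \<noteq> 0" "N \<noteq> 0" "d \<noteq> 0" using Nd cu(3) by (auto simp: evl.eval_0)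
  let ?ds = "(c, N) # (- c, d) # ds"
  have "c * (pd_ac i u / u) = c * (pd_ac i (evl N) / evl N) + (- c) * (pd_ac i (evl d) / evl d)" for i
    unfolding Nd(1) derivation_divide[OF ring_deriv_pd_ac Nd(4)]
    using Nd(4) nz(1) by (simp add: field_simps power2_eq_square)
  then have "log_form (a # us) i = log_form (map (\<lambda>(c, N). (c, evl N)) ?ds) i" for i
    unfolding a by (simp add: log_form_Cons ds(2))
  moreover have "\<forall>(c, N)\<in>set ?ds. c \<in> constants \<and> N \<in> kmpols \<and> N \<noteq> 0"
    using ds(1) cu(1) Nd nz by (auto simp: constants.minus)
  ultimately show ?case by blast
qed

lemma log_step:
  fixes y :: "'b::field"
  assumes "y \<noteq> 0"
  shows "(c * (x / y) + l) * (y * p) = c * x * p + y * (l * p)"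
proof -
  have "c * (x / y) * (y * p) = c * x * p" using assms by simp
  then show ?thesis by (simp only: distrib_right) (simp only: mult_ac)
qed

lemma log_num_den:
  assumes "\<forall>(c, N)\<in>set ds. c \<in> constants \<and> N \<in> kmpols \<and> N \<noteq> 0"
  shows "log_num i ds \<in> kmpols \<and> log_den ds \<in> kmpols \<and>
    log_form (map (\<lambda>(c, N). (c, evl N)) ds) i * evl (log_den ds) = evl (log_num i ds)"
  using assms
proof (induction ds)
  case Nil
  show ?case by (simp add: log_form_def log_den_def kmpols.zero kmpols.one evl.eval_0)
next
  case (Cons a ds)
  obtain c N where a: "a = (c, N)" by (cases a)
  have N: "c \<in> constants" "N \<in> kmpols" "N \<noteq> 0" using Cons.prems a by auto
  have evN: "evl N \<noteq> 0" using evl_inj N by blast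
  have IH: "log_num i ds \<in> kmpols" "log_den ds \<in> kmpols"
    "log_form (map (\<lambda>(c, N). (c, evl N)) ds) i * evl (log_den ds) = evl (log_num i ds)"
    using Cons by auto
  have "log_form (map (\<lambda>(c, N). (c, evl N)) (a # ds)) i * evl (log_den (a # ds))
      = c * pd_ac i (evl N) * evl (log_den ds) + evl N * (log_form (map (\<lambda>(c, N). (c, evl N)) ds) i * evl (log_den ds))"
    unfolding a list.map prod.case log_form_Cons log_den_Cons evl.eval_mult by (rule log_step[OF evN])
  also have "\<dots> = evl (log_num i (a # ds))"
    unfolding IH(3) pd_ac_evl[OF N(2)] a log_num.simps by (simp add: evl.eval_add evl.eval_mult evl_const)
  finally show ?case
    using IH N by (simp add: a log_den_Cons kmpols.add kmpols.mult kmpols_single kmpols_deriv)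
qed

text \<open>Clearing denominators gives \<open>lft a * log_den ds = lft b * log_num i ds\<close>.
  Comparing degrees in x_i yields properness. For squarefreeness, a prime \<open>p1\<close> whose
  square divides \<open>b\<close> is followed to a prime \<open>q\<close> of the larger
  ring.\<close>

theorem log_form_reduced_fraction:
  assumes us: "log_data us" and f: "to_ac f = log_form us i" and red: "reduced_fraction m f a b"
  shows "a = 0 \<or> degree_in i a < degree_in i b" and "squarefree_in (mpols m) b"
proof -
  obtain ds where ds: "\<forall>(c, N)\<in>set ds. c \<in> constants \<and> N \<in> kmpols \<and> N \<noteq> 0"
    "\<And>i. log_form us i = log_form (map (\<lambda>(c, N). (c, evl N)) ds) i"
    using log_form_polynomial[OF us] by blast
  have nz: "0 \<notin> snd ` set ds" using ds(1) by fastforce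
  let ?P = "log_den ds" and ?T = "log_num i ds"
  have PT: "?T \<in> kmpols" "?P \<in> kmpols" "to_ac f * evl ?P = evl ?T"
    using log_num_den[OF ds(1), of i] f ds(2) by simp_all
  have P0: "?P \<noteq> 0" using log_den_nonzero nz by blast
  have ab: "f = Fract a b" "b \<noteq> 0" "a \<in> mpols m" "b \<in> mpols m" "coprime_in (mpols m) a b"
    using red by (simp_all add: reduced_fraction_def)
  have evb: "evl (lft b) \<noteq> 0" using evl_inj[OF lft_in_kmpols] ab(2) lft_eq_0_iff by blast
  have "to_ac f = evl (lft a) / evl (lft b)"
    unfolding ab(1) Fract_1_divide[of a b] evl_lft by (simp only: to_ac_divide)
  then have fb: "evl (lft a) = to_ac f * evl (lft b)" using evb by simp
  have "evl (lft a) * evl ?P = evl (lft b) * (to_ac f * evl ?P)" unfolding fb by (simp only: mult_ac)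
  then have "evl (lft a) * evl ?P = evl (lft b) * evl ?T" unfolding PT(3) .
  then have "evl (lft a * ?P - lft b * ?T) = 0" by (simp add: evl.eval_mult evl.eval_diff)
  then have "lft a * ?P - lft b * ?T = 0"
    by (rule evl_inj[rotated]) (intro kmpols.diff kmpols.mult lft_in_kmpols PT)
  then have key: "lft a * ?P = lft b * ?T" by simp
  show "a = 0 \<or> degree_in i a < degree_in i b"
  proof (cases "a = 0")
    case False
    then have la: "lft a \<noteq> 0" "lft b \<noteq> 0" using ab(2) by (simp_all add: lft_eq_0_iff)
    then have T0: "?T \<noteq> 0" using key P0 by auto
    have "degree_in i (lft a) + degree_in i ?P = degree_in i (lft b) + degree_in i ?T"
      using arg_cong[OF key, of "degree_in i"] la T0 P0 by (simp add: degree_in_mult)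
    moreover have "degree_in i ?T < degree_in i ?P" using degree_in_log_num[of ds i] nz T0 by blast
    ultimately show ?thesis by (simp add: degree_in_wdeg wdeg_lft)
  qed simp
  show "squarefree_in (mpols m) b"
    unfolding squarefree_in_def
  proof (intro ballI impI)
    fix p assume p: "p \<in> mpols m" "dvd_in (mpols m) (p ^ 2) b"
    obtain r where r: "b = p ^ 2 * r" using p(2) unfolding dvd_in_def by blast
    have p0: "p \<noteq> 0" using r ab(2) by auto
    have "p dvd 1"
    proof (rule ccontr)
      assume "\<not> p dvd 1"
      then obtain p1 where p1: "prime_elem p1" "p1 dvd p" using prime_factor_exists p0 by blast
      then obtain p2 where p2: "p = p1 * p2" using dvdE by blast
      have p1u: "\<not> p1 dvd 1" "p1 \<noteq> 0" using p1(1) by (simp_all add: prime_elem_def)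
      have p1b: "b = p1 ^ 2 * (p2 ^ 2 * r)" unfolding r p2 by (simp add: power_mult_distrib mult.assoc)
      have na: "\<not> p1 dvd a"
      proof
        assume d: "p1 dvd a"
        have db: "p1 dvd b" unfolding p1b power2_eq_square by (simp add: mult.assoc)
        have in_m: "dvd_in (mpols m) p1 h" if "p1 dvd h" "h \<in> mpols m" for h
        proof (cases "h = 0")
          case True
          then show ?thesis unfolding dvd_in_def by (intro bexI[of _ 0]) (simp_all add: mpols_0)
        next
          case False
          obtain k where k: "h = p1 * k" using \<open>p1 dvd h\<close> by (rule dvdE)
          then have "k \<in> mpols m" using mpols_dvd[of k h m] that(2) False by simp
          then show ?thesis unfolding dvd_in_def using k by blast
        qed
        have "p1 \<in> mpols m" by (rule mpols_dvd[OF db ab(4,2)])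
        then have "dvd_in (mpols m) p1 1"
          using ab(5) in_m[OF d ab(3)] in_m[OF db ab(4)] unfolding coprime_in_def by blast
        then show False using p1u unfolding dvd_in_def by (metis dvd_triv_left)
      qed
      have "lft p1 \<noteq> 0" "\<not> lft p1 dvd 1"
        using p1u by (simp_all add: lft_eq_0_iff mpol_unit_iff wdeg_lft)
      then obtain q where q: "prime_elem q" "q dvd lft p1" using prime_factor_exists by blast
      obtain q' where q': "lft p1 = q * q'" using q(2) by (rule dvdE)
      obtain e M S where M: "?P = q ^ e * M" "\<not> q dvd M" "q * ?T = q ^ e * S"
        using log_num_multiplicity[OF q(1), of ds i] nz by blast
      have q0: "q \<noteq> 0" using q(1) by (simp add: prime_elem_def)
      have lb: "lft b = q ^ 2 * (q' ^ 2 * lft (p2 ^ 2 * r))"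
        unfolding p1b lft.eval_mult[of "p1 ^ 2"] lft.eval_power[of p1] q' by (simp add: power_mult_distrib mult.assoc)
      \<comment> \<open>The square of \<open>q\<close> divides \<open>lft b\<close>, while the
        logarithmic form has \<open>q\<close> at most once in its denominator. The excess factor
        must divide \<open>lft a\<close>, and \<open>prime_not_dvd_descends\<close> forbids that
        because \<open>p1\<close> does not divide \<open>a\<close>.\<close>
      have "q ^ Suc e * (lft a * M) = q * (lft a * ?P)" unfolding M(1) by (simp add: mult_ac)
      also have "\<dots> = lft b * (q * ?T)" unfolding key by (simp add: mult_ac)
      also have "\<dots> = q ^ Suc e * (q * (q' ^ 2 * lft (p2 ^ 2 * r) * S))"
        unfolding M(3) lb by (simp add: power2_eq_square mult_ac)
      finally have "lft a * M = q * (q' ^ 2 * lft (p2 ^ 2 * r) * S)"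
        using q0 by simp
      then have "q dvd lft a * M" by simp
      then have "q dvd lft a" using q(1) M(2) by (simp add: prime_elem_dvd_mult_iff)
      then have "q dvd 1" using prime_not_dvd_descends[OF p1(1) na _ q(2)] by blast
      then show False using q(1) by (simp add: prime_elem_def)
    qed
    then obtain s where s: "1 = p * s" by (rule dvdE)
    then have "s * p = 1" by (simp add: mult.commute)
    then have "s \<in> mpols m" using mpols_factor[of s p m] mpols_1[of m] by simp
    then show "dvd_in (mpols m) p 1" unfolding dvd_in_def using s by blast
  qed
qed

section \<open>Hermite reduction\<close>

context subfield_set
begin

text \<open>A factor of least positive degree. Irreducibility over \<open>S\<close> is phrased by
  the degrees of divisors with coefficients in \<open>S\<close>, since the factor may split over the
  ambient field.\<close>

lemma polys_irreducible_factor: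
  assumes "G \<in> polys_over S" "degree G > 0"
  obtains q where "q \<in> polys_over S" "degree q > 0" "q dvd G"
    "\<And>r. r \<in> polys_over S \<Longrightarrow> r dvd q \<Longrightarrow> degree r = 0 \<or> degree r = degree q"
proof -
  define fac where "fac q \<longleftrightarrow> q \<in> polys_over S \<and> degree q > 0 \<and> q dvd G" for q
  have "fac G" using assms by (simp add: fac_def)
  then obtain q where q: "fac q" and min: "\<forall>r. fac r \<longrightarrow> degree q \<le> degree r"
    using ex_has_least_nat[of fac G degree] by metis
  have q': "q \<in> polys_over S" "degree q > 0" "q dvd G" using q by (simp_all add: fac_def)
  show ?thesis
  proof (rule that[OF q'])
    fix r assume r: "r \<in> polys_over S" "r dvd q"
    have "q \<noteq> 0" using q'(2) by auto
    then have "degree r \<le> degree q" using r(2) by (simp add: dvd_imp_degree_le)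
    moreover have "degree r = 0 \<or> degree q \<le> degree r"
    proof (cases "degree r = 0")
      case False
      then have "fac r" using r(1) dvd_trans[OF r(2) q'(3)] by (simp add: fac_def)
      then show ?thesis by (intro disjI2 min[rule_format])
    qed simp
    ultimately show "degree r = 0 \<or> degree r = degree q" by auto
  qed
qed

lemma bezout_normalize:
  assumes "G \<in> polys_over S" "s \<in> polys_over S" "t \<in> polys_over S" "G \<noteq> 0" "G = s * A + t * B"
    "degree G = 0"
  obtains s' t' where "s' \<in> polys_over S" "t' \<in> polys_over S" "s' * A + t' * B = 1"
proof -
  obtain g where g: "G = [:g:]" using assms(6) by (rule degree_eq_zeroE)
  have gS: "g \<in> S" using polys_coeff[OF assms(1), of 0] g by simp
  let ?c = "Fields.inverse g"
  have "smult ?c s * A + smult ?c t * B = smult ?c G"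
    unfolding assms(5) by (simp add: smult_add_right)
  also have "\<dots> = 1" using assms(4) g by (simp add: pCons_one)
  finally have "smult ?c s * A + smult ?c t * B = 1" .
  then show ?thesis using that polys_smult[OF inverse[OF gS]] assms by blast
qed

lemma polys_irreducible_coprime:
  assumes q: "q \<in> polys_over S" "degree q > 0"
    "\<And>r. r \<in> polys_over S \<Longrightarrow> r dvd q \<Longrightarrow> degree r = 0 \<or> degree r = degree q"
    and A: "A \<in> polys_over S" "\<not> q dvd A"
  obtains s t where "s \<in> polys_over S" "t \<in> polys_over S" "s * q + t * A = 1"
proof -
  have q0: "q \<noteq> 0" using q(2) by auto
  obtain G s t where G: "G \<in> polys_over S" "s \<in> polys_over S" "t \<in> polys_over S" "G \<noteq> 0"
    "G = s * q + t * A" "G dvd q" "G dvd A"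
    using polys_bezout[OF q(1) A(1)] q0 by blast
  have "degree G \<noteq> degree q"
  proof
    assume d: "degree G = degree q"
    obtain c where c: "q = G * c" using G(6) by (rule dvdE)
    have "c \<noteq> 0" using c q0 by auto
    then have "degree q = degree G + degree c"
      unfolding c by (rule degree_mult_eq[OF G(4)])
    then have "degree c = 0" using d by simp
    then obtain k where k: "c = [:k:]" by (rule degree_eq_zeroE)
    then have "k \<noteq> 0" using \<open>c \<noteq> 0\<close> by simp
    have "q = smult k G" using c k by simp
    then have "q dvd G" using \<open>k \<noteq> 0\<close> by (metis smult_dvd_iff dvd_refl)
    then show False using A(2) G(7) dvd_trans by blast
  qed
  then have "degree G = 0" using q(3)[OF G(1,6)] by simp
  then show ?thesis using bezout_normalize[OF G(1-5)] that by metis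
qed

lemma polys_irreducible_prime:
  assumes q: "q \<in> polys_over S" "degree q > 0"
    "\<And>r. r \<in> polys_over S \<Longrightarrow> r dvd q \<Longrightarrow> degree r = 0 \<or> degree r = degree q"
    and A: "A \<in> polys_over S" and dvd: "q dvd A * B"
  shows "q dvd A \<or> q dvd B"
proof (cases "q dvd A")
  case False
  then obtain s t where st: "s * q + t * A = 1" using polys_irreducible_coprime[OF q A] by blast
  have "B = (s * q + t * A) * B" by (simp only: st mult_1_left)
  also have "\<dots> = q * (s * B) + t * (A * B)" by (simp add: algebra_simps)
  finally have e: "B = q * (s * B) + t * (A * B)" .
  have "q dvd q * (s * B) + t * (A * B)" by (rule dvd_add[OF dvd_triv_left dvd_mult[OF dvd]])
  then have "q dvd B" by (subst e)
  then show ?thesis ..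
qed simp

end

locale subfield_char_0 = subfield_set S for S :: "'b::field_char_0 set"
begin

lemma irreducible_not_dvd_pderiv:
  assumes "degree (q :: 'b poly) > 0"
  shows "\<not> q dvd pderiv q"
proof
  assume d: "q dvd pderiv q"
  have "pderiv q \<noteq> 0" using assms by (simp add: pderiv_eq_0_iff)
  then have "degree q \<le> degree (pderiv q)" using d by (simp add: dvd_imp_degree_le)
  then show False using assms by (simp add: degree_pderiv)
qed

text \<open>With B = q R, a common irreducible factor q of B and its derivative divides q' R but not
  q', hence divides R, and its square divides B. The Bezout identity holds in every extension field,
  so squarefreeness over F will give simple roots in the closure.\<close>

lemma squarefree_bezout_pderiv:
  assumes B: "B \<in> polys_over S" "B \<noteq> 0" "squarefree_in (polys_over S) B"
  obtains s t where "s \<in> polys_over S" "t \<in> polys_over S" "s * B + t * pderiv B = 1"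
proof -
  have B': "pderiv B \<in> polys_over S" by (rule polys_pderiv[OF B(1)])
  obtain G s t where G: "G \<in> polys_over S" "s \<in> polys_over S" "t \<in> polys_over S" "G \<noteq> 0"
    "G = s * B + t * pderiv B" "G dvd B" "G dvd pderiv B"
    using polys_bezout[OF B(1) B'] B(2) by blast
  have "degree G = 0"
  proof (rule ccontr)
    assume "degree G \<noteq> 0"
    then have "degree G > 0" by simp
    then obtain q where q: "q \<in> polys_over S" "degree q > 0" "q dvd G"
      "\<And>r. r \<in> polys_over S \<Longrightarrow> r dvd q \<Longrightarrow> degree r = 0 \<or> degree r = degree q"
      using polys_irreducible_factor[OF G(1)] by metis
    have "q dvd B" using q(3) G(6) by (rule dvd_trans)
    then obtain R where R: "B = q * R" by (rule dvdE)
    have "q dvd pderiv B" using q(3) G(7) by (rule dvd_trans)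
    moreover have "pderiv B = q * pderiv R + pderiv q * R" unfolding R pderiv_mult by (simp add: mult.commute)
    ultimately have "q dvd pderiv q * R" by (simp add: dvd_add_right_iff)
    then have "q dvd R"
      using polys_irreducible_prime[OF q(1,2,4) polys_pderiv[OF q(1)]] irreducible_not_dvd_pderiv[OF q(2)] by blast
    then have "q ^ 2 dvd B" unfolding R power2_eq_square by (rule mult_dvd_mono[OF dvd_refl])
    then have "dvd_in (polys_over S) (q ^ 2) B" using dvd_in_polys_iff[OF B(1) polys_power[OF q(1)]] by blast
    then have "dvd_in (polys_over S) q 1" using B(3) q(1) unfolding squarefree_in_def by blast
    then obtain c where "1 = q * c" unfolding dvd_in_def by blast
    then have "q dvd 1" by (rule dvdI)
    then show False using q(2) by (simp add: poly_dvd_1)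
  qed
  then show ?thesis using bezout_normalize[OF G(1-5)] that by metis
qed

end

lemma antiderivative_exists:
  fixes S :: "'b::field_char_0 set"
  assumes "is_subfield S" "T \<in> polys_over S"
  obtains I where "I \<in> polys_over S" "pderiv I = T"
proof -
  interpret subfield_set S by standard fact
  define I where "I = (\<Sum>i\<le>degree T. Polynomial.monom (coeff T i / of_nat (Suc i)) (Suc i))"
  have "I \<in> polys_over S"
    unfolding I_def by (intro polys_sum polys_monom divide polys_coeff[OF assms(2)] of_nat)
  moreover have "pderiv I = T"
  proof -
    have "pderiv I = (\<Sum>i\<le>degree T. Polynomial.monom (coeff T i) i)"
      unfolding I_def pderiv_sum
      by (intro sum.cong refl) (simp add: pderiv_monom del: of_nat_Suc)
    then show ?thesis by (simp add: poly_as_sum_of_monoms)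
  qed
  ultimately show ?thesis by (rule that)
qed

text \<open>The field S(x) with derivation d/dx. It is instantiated with F, where it provides
  Hermite reduction, and with the elements of the closure killed by all \<open>pd_ac j\<close> for
  \<open>n \<le> j\<close>, where it lifts identities from values at \<open>x\<close> to
  polynomials.\<close>

locale rational_extension = subfield_char_0 S for S :: "'b::field_char_0 set" +
  fixes D :: "'b \<Rightarrow> 'b" and x :: 'b and K :: "'b set"
  assumes D: "ring_deriv D" and D_S: "\<And>s. s \<in> S \<Longrightarrow> D s = 0" and D_x: "D x = 1"
    and K: "is_subfield K" and S_K: "S \<subseteq> K" and x_K: "x \<in> K"
begin

sublocale D: ring_deriv D by (rule D)
sublocale K: subfield_set K by standard (rule K)

lemma eval_in_K: "P \<in> polys_over S \<Longrightarrow> poly P x \<in> K"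
  using S_K by (intro K.poly_in x_K) (auto simp: polys_over_def)

lemma D_eval: "P \<in> polys_over S \<Longrightarrow> D (poly P x) = poly (pderiv P) x"
  using D.poly_const[of P x] by (simp add: D_x D_S polys_coeff)

lemma eval_eq_0: "P \<in> polys_over S \<Longrightarrow> poly P x = 0 \<Longrightarrow> P = 0"
  by (rule poly_transcendental[OF D D_x]) (simp_all add: D_S polys_coeff)

lemma D_eval_divide:
  assumes "P \<in> polys_over S" "Q \<in> polys_over S" "Q \<noteq> 0"
  shows "D (poly P x / poly Q x) = poly (pderiv P * Q - P * pderiv Q) x / (poly Q x) ^ 2"
proof -
  have "poly Q x \<noteq> 0" using eval_eq_0 assms by blast
  then show ?thesis by (simp add: derivation_divide[OF D] D_eval assms)
qed

text \<open>Integration by parts: the derivative of u / Q^(k+1) is split off and the exponent of Q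
  drops by one. \<open>du\<close> and \<open>dq\<close> stand for the derivatives of u and
  Q.\<close>

lemma hermite_step:
  fixes Q R p u v du dq :: 'b and k :: nat
  assumes "Q \<noteq> 0" "R \<noteq> 0"
    and "p = - (of_nat (Suc k) * u * dq * R) + Q * v"
  shows "p / (Q ^ Suc (Suc k) * R) =
    (du * Q ^ Suc k - u * (of_nat (Suc k) * Q ^ k * dq)) / (Q ^ Suc k) ^ 2 + (v - du * R) / (Q ^ Suc k * R)"
proof -
  have 1: "(du * Q ^ Suc k - u * (of_nat (Suc k) * Q ^ k * dq)) / (Q ^ Suc k) ^ 2
      = (du * R * Q - u * of_nat (Suc k) * dq * R) / (Q ^ Suc (Suc k) * R)"
  proof -
    have "(du * Q ^ Suc k - u * (of_nat (Suc k) * Q ^ k * dq)) * (Q ^ Suc (Suc k) * R)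
        = (du * R * Q - u * of_nat (Suc k) * dq * R) * (Q ^ Suc k) ^ 2"
      by (simp add: power2_eq_square algebra_simps del: of_nat_Suc)
    then show ?thesis using assms(1,2) by (simp add: frac_eq_eq del: of_nat_Suc power_Suc)
  qed
  have 2: "(v - du * R) / (Q ^ Suc k * R) = ((v - du * R) * Q) / (Q ^ Suc (Suc k) * R)"
    using assms(1,2) by (simp add: field_simps)
  have "p = (du * R * Q - u * of_nat (Suc k) * dq * R) + (v - du * R) * Q"
    unfolding assms(3) by (simp add: algebra_simps del: of_nat_Suc)
  then show ?thesis unfolding 1 2 by (simp only: add_divide_distrib)
qed

text \<open>A multiple irreducible factor of the denominator is lowered by one integration by parts,
  which decreases the degree of the denominator. Once it is squarefree, the polynomial part has an
  antiderivative and the proper rest is put into lowest terms.\<close>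

theorem hermite_exists:
  assumes "P \<in> polys_over S" "Q \<in> polys_over S" "Q \<noteq> 0"
  shows "\<exists>g A B. g \<in> K \<and> A \<in> polys_over S \<and> B \<in> polys_over S \<and> B \<noteq> 0 \<and> coprime_in (polys_over S) A B \<and>
    (A = 0 \<or> degree A < degree B) \<and> squarefree_in (polys_over S) B \<and>
    poly P x / poly Q x = D g + poly A x / poly B x"
  using assms
proof (induction "degree Q" arbitrary: P Q rule: less_induct)
  case less
  note P = less.prems(1) and Q = less.prems(2,3)
  have Qx: "poly Q x \<noteq> 0" using eval_eq_0 Q by blast
  show ?case
  proof (cases "squarefree_in (polys_over S) Q")
    case sqf: True
    obtain T R where TR: "T \<in> polys_over S" "R \<in> polys_over S" "P = Q * T + R"
      "R = 0 \<or> degree R < degree Q"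
      using polys_division[OF P Q] by blast
    obtain I where I: "I \<in> polys_over S" "pderiv I = T" using antiderivative_exists[OF subfield TR(1)] .
    obtain G s t where G: "G \<in> polys_over S" "s \<in> polys_over S" "t \<in> polys_over S" "G \<noteq> 0"
      "G = s * R + t * Q" "G dvd R" "G dvd Q"
      using polys_bezout[OF TR(2) Q(1)] Q(2) by blast
    obtain A where A: "R = G * A" using G(6) by (rule dvdE)
    obtain B where B: "Q = G * B" using G(7) by (rule dvdE)
    have AS: "A \<in> polys_over S" using TR(2) unfolding A by (rule polys_cofactor[OF _ G(1,4)])
    have BS: "B \<in> polys_over S" using Q(1) unfolding B by (rule polys_cofactor[OF _ G(1,4)])
    have B0: "B \<noteq> 0" using Q(2) B by auto
    have "G * (s * A + t * B) = G * 1" using G(5) A B by (simp add: algebra_simps)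
    then have st: "s * A + t * B = 1" using G(4) by (simp only: mult_left_cancel simp_thms)
    have "coprime_in (polys_over S) A B"
      unfolding coprime_in_def
    proof (intro ballI impI)
      fix c assume c: "c \<in> polys_over S" "dvd_in (polys_over S) c A" "dvd_in (polys_over S) c B"
      then have "c dvd A" "c dvd B" unfolding dvd_in_def by auto
      then have "c dvd s * A + t * B" by (intro dvd_add dvd_mult)
      then show "dvd_in (polys_over S) c 1" unfolding st using dvd_in_polys_iff[OF polys_1 c(1)] by blast
    qed
    moreover have "A = 0 \<or> degree A < degree B"
    proof (cases "A = 0")
      case False
      then have "degree G + degree A < degree G + degree B"
        using TR(4) G(4) B0 unfolding A B by (simp add: degree_mult_eq)
      then show ?thesis by simp
    qed simp
    moreover have "squarefree_in (polys_over S) B"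
      unfolding squarefree_in_def
    proof (intro ballI impI)
      fix q assume q: "q \<in> polys_over S" "dvd_in (polys_over S) (q ^ 2) B"
      then obtain r where r: "r \<in> polys_over S" "B = q ^ 2 * r" unfolding dvd_in_def by blast
      have "Q = q ^ 2 * (G * r)" unfolding B r(2) by (simp only: mult_ac)
      then have "dvd_in (polys_over S) (q ^ 2) Q" unfolding dvd_in_def using polys_mult[OF G(1) r(1)] by blast
      then show "dvd_in (polys_over S) q 1" using sqf q(1) unfolding squarefree_in_def by blast
    qed
    moreover have "poly P x / poly Q x = D (poly I x) + poly A x / poly B x"
    proof -
      have nz: "poly G x \<noteq> 0" "poly B x \<noteq> 0" using Qx unfolding B by auto
      have "poly P x / poly Q x = poly T x + poly R x / poly Q x"
        unfolding TR(3) using Qx by (simp add: add_divide_distrib)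
      also have "poly R x / poly Q x = poly A x / poly B x" unfolding A B using nz by simp
      finally show ?thesis by (simp add: D_eval I)
    qed
    ultimately show ?thesis using eval_in_K[OF I(1)] AS BS B0 by blast
  next
    case False
    then obtain q0 where q0: "q0 \<in> polys_over S" "dvd_in (polys_over S) (q0 ^ 2) Q" "\<not> dvd_in (polys_over S) q0 1"
      unfolding squarefree_in_def by blast
    have q0Q: "q0 ^ 2 dvd Q" using q0(2) unfolding dvd_in_def by auto
    have q00: "q0 \<noteq> 0" using q0Q Q(2) by auto
    have "degree q0 > 0"
    proof (rule ccontr)
      assume "\<not> degree q0 > 0"
      then obtain c where "q0 = [:c:]" using degree_eq_zeroE by blast
      then have "q0 dvd 1" using q00 by (simp add: const_poly_dvd_1)
      then show False using q0(3) dvd_in_polys_iff[OF polys_1 q0(1)] by blast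
    qed
    then obtain q where q: "q \<in> polys_over S" "degree q > 0" "q dvd q0"
      "\<And>r. r \<in> polys_over S \<Longrightarrow> r dvd q \<Longrightarrow> degree r = 0 \<or> degree r = degree q"
      using polys_irreducible_factor[OF q0(1)] by metis
    have "q ^ 2 dvd Q" using dvd_power_same[OF q(3)] q0Q by (rule dvd_trans)
    define ok where "ok e \<longleftrightarrow> q ^ e dvd Q" for e
    have bound: "e \<le> degree Q" if "ok e" for e
    proof -
      have "degree (q ^ e) \<le> degree Q"
        using that Q(2) unfolding ok_def by (rule dvd_imp_degree_le)
      moreover have "e \<le> degree (q ^ e)"
        using q(2) by (cases "q = 0") (auto simp: degree_power_eq)
      ultimately show ?thesis by simp
    qed
    \<comment> \<open>The full exponent of \<open>q\<close> in \<open>Q\<close>, so that the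
      cofactor \<open>R\<close> is prime to \<open>q\<close>; it is at least 2 and therefore has the
      form \<open>Suc (Suc k)\<close>.\<close>
    obtain e where e: "ok e" "\<forall>d. ok d \<longrightarrow> d \<le> e"
      using ex_has_greatest_nat[of ok 2 "\<lambda>e. e" "Suc (degree Q)"] \<open>q ^ 2 dvd Q\<close> bound
      unfolding ok_def by (metis le_imp_less_Suc)
    have "2 \<le> e" using e(2) \<open>q ^ 2 dvd Q\<close> unfolding ok_def by blast
    then obtain k where "e = 2 + k" by (rule less_eqE)
    then have k: "e = Suc (Suc k)" by simp
    obtain R where R: "Q = q ^ e * R" using e(1) unfolding ok_def by (rule dvdE)
    have nR: "\<not> q dvd R"
    proof
      assume "q dvd R"
      then have "q ^ Suc e dvd Q" unfolding R power_Suc2 by (rule mult_dvd_mono[OF dvd_refl])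
      then show False using e(2) unfolding ok_def by (metis Suc_n_not_le_n)
    qed
    have qe0: "q ^ e \<noteq> 0" "q \<noteq> 0" using R Q(2) q(2) by auto
    have RS: "R \<in> polys_over S" using Q(1) unfolding R by (rule polys_cofactor[OF _ polys_power[OF q(1)] qe0(1)])
    have R0: "R \<noteq> 0" using R Q(2) by auto
    have q'S: "pderiv q \<in> polys_over S" by (rule polys_pderiv[OF q(1)])
    have "\<not> q dvd R * pderiv q"
      using polys_irreducible_prime[OF q(1,2,4) RS] nR irreducible_not_dvd_pderiv[OF q(2)] by blast
    then obtain s t where st: "s \<in> polys_over S" "t \<in> polys_over S" "s * q + t * (R * pderiv q) = 1"
      using polys_irreducible_coprime[OF q(1,2,4) polys_mult[OF RS q'S]] by metis
    \<comment> \<open>The Bezout identity times \<open>P\<close> reads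
      \<open>P = P * s * q + P * t * R * pderiv q\<close>. The factor -1/(k+1) turns the second
      summand into the term that the derivative of u / q^(k+1) produces.\<close>
    define c where "c = - Fields.inverse (of_nat (Suc k) :: 'b)"
    have cS: "c \<in> S" unfolding c_def by (intro minus inverse of_nat)
    define u where "u = smult c (P * t)"
    define v where "v = P * s"
    have uS: "u \<in> polys_over S" unfolding u_def by (intro polys_smult cS polys_mult P st)
    have vS: "v \<in> polys_over S" unfolding v_def by (intro polys_mult P st)
    have "of_nat (Suc k) * (Fields.inverse (of_nat (Suc k)) :: 'b) = 1" by (simp del: of_nat_Suc)
    then have ck: "of_nat (Suc k) * c = - 1" unfolding c_def by (simp only: mult_minus_right)
    have px: "poly P x = - (of_nat (Suc k) * poly u x * poly (pderiv q) x * poly R x) + poly q x * poly v x"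
    proof -
      have 1: "poly s x * poly q x + poly t x * (poly R x * poly (pderiv q) x) = 1"
        using arg_cong[OF st(3), of "\<lambda>f. poly f x"] by simp
      have "- (of_nat (Suc k) * poly u x * poly (pderiv q) x * poly R x) + poly q x * poly v x
          = - ((of_nat (Suc k) * c) * poly P x * poly t x * poly (pderiv q) x * poly R x) + poly q x * (poly P x * poly s x)"
        by (simp add: u_def v_def mult.assoc del: of_nat_Suc)
      also have "\<dots> = poly P x * (poly s x * poly q x + poly t x * (poly R x * poly (pderiv q) x))"
        unfolding ck by (simp add: algebra_simps)
      finally show ?thesis unfolding 1 by simp
    qed
    have qx: "poly q x \<noteq> 0" "poly R x \<noteq> 0" using Qx unfolding R k by auto
    define Q1 where "Q1 = q ^ Suc k * R"
    define P1 where "P1 = v - pderiv u * R"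
    have Q1: "Q1 \<in> polys_over S" "Q1 \<noteq> 0"
      unfolding Q1_def using qe0(2) R0 by (auto intro!: polys_mult polys_power q(1) RS)
    have P1: "P1 \<in> polys_over S" unfolding P1_def by (intro polys_diff polys_mult polys_pderiv uS vS RS)
    have "Q = q * Q1" unfolding R k Q1_def by (simp only: power_Suc mult.assoc)
    then have "degree Q1 < degree Q"
      using q(2) Q1(2) qe0(2) by (simp add: degree_mult_eq)
    then obtain g A B where IH: "g \<in> K" "A \<in> polys_over S" "B \<in> polys_over S" "B \<noteq> 0" "coprime_in (polys_over S) A B"
      "A = 0 \<or> degree A < degree B" "squarefree_in (polys_over S) B"
      "poly P1 x / poly Q1 x = D g + poly A x / poly B x"
      using less.hyps[OF _ P1 Q1] by blast
    define g1 where "g1 = poly u x / poly (q ^ Suc k) x"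
    have g1K: "g1 \<in> K" unfolding g1_def by (intro K.divide eval_in_K uS polys_power q(1))
    have Dg1: "D g1 = (poly (pderiv u) x * poly q x ^ Suc k
        - poly u x * (of_nat (Suc k) * poly q x ^ k * poly (pderiv q) x)) / (poly q x ^ Suc k) ^ 2"
    proof -
      have "q ^ Suc k \<noteq> 0" using qe0(2) by simp
      from D_eval_divide[OF uS polys_power[OF q(1)] this] show ?thesis
        unfolding g1_def by (simp only: pderiv_power_Suc poly_diff poly_mult poly_power poly_smult)
    qed
    have "poly P x / poly Q x = D g1 + poly P1 x / poly Q1 x"
      using hermite_step[OF qx px, of "poly (pderiv u) x"] unfolding Dg1 R k P1_def Q1_def
      by (simp only: poly_mult poly_power poly_diff)
    also have "\<dots> = D (g1 + g) + poly A x / poly B x"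
      unfolding IH(8) D.add by (simp only: add.assoc)
    finally show ?thesis using K.add[OF g1K IH(1)] IH(2-7) by blast
  qed
qed

end

section \<open>Residues and the Rothstein--Trager resultant\<close>

lemma map_poly_to_ac_add: "map_poly to_ac (p + q) = map_poly to_ac p + map_poly to_ac q"
  by (rule poly_eqI) (simp add: coeff_map_poly)

lemma map_poly_to_ac_mult: "map_poly to_ac (p * q) = map_poly to_ac p * map_poly to_ac q"
  by (rule poly_eqI) (simp add: coeff_map_poly coeff_mult to_ac_sum)

lemma map_poly_to_ac_1: "map_poly to_ac 1 = 1"
  by (simp add: map_poly_1)

lemma map_poly_to_ac_pderiv: "map_poly to_ac (pderiv p) = pderiv (map_poly to_ac p)"
  by (rule poly_eqI) (simp add: coeff_map_poly coeff_pderiv del: of_nat_Suc)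

lemma degree_map_poly_to_ac: "degree (map_poly to_ac p) = degree p"
  by (rule degree_map_poly) simp

lemma map_poly_to_ac_eq_0_iff: "map_poly to_ac p = 0 \<longleftrightarrow> p = 0"
  by (metis coeff_0 coeff_map_poly leading_coeff_0_iff map_poly_0 to_ac_0 to_ac_eq_0_iff)

lemma poly_map_poly_to_ac: "poly (map_poly to_ac p) (to_ac x) = to_ac (poly p x)"
  by (induction p) (simp_all add: Polynomial.map_poly_pCons[of to_ac, OF to_ac_0])

text \<open>If the formal degree of \<open>q\<close> is too large by one, the first column of the
  Sylvester matrix contains only the coefficient of \<open>p\<close> at \<open>m\<close>, and
  expansion along it removes one row and one column.\<close>

lemma resultant_sub_Suc:
  fixes p q :: "'b::comm_ring_1 poly"
  assumes q: "coeff q (Suc n) = 0"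
  shows "resultant_sub m (Suc n) p q = coeff p m * resultant_sub m n p q"
proof -
  let ?M = "sylvester_mat_sub m (Suc n) p q"
  have M: "?M \<in> carrier_mat (Suc (m + n)) (Suc (m + n))"
    using sylvester_mat_sub_carrier[of m "Suc n" p q] by simp
  have col: "?M $$ (i, 0) = (if i = 0 then coeff p m else 0)" if "i < Suc (m + n)" for i
  proof -
    have "i < m + Suc n" "0 < m + Suc n" using that by simp_all
    from sylvester_mat_sub_index[OF this, of p q] show ?thesis
      using q by (auto simp: le_Suc_eq not_less)
  qed
  have "det ?M = (\<Sum>i<Suc (m + n). ?M $$ (i, 0) * cofactor ?M i 0)"
    by (rule laplace_expansion_column[OF M]) simp
  also have "\<dots> = (\<Sum>i<Suc (m + n). if i = 0 then coeff p m * cofactor ?M 0 0 else 0)"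
    by (intro sum.cong refl) (simp add: col)
  also have "\<dots> = coeff p m * cofactor ?M 0 0"
    by (subst sum.delta) simp_all
  also have "cofactor ?M 0 0 = det (mat_delete ?M 0 0)" by (simp add: cofactor_def)
  also have "mat_delete ?M 0 0 = sylvester_mat_sub m n p q"
  proof (rule eq_matI)
    fix i j
    assume "i < dim_row (sylvester_mat_sub m n p q)" "j < dim_col (sylvester_mat_sub m n p q)"
    then have ij: "i < m + n" "j < m + n" by simp_all
    have "mat_delete ?M 0 0 $$ (i, j) = ?M $$ (Suc i, Suc j)"
      using ij by (simp add: mat_delete_def)
    also have "\<dots> = sylvester_mat_sub m n p q $$ (i, j)"
    proof -
      have S: "Suc i < m + Suc n" "Suc j < m + Suc n" using ij by simp_all
      have "i - j = Suc n" if "\<not> i < n" "i - n \<le> Suc j" "\<not> i - n \<le> j" using that by simp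
      then show ?thesis
        unfolding sylvester_mat_sub_index[OF S] sylvester_mat_sub_index[OF ij] using q by auto
    qed
    finally show "mat_delete ?M 0 0 $$ (i, j) = sylvester_mat_sub m n p q $$ (i, j)" .
  qed (simp_all add: mat_delete_def)
  finally show ?thesis by (simp add: resultant_sub_def)
qed

text \<open>Specializing z can lower the degree of A - z B' while the Sylvester matrix keeps its
  size. This is the factor by which the specialized determinant then differs from the
  resultant.\<close>

lemma resultant_sub_formal_degree:
  fixes p q :: "'b::comm_ring_1 poly"
  assumes "degree q \<le> n"
  shows "resultant_sub (degree p) n p q
    = lead_coeff p ^ (n - degree q) * resultant p q"
  using assms
proof (induction n)
  case 0
  then show ?case by (simp add: resultant_sub)
next
  case (Suc n)
  show ?case
  proof (cases "degree q = Suc n")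
    case True
    then show ?thesis by (simp add: resultant_sub)
  next
    case False
    then have le: "degree q \<le> n" using Suc.prems by simp
    then have "coeff q (Suc n) = 0" by (intro coeff_eq_0) simp
    then show ?thesis using Suc.IH[OF le] le by (simp add: resultant_sub_Suc Suc_diff_le mult.assoc)
  qed
qed

text \<open>The determinant commutes with substituting c for z. A drop of degree contributes only a
  power of the nonzero leading coefficient of B, so a zero still means a common factor.\<close>

lemma rt_resultant_eval:
  fixes A B :: "'f::field_char_0 poly"
  assumes B: "degree B > 0" and A: "A = 0 \<or> degree A < degree B"
  defines "A' \<equiv> map_poly to_ac A" and "B' \<equiv> map_poly to_ac B"
  shows "poly (map_poly to_ac (rt_resultant A B)) c = 0 \<longleftrightarrow>
    degree (gcd B' (A' - smult c (pderiv B'))) \<noteq> 0"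
proof -
  define h where "h p = poly (map_poly to_ac p) c" for p :: "'f poly"
  interpret h: comm_ring_hom h
    by standard (simp_all add: h_def map_poly_to_ac_add map_poly_to_ac_mult)
  define n where "n = degree B - 1"
  let ?B = "map_poly (\<lambda>c. [:c:]) B"
  let ?G = "map_poly (\<lambda>c. [:c:]) A - smult [:0, 1:] (map_poly (\<lambda>c. [:c:]) (pderiv B))"
  have Gc: "coeff ?G i = [:coeff A i, - coeff (pderiv B) i:]" for i
    by (simp add: coeff_map_poly)
  have degB: "degree ?B = degree B" by (rule degree_map_poly) simp
  \<comment> \<open>The coefficient at \<open>n\<close> contains -z times the leading coefficient of
    \<open>pderiv B\<close>. This cannot cancel against the coefficient of \<open>A\<close>, which
    is free of z.\<close>
  have "degree ?G = n"
  proof (rule antisym)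
    show "degree ?G \<le> n"
    proof (rule degree_le, intro allI impI)
      fix i assume i: "n < i"
      then have "degree B \<le> i" unfolding n_def by simp
      then have "coeff A i = 0" using A by (cases "A = 0") (simp_all add: coeff_eq_0)
      moreover have "coeff (pderiv B) i = 0"
        using i unfolding n_def by (intro coeff_eq_0) (simp add: degree_pderiv)
      ultimately show "coeff ?G i = 0" unfolding Gc by simp
    qed
    have "coeff (pderiv B) n \<noteq> 0"
      using B unfolding n_def by (auto simp: coeff_pderiv simp del: of_nat_Suc)
    then have "coeff ?G n \<noteq> 0" unfolding Gc by simp
    then show "n \<le> degree ?G" by (rule le_degree)
  qed
  then have res: "rt_resultant A B = resultant_sub (degree B) n ?B ?G"
    unfolding rt_resultant_def resultant_sub degB by simp
  have hB: "map_poly h ?B = B'"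
    by (rule poly_eqI) (simp add: B'_def coeff_map_poly h_def Polynomial.map_poly_pCons)
  have hG: "map_poly h ?G = A' - smult c (pderiv B')"
  proof (rule poly_eqI)
    fix i
    have "coeff (map_poly h ?G) i = h (coeff ?G i)"
      by (rule coeff_map_poly) (simp add: h_def)
    also have "\<dots> = to_ac (coeff A i) - c * to_ac (coeff (pderiv B) i)"
      unfolding Gc h_def by (simp add: Polynomial.map_poly_pCons)
    finally show "coeff (map_poly h ?G) i = coeff (A' - smult c (pderiv B')) i"
      by (simp add: A'_def B'_def coeff_map_poly flip: map_poly_to_ac_pderiv)
  qed
  have "h (rt_resultant A B) = resultant_sub (degree B) n B' (A' - smult c (pderiv B'))"
    unfolding res resultant_sub_def h.hom_det[symmetric] sylvester_mat_sub_map[of h, OF h.hom_zero] hB hG ..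
  also have "\<dots> = resultant_sub (degree B') n B' (A' - smult c (pderiv B'))"
    by (simp add: B'_def degree_map_poly_to_ac)
  also have "\<dots> = lead_coeff B' ^ (n - degree (A' - smult c (pderiv B')))
      * resultant B' (A' - smult c (pderiv B'))"
  proof (rule resultant_sub_formal_degree)
    have "degree A' \<le> n" using A B unfolding A'_def n_def by (auto simp: degree_map_poly_to_ac)
    moreover have "degree (smult c (pderiv B')) \<le> n"
      using degree_smult_le[of c "pderiv B'"] unfolding B'_def n_def by (simp add: degree_pderiv degree_map_poly_to_ac)
    ultimately show "degree (A' - smult c (pderiv B')) \<le> n" by (rule degree_diff_le)
  qed
  finally have "h (rt_resultant A B) = 0 \<longleftrightarrow> resultant B' (A' - smult c (pderiv B')) = 0"
    using B by (auto simp: B'_def map_poly_to_ac_eq_0_iff)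
  then show ?thesis unfolding h_def resultant_0_gcd .
qed

section \<open>Partial fractions at simple poles\<close>

abbreviation lin :: "'b::comm_ring_1 \<Rightarrow> 'b poly" where
  "lin \<beta> \<equiv> [:- \<beta>, 1:]"

definition simple_roots :: "'b::field poly \<Rightarrow> bool" where
  "simple_roots B \<longleftrightarrow> B \<noteq> 0 \<and> (\<forall>\<beta>. \<not> lin \<beta> ^ 2 dvd B)"

definition roots :: "'b::field poly \<Rightarrow> 'b set" where
  "roots B = {\<beta>. poly B \<beta> = 0}"

lemma prod_lin_dvd:
  fixes B :: "'b::field poly"
  assumes "finite Z" "\<And>\<beta>. \<beta> \<in> Z \<Longrightarrow> poly B \<beta> = 0"
  shows "(\<Prod>\<beta>\<in>Z. lin \<beta>) dvd B"
  using assms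
proof (induction Z)
  case (insert \<beta> Z)
  then obtain K where K: "B = (\<Prod>\<beta>\<in>Z. lin \<beta>) * K" by (metis dvdE insert_iff)
  have "poly (\<Prod>\<beta>\<in>Z. lin \<beta>) \<beta> \<noteq> 0" using insert.hyps by (auto simp: poly_prod)
  then have "poly K \<beta> = 0" using insert.prems[of \<beta>] K by simp
  then have "lin \<beta> dvd K" by (simp add: poly_eq_0_iff_dvd)
  then show ?case unfolding K prod.insert[OF insert.hyps] by (metis dvd_refl mult.commute mult_dvd_mono)
qed simp

lemma simple_roots_dvd: "simple_roots B \<Longrightarrow> G dvd B \<Longrightarrow> simple_roots G"
  unfolding simple_roots_def using dvd_trans dvd_0_left by blast

lemma simple_roots_factorization:
  fixes G :: "'b::alg_closed_field poly"
  assumes "simple_roots G"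
  shows "G = smult (lead_coeff G) (\<Prod>\<beta>\<in>roots G. lin \<beta>)" and "finite (roots G)"
proof -
  have G0: "G \<noteq> 0" using assms by (simp add: simple_roots_def)
  show fin: "finite (roots G)" unfolding roots_def using G0 by (rule poly_roots_finite)
  have "(\<Prod>\<beta>\<in>roots G. lin \<beta>) dvd G" by (rule prod_lin_dvd[OF fin]) (simp add: roots_def)
  then obtain K where K: "G = (\<Prod>\<beta>\<in>roots G. lin \<beta>) * K" by (rule dvdE)
  have "degree K = 0"
  proof (rule ccontr)
    assume "degree K \<noteq> 0"
    then obtain \<kappa> where \<kappa>: "poly K \<kappa> = 0" using alg_closed_imp_poly_has_root[of K] by auto
    have "poly G \<kappa> = 0" by (subst K) (simp add: \<kappa>)
    then have "\<kappa> \<in> roots G" by (simp add: roots_def)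
    then have "lin \<kappa> dvd (\<Prod>\<beta>\<in>roots G. lin \<beta>)" using fin by (rule dvd_prodI[rotated])
    moreover have "lin \<kappa> dvd K" using \<kappa> by (simp add: poly_eq_0_iff_dvd)
    ultimately have "lin \<kappa> ^ 2 dvd (\<Prod>\<beta>\<in>roots G. lin \<beta>) * K"
      unfolding power2_eq_square by (rule mult_dvd_mono)
    then show False using assms K unfolding simple_roots_def by metis
  qed
  then obtain k where k: "K = [:k:]" by (rule degree_eq_zeroE)
  have "lead_coeff (\<Prod>\<beta>\<in>roots G. lin \<beta>) = 1" by (simp add: lead_coeff_prod)
  then have "lead_coeff ((\<Prod>\<beta>\<in>roots G. lin \<beta>) * K) = k" unfolding k by (simp add: lead_coeff_mult)
  then have "lead_coeff G = k" using K by metis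
  then show "G = smult (lead_coeff G) (\<Prod>\<beta>\<in>roots G. lin \<beta>)"
    using K k by (metis mult.right_neutral mult_smult_right smult_one pCons_one smult_pCons smult_0_right mult.commute)
qed

text \<open>For simple roots this is \<open>B\<close> divided by \<open>lin \<beta>\<close>. Written
  as a product, it visibly has coefficients in any field that contains the roots and the leading
  coefficient.\<close>

definition cofac :: "'b::field poly \<Rightarrow> 'b \<Rightarrow> 'b poly" where
  "cofac B \<beta> = smult (lead_coeff B) (\<Prod>\<gamma>\<in>roots B - {\<beta>}. lin \<gamma>)"

definition residue_at :: "'b::field poly \<Rightarrow> 'b poly \<Rightarrow> 'b \<Rightarrow> 'b" where
  "residue_at A B \<beta> = poly A \<beta> / poly (pderiv B) \<beta>"

locale simple_poles =
  fixes B :: "'b::{alg_closed_field, field_char_0} poly"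
  assumes simple: "simple_roots B"
begin

lemma fin: "finite (roots B)" using simple_roots_factorization[OF simple] by blast

lemma B0: "B \<noteq> 0" using simple by (simp add: simple_roots_def)

lemma cofac: "\<beta> \<in> roots B \<Longrightarrow> B = lin \<beta> * cofac B \<beta>"
proof -
  assume b: "\<beta> \<in> roots B"
  have "B = smult (lead_coeff B) (\<Prod>\<beta>\<in>roots B. lin \<beta>)"
    by (rule simple_roots_factorization[OF simple])
  also have "(\<Prod>\<beta>\<in>roots B. lin \<beta>) = lin \<beta> * (\<Prod>\<gamma>\<in>roots B - {\<beta>}. lin \<gamma>)"
    by (rule prod.remove[OF fin b])
  finally show ?thesis unfolding cofac_def by (simp only: mult_smult_right)
qed

lemma cofac_other: "\<beta> \<in> roots B \<Longrightarrow> \<gamma> \<in> roots B \<Longrightarrow> \<gamma> \<noteq> \<beta> \<Longrightarrow> poly (cofac B \<beta>) \<gamma> = 0"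
  unfolding cofac_def using fin by (auto simp: poly_prod)

lemma cofac_same: "\<beta> \<in> roots B \<Longrightarrow> poly (cofac B \<beta>) \<beta> \<noteq> 0"
  unfolding cofac_def using fin B0 by (auto simp: poly_prod)

lemma pderiv_root: "\<beta> \<in> roots B \<Longrightarrow> poly (pderiv B) \<beta> = poly (cofac B \<beta>) \<beta>"
proof -
  assume "\<beta> \<in> roots B"
  then have "pderiv B = pderiv (lin \<beta> * cofac B \<beta>)" using cofac by simp
  then show ?thesis by (simp only: pderiv_mult) (simp add: pderiv_pCons)
qed

lemma degree_cofac: "\<beta> \<in> roots B \<Longrightarrow> degree (cofac B \<beta>) < degree B"
proof -
  assume b: "\<beta> \<in> roots B"
  have "cofac B \<beta> \<noteq> 0" using cofac[OF b] B0 by auto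
  then have "degree (lin \<beta> * cofac B \<beta>) = Suc (degree (cofac B \<beta>))"
    by (subst degree_mult_eq) simp_all
  then show ?thesis using cofac[OF b] by simp
qed

lemma degree_B: "degree B = card (roots B)"
proof -
  have "degree B = degree (smult (lead_coeff B) (\<Prod>\<beta>\<in>roots B. lin \<beta>))"
    using simple_roots_factorization(1)[OF simple] by simp
  also have "\<dots> = card (roots B)" using B0 by (simp add: degree_prod_eq_sum_degree)
  finally show ?thesis .
qed

text \<open>The numerator over \<open>B\<close> of the sum of partial fractions with prescribed
  residues \<open>c\<close>.\<close>

definition comb :: "('b \<Rightarrow> 'b) \<Rightarrow> 'b poly" where
  "comb c = (\<Sum>\<beta>\<in>roots B. smult (c \<beta>) (cofac B \<beta>))"

lemma degree_comb: "comb c = 0 \<or> degree (comb c) < degree B"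
proof (cases "roots B = {}")
  case False
  then obtain \<beta> where "\<beta> \<in> roots B" by blast
  then have pos: "0 < degree B" using degree_cofac by (metis gr_zeroI not_less_zero)
  have "degree (comb c) < degree B"
    unfolding comb_def
  proof (rule degree_sum_less[OF _ pos])
    fix \<beta> assume "\<beta> \<in> roots B"
    then show "degree (smult (c \<beta>) (cofac B \<beta>)) < degree B"
      using degree_cofac degree_smult_le[of "c \<beta>" "cofac B \<beta>"] by (meson le_less_trans)
  qed
  then show ?thesis ..
qed (simp add: comb_def)

lemma comb_root: "\<beta> \<in> roots B \<Longrightarrow> poly (comb c) \<beta> = c \<beta> * poly (cofac B \<beta>) \<beta>"
proof -
  assume b: "\<beta> \<in> roots B"
  have "poly (comb c) \<beta> = (\<Sum>\<gamma>\<in>roots B. if \<gamma> = \<beta> then c \<beta> * poly (cofac B \<beta>) \<beta> else 0)"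
    unfolding comb_def poly_sum using cofac_other b by (intro sum.cong refl) auto
  then show ?thesis using b fin by simp
qed

lemma comb_eval:
  assumes "poly B x \<noteq> 0"
  shows "poly (comb c) x / poly B x = (\<Sum>\<beta>\<in>roots B. c \<beta> / (x - \<beta>))"
proof -
  have "c \<beta> * poly (cofac B \<beta>) x / poly B x = c \<beta> / (x - \<beta>)" if "\<beta> \<in> roots B" for \<beta>
  proof -
    have e: "poly B x = (x - \<beta>) * poly (cofac B \<beta>) x"
      using arg_cong[OF cofac[OF that], of "\<lambda>p. poly p x"] by (simp add: algebra_simps)
    then have "poly (cofac B \<beta>) x \<noteq> 0" using assms by auto
    then show ?thesis unfolding e by simp
  qed
  then show ?thesis
    unfolding comb_def poly_sum sum_divide_distrib by (intro sum.cong refl) simp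
qed

text \<open>Lagrange interpolation: both sides have degree below that of \<open>B\<close> and agree
  at its roots, whose number is the degree of \<open>B\<close>.\<close>

lemma interpolation:
  assumes "A = 0 \<or> degree A < degree B"
  shows "A = comb (residue_at A B)"
proof (rule ccontr)
  let ?C = "A - comb (residue_at A B)"
  assume "A \<noteq> comb (residue_at A B)"
  then have nz: "?C \<noteq> 0" by simp
  have "poly ?C \<beta> = 0" if "\<beta> \<in> roots B" for \<beta>
    using comb_root[OF that] pderiv_root[OF that] cofac_same[OF that] by (simp add: residue_at_def)
  then have "roots B \<subseteq> {\<beta>. poly ?C \<beta> = 0}" by blast
  then have "card (roots B) \<le> card {\<beta>. poly ?C \<beta> = 0}" by (rule card_mono[OF poly_roots_finite[OF nz]])
  also have "\<dots> \<le> degree ?C" by (rule card_poly_roots_bound[OF nz])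
  finally have le: "degree B \<le> degree ?C" unfolding degree_B .
  show False
  proof (cases "A = 0 \<or> comb (residue_at A B) = 0")
    case True
    then show ?thesis using le assms degree_comb[of "residue_at A B"] nz by auto
  next
    case False
    then have "degree ?C < degree B"
      using assms degree_comb[of "residue_at A B"] by (intro degree_diff_less) auto
    then show ?thesis using le by simp
  qed
qed

lemma comb_eq_0: "comb c = 0 \<Longrightarrow> \<beta> \<in> roots B \<Longrightarrow> c \<beta> = 0"
  using comb_root[of \<beta> c] cofac_same[of \<beta>] by simp

end

text \<open>A derivative of a rational function has no simple poles. A common root of \<open>P\<close> and \<open>Q\<close> is
  cancelled first; at a remaining root of \<open>Q\<close> of order \<open>s\<close> the derivative has a pole of order
  \<open>s + 1\<close>.\<close>
lemma derivative_no_simple_poles: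
  fixes P Q B E :: "'b::{alg_closed_field, field_char_0} poly"
  assumes Q: "Q \<noteq> 0" and B: "simple_roots B" and E: "E = 0 \<or> degree E < degree B"
    and eq: "(pderiv P * Q - P * pderiv Q) * B = E * Q ^ 2"
  shows "E = 0"
  using Q eq
proof (induction "degree Q" arbitrary: P Q rule: less_induct)
  case less
  have B0: "B \<noteq> 0" using B by (simp add: simple_roots_def)
  show ?case
  proof (cases "degree Q = 0")
    case True
    then obtain c where c: "Q = [:c:]" by (rule degree_eq_zeroE)
    then have c0: "c \<noteq> 0" using less.prems by simp
    have "smult c (pderiv P * B) = smult (c * c) E"
      using less.prems(2) unfolding c by (simp add: power2_eq_square mult.commute)
    \<comment> \<open>For constant \<open>Q\<close> this makes \<open>E\<close> a polynomial
      multiple of \<open>B\<close>, yet of smaller degree unless it is 0.\<close>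
    then have e: "pderiv P * B = smult c E"
      using c0 by (metis smult_eq_iff smult_smult mult_left_cancel smult_cancel)
    show ?thesis
    proof (rule ccontr)
      assume "E \<noteq> 0"
      then have "pderiv P \<noteq> 0" using e c0 by auto
      then have "degree (pderiv P * B) = degree (pderiv P) + degree B"
        using B0 by (rule degree_mult_eq)
      then show False using e c0 E \<open>E \<noteq> 0\<close> by simp
    qed
  next
    case False
    then obtain \<gamma> where \<gamma>: "poly Q \<gamma> = 0" using alg_closed_imp_poly_has_root[of Q] by auto
    show ?thesis
    proof (cases "poly P \<gamma> = 0")
      case True
      obtain P1 where P1: "P = lin \<gamma> * P1" using True by (metis dvdE poly_eq_0_iff_dvd)
      obtain Q1 where Q1: "Q = lin \<gamma> * Q1" using \<gamma> by (metis dvdE poly_eq_0_iff_dvd)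
      have Q10: "Q1 \<noteq> 0" using less.prems(1) Q1 by auto
      have "degree Q = Suc (degree Q1)"
        unfolding Q1 using Q10 by (subst degree_mult_eq) simp_all
      then have lt: "degree Q1 < degree Q" by simp
      have l: "pderiv (lin \<gamma>) = 1" by (simp add: pderiv_pCons pCons_one)
      have d: "pderiv P * Q - P * pderiv Q = lin \<gamma> ^ 2 * (pderiv P1 * Q1 - P1 * pderiv Q1)"
        unfolding P1 Q1 pderiv_mult l by (simp only: power2_eq_square) (simp add: algebra_simps del: mult_pCons_left mult_pCons_right)
      have "lin \<gamma> ^ 2 * ((pderiv P1 * Q1 - P1 * pderiv Q1) * B) = lin \<gamma> ^ 2 * (E * Q1 ^ 2)"
        using less.prems(2) unfolding d by (simp only: Q1 power_mult_distrib) (simp only: mult_ac)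
      then have "(pderiv P1 * Q1 - P1 * pderiv Q1) * B = E * Q1 ^ 2" by simp
      then show ?thesis using less.hyps[OF lt Q10] by blast
    next
      case P: False
      define s where "s = Polynomial.order \<gamma> Q"
      have "s \<noteq> 0" unfolding s_def using \<gamma> less.prems(1) by (simp add: order_root)
      then obtain k where k: "s = Suc k" by (cases s) auto
      obtain Q1 where Q1: "Q = lin \<gamma> ^ Suc k * Q1" "\<not> lin \<gamma> dvd Q1"
        using order_decomp[OF less.prems(1), of \<gamma>] unfolding s_def[symmetric] k by blast
      have Q1\<gamma>: "poly Q1 \<gamma> \<noteq> 0" using Q1(2) by (simp add: poly_eq_0_iff_dvd)
      define l where "l = lin \<gamma>"
      have l0: "l \<noteq> 0" "pderiv l = 1" unfolding l_def by (simp_all add: pderiv_pCons pCons_one)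
      \<comment> \<open>What remains of the numerator once \<open>l ^ k\<close> is taken out. At
        \<gamma> only the term with factor \<open>Suc k\<close> survives, so \<open>l\<close> does
        not divide \<open>H\<close>. The two factors \<open>l\<close> on the right of the equation
        for \<open>H * B\<close> must then both divide \<open>B\<close>, against its simple
        roots.\<close>
      define H where "H = l * (pderiv P * Q1 - P * pderiv Q1) - smult (of_nat (Suc k)) (P * Q1)"
      have d: "pderiv P * Q - P * pderiv Q = l ^ k * H"
        unfolding H_def Q1(1) l_def[symmetric] pderiv_mult pderiv_power_Suc l0(2)
        by (simp add: algebra_simps smult_add_left del: of_nat_Suc)
      have "l ^ k * (H * B) = l ^ k * (l * (l * (E * l ^ k * Q1 ^ 2)))"
      proof -
        have "l ^ k * (H * B) = (pderiv P * Q - P * pderiv Q) * B" unfolding d by (simp only: mult.assoc)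
        also have "\<dots> = E * Q ^ 2" by (rule less.prems(2))
        also have "\<dots> = E * (l ^ Suc k * Q1) ^ 2" by (simp only: Q1(1) l_def)
        also have "\<dots> = l ^ k * (l * (l * (E * l ^ k * Q1 ^ 2)))"
          by (simp add: power2_eq_square algebra_simps)
        finally show ?thesis .
      qed
      then have HB: "H * B = l * (l * (E * l ^ k * Q1 ^ 2))" using l0(1) by simp
      have "poly H \<gamma> \<noteq> 0"
        unfolding H_def l_def using P Q1\<gamma> by (simp del: of_nat_Suc)
      then have H: "\<not> l dvd H" unfolding l_def by (simp add: poly_eq_0_iff_dvd)
      have prime: "prime_elem l"
      proof -
        have "irreducible l" unfolding l_def by (rule irreducible_linear_field_poly) simp
        then show ?thesis by (rule field_poly_irreducible_imp_prime)
      qed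
      have "l dvd H * B" unfolding HB by simp
      then have "l dvd B" using prime H by (simp add: prime_elem_dvd_mult_iff)
      then obtain B1 where B1: "B = l * B1" by (rule dvdE)
      have "l * (H * B1) = l * (l * (E * l ^ k * Q1 ^ 2))" using HB unfolding B1 by (simp only: mult.left_commute)
      then have "H * B1 = l * (E * l ^ k * Q1 ^ 2)" using l0(1) by simp
      then have "l dvd H * B1" by simp
      then have "l dvd B1" using prime H by (simp add: prime_elem_dvd_mult_iff)
      then have "l ^ 2 dvd B" unfolding B1 power2_eq_square by (rule mult_dvd_mono[OF dvd_refl])
      then show ?thesis using B unfolding simple_roots_def l_def by blast
    qed
  qed
qed

section \<open>Splitting off the residues\<close>

lemma log_deriv_prod:
  fixes D :: "'b::field \<Rightarrow> 'b"
  assumes "ring_deriv D" "finite A" "\<And>a. a \<in> A \<Longrightarrow> f a \<noteq> 0"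
  shows "D (prod f A) / prod f A = (\<Sum>a\<in>A. D (f a) / f a)"
  using assms(2,3)
proof (induction A)
  case empty
  then show ?case by (simp add: ring_deriv.one[OF assms(1)])
next
  case (insert a A)
  have nz: "f a \<noteq> 0" "prod f A \<noteq> 0" using insert by auto
  have "D (f a * prod f A) / (f a * prod f A) = D (f a) / f a + D (prod f A) / prod f A"
    unfolding ring_deriv.mult[OF assms(1)] using nz by (simp add: add_divide_distrib)
  then show ?case using insert by simp
qed

lemma degree_diff_less_nonzero:
  fixes p q :: "'b::ab_group_add poly"
  assumes "p = 0 \<or> degree p < n" "q = 0 \<or> degree q < n" "p - q \<noteq> 0"
  shows "degree (p - q) < n"
proof (cases "p = 0 \<or> q = 0")
  case False
  then show ?thesis using assms(1,2) by (intro degree_diff_less) simp_all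
qed (use assms in auto)

text \<open>The exterior derivative of \<open>c \<cdot> dy/y\<close> is \<open>dc \<and> dy/y\<close>.\<close>
lemma log_term_curl:
  fixes c y :: "'a::field_char_0 alg_fun"
  assumes "y \<noteq> 0"
  shows "pd_ac i (c * (pd_ac j y / y)) - pd_ac j (c * (pd_ac i y / y))
    = pd_ac i c * (pd_ac j y / y) - pd_ac j c * (pd_ac i y / y)"
proof -
  have "pd_ac i (pd_ac j y / y) = pd_ac j (pd_ac i y / y)"
    unfolding derivation_divide[OF ring_deriv_pd_ac assms] pd_ac_commute[of i j y] by (simp only: mult.commute)
  then show ?thesis unfolding ring_deriv.mult[OF ring_deriv_pd_ac] by simp
qed

lemma is_subfield_UNIV: "is_subfield UNIV"
  by (simp add: is_subfield_def)

text \<open>This field takes the place of the algebraic closure of F = \<open>rat_funs n\<close>: it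
  contains everything algebraic over F, and the variable of index \<open>n\<close> is transcendental
  over it.\<close>

definition constants_above :: "nat \<Rightarrow> 'a::field_char_0 alg_fun set" where
  "constants_above n = (\<Inter>j\<in>{n..}. kernel (pd_ac j))"

lemma constants_above_iff: "u \<in> constants_above n \<longleftrightarrow> (\<forall>j\<ge>n. pd_ac j u = 0)"
  by (auto simp: constants_above_def kernel_def)

lemma is_subfield_constants_above: "is_subfield (constants_above n)"
  unfolding constants_above_def
  by (rule is_subfield_Inter) (auto intro: is_subfield_kernel ring_deriv_pd_ac)

lemma to_ac_in_constants_above: "f \<in> rat_funs n \<Longrightarrow> to_ac f \<in> constants_above n"
  by (simp add: constants_above_iff pd_ac_to_ac pd_rat_funs_0)

lemma algebraic_in_constants_above:
  assumes "algebraic_over (to_ac ` rat_funs n) u"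
  shows "u \<in> constants_above n"
  unfolding constants_above_iff
proof (intro allI impI)
  fix j assume j: "n \<le> j"
  show "pd_ac j u = 0"
  proof (rule algebraic_imp_deriv_0[OF ring_deriv_pd_ac _ _ assms])
    show "is_subfield (to_ac ` rat_funs n)" by (rule is_subfield_image[OF is_subfield_rat_funs]) simp_all
    show "pd_ac j s = 0" if "s \<in> to_ac ` rat_funs n" for s
      using that j by (auto simp: pd_ac_to_ac pd_rat_funs_0)
  qed
qed

text \<open>Partial derivatives commute, so each of them preserves the common kernel of the
  others.\<close>

lemma pd_ac_in_constants_above: "u \<in> constants_above n \<Longrightarrow> pd_ac i u \<in> constants_above n"
  by (simp add: constants_above_iff pd_ac_commute[of _ i] ring_deriv.zero[OF ring_deriv_pd_ac])

lemma adjoin_subfield: "is_subfield (adjoin F c)"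
  unfolding adjoin_def hull_def by (rule is_subfield_Inter) auto

lemma adjoin_superset: "insert c (to_ac ` F) \<subseteq> adjoin F c"
  unfolding adjoin_def by (rule hull_subset)

lemma adjoin_subset_kfracs: "c \<in> constants \<Longrightarrow> adjoin F c \<subseteq> kfracs"
  unfolding adjoin_def
  by (rule hull_minimal) (auto simp: constants_in_kfracs to_ac_in_kfracs is_subfield_kfracs)

section \<open>The logarithmic part of one proper fraction over F\<close>

locale rt_setup =
  fixes n :: nat and A B :: "'a::field_char_0 rat_fun poly"
  assumes A: "A \<in> polys_over (rat_funs n)" and B: "B \<in> polys_over (rat_funs n)" "B \<noteq> 0"
    and deg: "A = 0 \<or> degree A < degree B"
    and sqf: "squarefree_in (polys_over (rat_funs n)) B"
begin

abbreviation x :: "'a alg_fun" where "x \<equiv> to_ac (x_var n)"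
text \<open>The prime marks the image over the closure; derivatives are always written with
  \<open>pderiv\<close>.\<close>

abbreviation A' :: "'a alg_fun poly" where "A' \<equiv> map_poly to_ac A"
abbreviation B' :: "'a alg_fun poly" where "B' \<equiv> map_poly to_ac B"

sublocale F: subfield_char_0 "rat_funs n :: 'a rat_fun set"
  by unfold_locales (rule is_subfield_rat_funs)

sublocale E: rational_extension "constants_above n :: 'a alg_fun set" "pd_ac n" x UNIV
  by unfold_locales
    (simp_all add: is_subfield_constants_above is_subfield_UNIV constants_above_iff pd_ac_to_ac pd_x_var
      ring_deriv.add[OF ring_deriv_pd_ac] ring_deriv.mult[OF ring_deriv_pd_ac])

lemma map_poly_in: "P \<in> polys_over (rat_funs n) \<Longrightarrow> map_poly to_ac P \<in> polys_over (constants_above n)"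
  by (simp add: polys_over_def coeff_map_poly to_ac_in_constants_above)

text \<open>A double root would be a common root of \<open>B'\<close> and \<open>pderiv B'\<close>,
  against the Bezout identity carried over from F.\<close>

lemma simple: "simple_roots B'"
  unfolding simple_roots_def
proof (intro conjI allI)
  show "B' \<noteq> 0" by (simp only: map_poly_to_ac_eq_0_iff B(2) not_False_eq_True)
  fix \<beta>
  obtain s t where st: "s * B + t * pderiv B = 1"
    using F.squarefree_bezout_pderiv[OF B sqf] by blast
  have st': "map_poly to_ac s * B' + map_poly to_ac t * pderiv B' = 1"
    using arg_cong[OF st, of "map_poly to_ac"]
    by (simp only: map_poly_to_ac_add map_poly_to_ac_mult map_poly_to_ac_pderiv map_poly_to_ac_1)
  show "\<not> lin \<beta> ^ 2 dvd B'"
  proof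
    assume "lin \<beta> ^ 2 dvd B'"
    then obtain R where R: "B' = lin \<beta> ^ 2 * R" by (rule dvdE)
    have 1: "poly B' \<beta> = 0" unfolding R by simp
    have "pderiv (l ^ 2 * R) = l * (l * pderiv R + (R + R))" if "pderiv l = 1" for l :: "'a alg_fun poly"
      unfolding power2_eq_square pderiv_mult that by (simp add: algebra_simps)
    then have "pderiv B' = lin \<beta> * (lin \<beta> * pderiv R + (R + R))"
      unfolding R by (simp add: pderiv_pCons pCons_one)
    then have 2: "poly (pderiv B') \<beta> = 0" by simp
    have "poly 1 \<beta> = (0 :: 'a alg_fun)" unfolding st'[symmetric] by (simp add: 1 2)
    then show False by simp
  qed
qed

sublocale P: simple_poles B' by standard (rule simple)

lemma root_in: "\<beta> \<in> roots B' \<Longrightarrow> \<beta> \<in> constants_above n"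
proof (rule algebraic_in_constants_above)
  assume "\<beta> \<in> roots B'"
  moreover have "B' \<in> polys_over (to_ac ` rat_funs n)" using B(1) by (simp add: polys_over_def coeff_map_poly)
  ultimately show "algebraic_over (to_ac ` rat_funs n) \<beta>"
    using P.B0 unfolding algebraic_over_def roots_def by blast
qed

abbreviation res :: "'a alg_fun \<Rightarrow> 'a alg_fun" where "res \<equiv> residue_at A' B'"

lemma res_in: "\<beta> \<in> roots B' \<Longrightarrow> res \<beta> \<in> constants_above n"
  unfolding residue_at_def
  by (intro E.divide E.poly_in map_poly_in A B root_in E.polys_pderiv)

lemma x_minus_root: "\<beta> \<in> roots B' \<Longrightarrow> x - \<beta> \<noteq> 0"
proof
  assume "\<beta> \<in> roots B'" "x - \<beta> = 0"
  then have "pd_ac n x = 0" using root_in[of \<beta>] by (simp add: constants_above_iff)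
  then show False by (simp add: E.D_x)
qed

lemma eval_B': "poly B' x \<noteq> 0"
  using E.eval_eq_0[OF map_poly_in[OF B(1)]] P.B0 by blast

lemma rt_gcd_nonzero: "rt_gcd A B c \<noteq> 0"
  unfolding rt_gcd_def using P.B0 by simp

lemma lead_coeff_rt_gcd: "lead_coeff (rt_gcd A B c) = 1"
proof -
  have "unit_factor (rt_gcd A B c) = 1"
    unfolding rt_gcd_def by (subst unit_factor_gcd) (use P.B0 in simp)
  then show ?thesis by (simp add: unit_factor_poly_def unit_factor_field_def flip: pCons_one)
qed

text \<open>At a root \<beta> of \<open>B'\<close> the derivative is nonzero, so
  \<open>A' - smult c (pderiv B')\<close> vanishes there exactly if \<open>c\<close> is the residue
  at \<beta>.\<close>

lemma roots_rt_gcd: "roots (rt_gcd A B c) = {\<beta> \<in> roots B'. res \<beta> = c}"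
proof -
  have "poly (rt_gcd A B c) \<beta> = 0 \<longleftrightarrow> poly B' \<beta> = 0 \<and> res \<beta> = c" for \<beta>
  proof -
    have "poly (rt_gcd A B c) \<beta> = 0 \<longleftrightarrow> poly B' \<beta> = 0 \<and> poly (A' - smult c (pderiv B')) \<beta> = 0"
      unfolding rt_gcd_def map_poly_to_ac_pderiv poly_eq_0_iff_dvd by simp
    also have "\<dots> \<longleftrightarrow> poly B' \<beta> = 0 \<and> res \<beta> = c"
    proof (cases "poly B' \<beta> = 0")
      case True
      then have "\<beta> \<in> roots B'" by (simp add: roots_def)
      then have "poly (pderiv B') \<beta> \<noteq> 0" using P.pderiv_root P.cofac_same by simp
      then show ?thesis by (auto simp: residue_at_def field_simps)
    qed simp
    finally show ?thesis .
  qed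
  then show ?thesis unfolding roots_def by auto
qed

lemma rt_gcd_eq: "rt_gcd A B c = (\<Prod>\<beta>\<in>{\<beta> \<in> roots B'. res \<beta> = c}. lin \<beta>)"
proof -
  have "rt_gcd A B c dvd B'" unfolding rt_gcd_def by simp
  then have "simple_roots (rt_gcd A B c)" by (rule simple_roots_dvd[OF simple])
  from simple_roots_factorization(1)[OF this] show ?thesis
    unfolding lead_coeff_rt_gcd roots_rt_gcd by simp
qed

lemma degree_rt_gcd: "degree (rt_gcd A B c) \<noteq> 0 \<longleftrightarrow> c \<in> res ` roots B'"
proof -
  have "degree (rt_gcd A B c) = card {\<beta> \<in> roots B'. res \<beta> = c}"
    unfolding rt_gcd_eq by (subst degree_prod_eq_sum_degree) simp_all
  then show ?thesis using P.fin by (auto simp: card_eq_0_iff)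
qed

lemma rt_roots_eq: "rt_roots A B = res ` roots B'"
proof (cases "degree B = 0")
  \<comment> \<open>A constant \<open>B\<close> is treated apart because
    \<open>rt_resultant_eval\<close> assumes positive degree. Here \<open>A\<close> is 0, the
    resultant is 1, and there are neither roots nor residues.\<close>
  case True
  then obtain b where b: "B = [:b:]" by (rule degree_eq_zeroE)
  have b0: "b \<noteq> 0" using b B(2) by simp
  have A0: "A = 0" using deg True by simp
  have "rt_resultant A B = 1"
    unfolding rt_resultant_def A0 b using b0 by (simp add: Polynomial.map_poly_pCons pderiv_pCons)
  then have "rt_roots A B = {}" by (simp add: rt_roots_def map_poly_to_ac_1)
  moreover have "roots B' = {}" unfolding roots_def b using b0 by (simp add: Polynomial.map_poly_pCons)
  ultimately show ?thesis by simp
next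
  case False
  then have "0 < degree B" by simp
  from rt_resultant_eval[OF this deg] show ?thesis
    using degree_rt_gcd unfolding rt_roots_def rt_gcd_def map_poly_to_ac_pderiv by blast
qed

text \<open>A sum over single poles, whose derivatives are explicit. Collecting the poles with equal
  residue gives the sum over the gcds that the algorithm forms.\<close>

definition h :: "nat \<Rightarrow> 'a alg_fun" where
  "h i = (\<Sum>\<beta>\<in>roots B'. res \<beta> * (pd_ac i (x - \<beta>) / (x - \<beta>)))"

lemma eval_rt_gcd: "poly (rt_gcd A B c) x = (\<Prod>\<beta>\<in>{\<beta> \<in> roots B'. res \<beta> = c}. x - \<beta>)"
  unfolding rt_gcd_eq poly_prod by simp

lemma log_deriv_sum_eq: "log_deriv_sum n i (rt_roots A B) (rt_gcd A B) = h i"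
proof -
  have "log_deriv_sum n i (rt_roots A B) (rt_gcd A B) =
    (\<Sum>c\<in>res ` roots B'. \<Sum>\<beta>\<in>{\<beta> \<in> roots B'. res \<beta> = c}. res \<beta> * (pd_ac i (x - \<beta>) / (x - \<beta>)))"
    unfolding log_deriv_sum_def rt_roots_eq eval_rt_gcd
  proof (intro sum.cong refl)
    fix c
    have "pd_ac i (\<Prod>\<beta>\<in>{\<beta> \<in> roots B'. res \<beta> = c}. x - \<beta>) / (\<Prod>\<beta>\<in>{\<beta> \<in> roots B'. res \<beta> = c}. x - \<beta>)
      = (\<Sum>\<beta>\<in>{\<beta> \<in> roots B'. res \<beta> = c}. pd_ac i (x - \<beta>) / (x - \<beta>))"
      using P.fin x_minus_root by (intro log_deriv_prod ring_deriv_pd_ac) auto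
    then show "c * (pd_ac i (\<Prod>\<beta>\<in>{\<beta> \<in> roots B'. res \<beta> = c}. x - \<beta>) / (\<Prod>\<beta>\<in>{\<beta> \<in> roots B'. res \<beta> = c}. x - \<beta>))
      = (\<Sum>\<beta>\<in>{\<beta> \<in> roots B'. res \<beta> = c}. res \<beta> * (pd_ac i (x - \<beta>) / (x - \<beta>)))"
      by (simp add: sum_distrib_left)
  qed
  also have "\<dots> = h i" unfolding h_def by (rule sum.image_gen[OF P.fin, symmetric])
  finally show ?thesis .
qed

lemma pd_ac_x: "pd_ac i x = (if i = n then 1 else 0)"
  by (simp add: pd_ac_to_ac pd_x_var)

lemma pd_ac_x_minus: "pd_ac i (x - \<beta>) = (if i = n then 1 else 0) - pd_ac i \<beta>"
  by (simp add: ring_deriv.diff[OF ring_deriv_pd_ac] pd_ac_x)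

lemma quotient_eq: "to_ac (quotient_at n A B) = poly A' x / poly B' x"
  by (simp add: quotient_at_def poly_map_poly_to_ac)

lemma h_n: "h n = to_ac (quotient_at n A B)"
proof -
  have "A' = P.comb res"
    by (rule P.interpolation) (use deg in \<open>simp add: degree_map_poly_to_ac map_poly_to_ac_eq_0_iff\<close>)
  then have "poly A' x / poly B' x = (\<Sum>\<beta>\<in>roots B'. res \<beta> / (x - \<beta>))"
    using P.comb_eval[OF eval_B', of res] by simp
  also have "\<dots> = h n"
    unfolding h_def using root_in by (intro sum.cong refl) (simp add: pd_ac_x_minus constants_above_iff)
  finally show ?thesis by (simp add: quotient_eq)
qed

lemma h_above: "n < i \<Longrightarrow> h i = 0"
  unfolding h_def using root_in by (intro sum.neutral) (simp add: pd_ac_x_minus constants_above_iff)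

lemma pd_ac_h_above: "n < j \<Longrightarrow> pd_ac j (h i) = 0"
proof -
  assume j: "n < j"
  have "pd_ac j (res \<beta> * (pd_ac i (x - \<beta>) / (x - \<beta>))) = 0" if b: "\<beta> \<in> roots B'" for \<beta>
  proof -
    have "pd_ac j (x - \<beta>) = 0" "pd_ac j (res \<beta>) = 0"
      using root_in[OF b] res_in[OF b] j by (simp_all add: pd_ac_x_minus constants_above_iff)
    then show ?thesis
      using log_term_curl[OF x_minus_root[OF b], of j "res \<beta>" i] by (simp add: ring_deriv.zero[OF ring_deriv_pd_ac])
  qed
  then show ?thesis unfolding h_def ring_deriv.sum[OF ring_deriv_pd_ac] by (rule sum.neutral[rule_format])
qed

text \<open>The poles and their residues do not depend on the variable of index \<open>n\<close>.
  The curl is therefore again a sum of simple poles, with the derivatives of the residues as its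
  residues.\<close>

lemma h_curl:
  "pd_ac i (h n) - pd_ac n (h i) = (\<Sum>\<beta>\<in>roots B'. pd_ac i (res \<beta>) / (x - \<beta>))"
proof -
  have "pd_ac i (res \<beta> * (pd_ac n (x - \<beta>) / (x - \<beta>))) - pd_ac n (res \<beta> * (pd_ac i (x - \<beta>) / (x - \<beta>)))
      = pd_ac i (res \<beta>) / (x - \<beta>)" if b: "\<beta> \<in> roots B'" for \<beta>
  proof -
    have "pd_ac n (x - \<beta>) = 1" "pd_ac n (res \<beta>) = 0"
      using root_in[OF b] res_in[OF b] by (simp_all add: pd_ac_x_minus constants_above_iff)
    then show ?thesis using log_term_curl[OF x_minus_root[OF b], of i "res \<beta>" n] by simp
  qed
  then show ?thesis
    unfolding h_def ring_deriv.sum[OF ring_deriv_pd_ac] sum_subtractf[symmetric] by (rule sum.cong[OF refl])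
qed

lemma cofac_in: "\<beta> \<in> roots B' \<Longrightarrow> cofac B' \<beta> \<in> polys_over (constants_above n)"
  unfolding cofac_def
  by (intro E.polys_smult E.polys_prod E.polys_pCons E.polys_coeff map_poly_in B E.minus E.one E.polys_0)
    (use root_in in auto)

lemma comb_in: "(\<And>\<beta>. \<beta> \<in> roots B' \<Longrightarrow> c \<beta> \<in> constants_above n) \<Longrightarrow> P.comb c \<in> polys_over (constants_above n)"
  unfolding P.comb_def by (intro E.polys_sum E.polys_smult cofac_in)

lemma frac_diff_eq:
  fixes a b c d :: "'b::field"
  assumes "b \<noteq> 0" "d \<noteq> 0"
  shows "a / b - c / d = (a * d - c * b) / (b * d)"
  using assms by (simp add: diff_frac_eq mult.commute)

lemma split_off_residues:
  assumes i: "i < n" and u: "u \<in> rat_funs (Suc n)" "pd n u = pd i (quotient_at n A B)"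
  shows "\<forall>\<beta>\<in>roots B'. pd_ac i (res \<beta>) = 0" and "\<exists>w\<in>rat_funs n. to_ac u = h i + to_ac w"
proof -
  obtain P0 Q0 where PQ0: "P0 \<in> polys_over (rat_funs n)" "Q0 \<in> polys_over (rat_funs n)" "Q0 \<noteq> 0"
    "poly Q0 (x_var n) \<noteq> 0" "u = poly P0 (x_var n) / poly Q0 (x_var n)"
    using u(1) by (rule rat_funs_SucE)
  define P where "P = map_poly to_ac P0"
  define Q where "Q = map_poly to_ac Q0"
  have PQ: "P \<in> polys_over (constants_above n)" "Q \<in> polys_over (constants_above n)" "Q \<noteq> 0"
    unfolding P_def Q_def using PQ0(1-3) by (simp_all add: map_poly_in map_poly_to_ac_eq_0_iff)
  have Qx: "poly Q x \<noteq> 0" using E.eval_eq_0[OF PQ(2)] PQ(3) by blast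
  have ux: "to_ac u = poly P x / poly Q x" unfolding PQ0(5) P_def Q_def by (simp add: poly_map_poly_to_ac)
  \<comment> \<open>For \<open>i < n\<close> the derivative of \<open>x - \<beta>\<close> is that of
    \<open>- \<beta>\<close>, which makes \<open>h i\<close> a proper fraction over
    \<open>B'\<close> with these residues.\<close>
  define H where "H = P.comb (\<lambda>\<beta>. res \<beta> * (- pd_ac i \<beta>))"
  have HS: "H \<in> polys_over (constants_above n)"
    unfolding H_def by (intro comb_in E.mult E.minus res_in pd_ac_in_constants_above root_in)
  have hx: "h i = poly H x / poly B' x"
    unfolding H_def P.comb_eval[OF eval_B'] h_def using i
    by (intro sum.cong refl) (simp add: pd_ac_x_minus)
  define P1 where "P1 = P * B' - H * Q"
  define Q1 where "Q1 = Q * B'"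
  have B'S: "B' \<in> polys_over (constants_above n)" by (rule map_poly_in[OF B(1)])
  have PQ1: "P1 \<in> polys_over (constants_above n)" "Q1 \<in> polys_over (constants_above n)" "Q1 \<noteq> 0"
    unfolding P1_def Q1_def using PQ(3) P.B0 by (simp_all add: E.polys_diff E.polys_mult PQ HS B'S)
  define w where "w = to_ac u - h i"
  have wx: "w = poly P1 x / poly Q1 x"
    unfolding w_def ux hx P1_def Q1_def frac_diff_eq[OF Qx eval_B'] by simp
  define R where "R = P.comb (\<lambda>\<beta>. pd_ac i (res \<beta>))"
  have RS: "R \<in> polys_over (constants_above n)"
    unfolding R_def by (intro comb_in pd_ac_in_constants_above res_in)
  have Dw: "pd_ac n w = poly R x / poly B' x"
  proof -
    have "pd_ac n w = pd_ac i (h n) - pd_ac n (h i)"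
      unfolding w_def ring_deriv.diff[OF ring_deriv_pd_ac] h_n pd_ac_to_ac u(2) ..
    then show ?thesis unfolding h_curl R_def P.comb_eval[OF eval_B'] .
  qed
  have "(pderiv P1 * Q1 - P1 * pderiv Q1) * B' - R * Q1 ^ 2 = 0"
  proof (rule E.eval_eq_0)
    show "(pderiv P1 * Q1 - P1 * pderiv Q1) * B' - R * Q1 ^ 2 \<in> polys_over (constants_above n)"
      by (intro E.polys_diff E.polys_mult E.polys_pderiv E.polys_power PQ1 RS B'S)
    have Q1x: "poly Q1 x \<noteq> 0" using E.eval_eq_0[OF PQ1(2)] PQ1(3) by blast
    have "poly (pderiv P1 * Q1 - P1 * pderiv Q1) x / poly Q1 x ^ 2 = poly R x / poly B' x"
      using E.D_eval_divide[OF PQ1] Dw wx by simp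
    then have "poly (pderiv P1 * Q1 - P1 * pderiv Q1) x * poly B' x = poly R x * poly Q1 x ^ 2"
      using Q1x eval_B' by (simp only: frac_eq_eq power_not_zero not_False_eq_True)
    then show "poly ((pderiv P1 * Q1 - P1 * pderiv Q1) * B' - R * Q1 ^ 2) x = 0" by simp
  qed
  then have eqR: "(pderiv P1 * Q1 - P1 * pderiv Q1) * B' = R * Q1 ^ 2" by simp
  have R0: "R = 0"
    by (rule derivative_no_simple_poles[OF PQ1(3) simple _ eqR]) (simp only: R_def, rule P.degree_comb)
  then show "\<forall>\<beta>\<in>roots B'. pd_ac i (res \<beta>) = 0" unfolding R_def using P.comb_eq_0 by blast
  have wS: "w \<in> constants_above n"
    unfolding constants_above_iff
  proof (intro allI impI)
    fix j assume "n \<le> j"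
    then consider "j = n" | "n < j" by linarith
    then show "pd_ac j w = 0"
    proof cases
      case 1
      then show ?thesis using Dw R0 by simp
    next
      case 2
      then show ?thesis
        unfolding w_def ring_deriv.diff[OF ring_deriv_pd_ac] pd_ac_h_above[OF 2] pd_ac_to_ac
        using pd_rat_funs_0[OF u(1), of j] by simp
    qed
  qed
  \<comment> \<open>The division is carried out over F itself, where \<open>P0\<close> and
    \<open>Q0\<close> have their coefficients. The coefficients of the quotient \<open>T\<close> lie
    in F, and \<open>w\<close> will turn out to be its constant coefficient.\<close>
  obtain T R1 where TR: "T \<in> polys_over (rat_funs n)" "R1 \<in> polys_over (rat_funs n)" "P0 = Q0 * T + R1"
    "R1 = 0 \<or> degree R1 < degree Q0"
    using F.polys_division[OF PQ0(1-3)] by blast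
  define T' where "T' = map_poly to_ac T"
  define R' where "R' = map_poly to_ac R1"
  have P_eq: "P = Q * T' + R'" unfolding P_def Q_def T'_def R'_def TR(3)
    by (simp only: map_poly_to_ac_add map_poly_to_ac_mult)
  have R'deg: "R' = 0 \<or> degree R' < degree Q"
    using TR(4) unfolding R'_def Q_def by (simp add: degree_map_poly_to_ac map_poly_to_ac_eq_0_iff)
  have T'S: "T' \<in> polys_over (constants_above n)" "R' \<in> polys_over (constants_above n)"
    unfolding T'_def R'_def by (simp_all add: map_poly_in TR)
  \<comment> \<open>Since \<open>w\<close> is now known to be in \<open>constants_above n\<close>,
    it may serve as a coefficient, and the identity of values at \<open>x\<close> lifts to
    polynomials, where degrees can be compared.\<close>
  have "(T' - [:w:]) * (Q * B') - (H * Q - R' * B') = 0"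
  proof (rule E.eval_eq_0)
    show "(T' - [:w:]) * (Q * B') - (H * Q - R' * B') \<in> polys_over (constants_above n)"
      by (intro E.polys_diff E.polys_mult E.polys_pCons E.polys_0 wS T'S PQ HS B'S)
    have "poly P1 x = w * poly Q1 x"
      using wx E.eval_eq_0[OF PQ1(2)] PQ1(3) by auto
    then have "poly P x * poly B' x - poly H x * poly Q x = w * (poly Q x * poly B' x)"
      unfolding P1_def Q1_def by simp
    then show "poly ((T' - [:w:]) * (Q * B') - (H * Q - R' * B')) x = 0"
      unfolding P_eq by (simp add: algebra_simps)
  qed
  then have key: "(T' - [:w:]) * (Q * B') = H * Q - R' * B'" by simp
  have "T' = [:w:]"
  proof (rule ccontr)
    assume "T' \<noteq> [:w:]"
    then have nz: "T' - [:w:] \<noteq> 0" by simp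
    have QB: "Q * B' \<noteq> 0" "degree (Q * B') = degree Q + degree B'"
      using PQ(3) P.B0 by (simp_all add: degree_mult_eq)
    have ge: "degree Q + degree B' \<le> degree (H * Q - R' * B')"
      unfolding key[symmetric] degree_mult_eq[OF nz QB(1)] QB(2) by simp
    have Hdeg: "H = 0 \<or> degree H < degree B'"
      unfolding H_def by (rule P.degree_comb)
    have 1: "H * Q = 0 \<or> degree (H * Q) < degree Q + degree B'"
      using Hdeg PQ(3) by (cases "H = 0") (simp_all add: degree_mult_eq)
    have 2: "R' * B' = 0 \<or> degree (R' * B') < degree Q + degree B'"
      using R'deg P.B0 by (cases "R' = 0") (simp_all add: degree_mult_eq)
    have "H * Q - R' * B' \<noteq> 0" unfolding key[symmetric] using nz QB(1) by simp
    then have "degree (H * Q - R' * B') < degree Q + degree B'"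
      by (rule degree_diff_less_nonzero[OF 1 2])
    then show False using ge by simp
  qed
  then have "w = coeff T' 0" by simp
  also have "\<dots> = to_ac (coeff T 0)" unfolding T'_def by (simp add: coeff_map_poly)
  finally have "to_ac u = h i + to_ac (coeff T 0)" unfolding w_def by (simp add: algebra_simps)
  then show "\<exists>w\<in>rat_funs n. to_ac u = h i + to_ac w" using F.polys_coeff[OF TR(1)] by blast
qed

text \<open>A gcd found over F(c) by Bezout divides the gcd over the closure and is divided by it,
  so the two differ by the leading coefficient, which lies in F(c).\<close>

lemma rt_gcd_in_adjoin: "rt_gcd A B c \<in> polys_over (adjoin (rat_funs n) c)"
proof -
  interpret adj: subfield_set "adjoin (rat_funs n) c" by standard (rule adjoin_subfield)
  have sub: "map_poly to_ac P \<in> polys_over (adjoin (rat_funs n) c)" if "P \<in> polys_over (rat_funs n)" for P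
    using that adjoin_superset[of c "rat_funs n"] by (auto simp: polys_over_def coeff_map_poly)
  have c: "c \<in> adjoin (rat_funs n) c" using adjoin_superset[of c "rat_funs n"] by auto
  let ?A = "A' - smult c (map_poly to_ac (pderiv B))"
  have A1: "?A \<in> polys_over (adjoin (rat_funs n) c)"
    by (intro adj.polys_diff adj.polys_smult c sub A F.polys_pderiv B)
  obtain G s t where G: "G \<in> polys_over (adjoin (rat_funs n) c)" "G \<noteq> 0" "G = s * B' + t * ?A" "G dvd B'" "G dvd ?A"
    using adj.polys_bezout[OF sub[OF B(1)] A1] P.B0 by metis
  have "rt_gcd A B c dvd s * B' + t * ?A" unfolding rt_gcd_def by (intro dvd_add dvd_mult) simp_all
  then have 1: "rt_gcd A B c dvd G" using G(3) by simp
  have "G dvd rt_gcd A B c" unfolding rt_gcd_def using G(4,5) by simp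
  then obtain r where r: "rt_gcd A B c = G * r" by (rule dvdE)
  have r0: "r \<noteq> 0" using r rt_gcd_nonzero by auto
  have "degree (rt_gcd A B c) \<le> degree G" using 1 G(2) by (rule dvd_imp_degree_le)
  then have "degree r = 0" unfolding r degree_mult_eq[OF G(2) r0] by simp
  then obtain k where k: "r = [:k:]" by (rule degree_eq_zeroE)
  have "lead_coeff G * k = 1" using lead_coeff_rt_gcd[of c] unfolding r lead_coeff_mult by (simp add: k)
  then have "k = inverse (lead_coeff G)" by (metis inverse_unique)
  then have "rt_gcd A B c = smult (inverse (lead_coeff G)) G" unfolding r k by simp
  then show ?thesis using adj.polys_smult[OF adj.inverse[OF adj.polys_coeff[OF G(1)]] G(1)] by metis
qed

text \<open>The entries are the gcds rather than the linear factors \<open>x - \<beta>\<close>: a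
  root \<beta> is merely algebraic over F, whereas for constant c the gcd has its coefficients in
  F(c), which is contained in \<open>kfracs\<close>.\<close>

lemma log_data_exists:
  assumes c: "\<And>\<beta>. \<beta> \<in> roots B' \<Longrightarrow> res \<beta> \<in> constants"
  shows "\<exists>us. log_data us \<and> (\<forall>i. log_form us i = h i)"
proof -
  let ?C = "rt_roots A B"
  have fin: "finite ?C" unfolding rt_roots_eq using P.fin by simp
  then obtain cs where cs: "set cs = ?C" "distinct cs" using finite_distinct_list by blast
  define us where "us = map (\<lambda>c. (c, poly (rt_gcd A B c) x)) cs"
  interpret K: subfield_set "kfracs :: 'a alg_fun set" by standard (rule is_subfield_kfracs)
  have "c \<in> constants \<and> poly (rt_gcd A B c) x \<in> kfracs \<and> poly (rt_gcd A B c) x \<noteq> 0" if "c \<in> ?C" for c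
  proof (intro conjI)
    show cc: "c \<in> constants" using that c unfolding rt_roots_eq by blast
    have "rt_gcd A B c \<in> polys_over kfracs"
      using rt_gcd_in_adjoin[of c] adjoin_subset_kfracs[OF cc, of "rat_funs n"] by (auto simp: polys_over_def)
    then show "poly (rt_gcd A B c) x \<in> kfracs" by (rule K.poly_in) (rule to_ac_in_kfracs)
    show "poly (rt_gcd A B c) x \<noteq> 0" unfolding eval_rt_gcd using P.fin x_minus_root by auto
  qed
  then have "log_data us" unfolding log_data_def us_def using cs(1) by auto
  moreover have "log_form us i = h i" for i
    unfolding log_deriv_sum_eq[symmetric] log_deriv_sum_def log_form_def us_def
    by (simp add: o_def sum_list_distinct_conv_sum_set[OF cs(2)] cs(1))
  ultimately show ?thesis by blast
qed

end

section \<open>Correctness of the algorithm\<close>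

lemma hermite_reduction_exists:
  assumes "f \<in> rat_funs (Suc n)"
  shows "\<exists>r. hermite_reduction n f r"
proof -
  have sub: "rat_funs n \<subseteq> (rat_funs (Suc n) :: 'a rat_fun set)"
    using rat_funs_mono[of n "Suc n"] by (intro subsetI) simp
  interpret R: rational_extension "rat_funs n :: 'a rat_fun set" "pd n" "x_var n" "rat_funs (Suc n)"
    by unfold_locales
      (simp_all add: is_subfield_rat_funs pd_rat_funs_0 pd_x_var x_var_in_rat_funs sub
        ring_deriv.add[OF ring_deriv_pd] ring_deriv.mult[OF ring_deriv_pd])
  obtain P Q where PQ: "P \<in> polys_over (rat_funs n)" "Q \<in> polys_over (rat_funs n)" "Q \<noteq> 0"
    "f = poly P (x_var n) / poly Q (x_var n)"
    using assms by (rule rat_funs_SucE)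
  obtain g A B where "g \<in> rat_funs (Suc n)" "A \<in> polys_over (rat_funs n)" "B \<in> polys_over (rat_funs n)"
    "B \<noteq> 0" "coprime_in (polys_over (rat_funs n)) A B" "A = 0 \<or> degree A < degree B"
    "squarefree_in (polys_over (rat_funs n)) B" "f = pd n g + poly A (x_var n) / poly B (x_var n)"
    using R.hermite_exists[OF PQ(1-3)] unfolding PQ(4)[symmetric] by blast
  then have "hermite_reduction n f (g, A, B)"
    unfolding hermite_reduction_def quotient_at_def Let_def by simp
  then show ?thesis ..
qed

text \<open>\<open>rt_remainder\<close>, \<open>rt_pick\<close> and \<open>rt_valid\<close> name
  pieces of the recursive case of \<open>hermite_one_form\<close>, so that each of its steps can be
  discussed by itself.\<close>

definition rt_remainder :: "nat \<Rightarrow> 'a::field_char_0 rat_fun poly \<Rightarrow> 'a rat_fun poly \<Rightarrow> 'a one_form \<Rightarrow> 'a one_form" where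
  "rt_remainder n A B f = (\<lambda>i. if i < n then f i else if i = n then quotient_at n A B else 0)"

definition rt_pick :: "nat \<Rightarrow> 'a::field_char_0 rat_fun poly \<Rightarrow> 'a rat_fun poly \<Rightarrow> 'a one_form \<Rightarrow> bool" where
  "rt_pick n A B f \<longleftrightarrow> (\<forall>i<n. f i \<in> rat_funs (Suc n) \<and>
     to_ac (f i) = log_deriv_sum n i (rt_roots A B) (rt_gcd A B))"

definition rt_valid :: "nat \<Rightarrow> 'a::field_char_0 rat_fun poly \<Rightarrow> 'a rat_fun poly \<Rightarrow> bool" where
  "rt_valid n A B \<longleftrightarrow> finite (rt_roots A B) \<and>
     (\<forall>c\<in>rt_roots A B. c \<in> k_bar \<and> rt_gcd A B c \<in> polys_over (adjoin (rat_funs n) c) \<and>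
        lead_coeff (rt_gcd A B c) = 1 \<and> 0 < degree (rt_gcd A B c)) \<and>
     to_ac (quotient_at n A B) = log_deriv_sum n n (rt_roots A B) (rt_gcd A B)"

text \<open>The list \<open>us\<close> in the third claim is chosen before \<open>f\<close>: the
  logarithmic form depends on \<open>A\<close> and \<open>B\<close> alone, and
  \<open>rt_pick\<close> determines \<open>f\<close> below \<open>n\<close> because
  \<open>to_ac\<close> is injective.\<close>

lemma closed_form_step:
  assumes closed: "closed_form (Suc n) \<omega>" and hr: "hermite_reduction n (\<omega> n) (a, A, B)"
  shows "rt_valid n A B" and "\<exists>f. rt_pick n A B f"
    and "\<exists>us. log_data us \<and> (\<forall>f. rt_pick n A B f \<longrightarrow> (\<forall>i. to_ac (rt_remainder n A B f i) = log_form us i))"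
    and "\<And>f. rt_pick n A B f \<Longrightarrow>
      closed_form n (\<lambda>i. \<omega> i - pd i a - rt_remainder n A B f i) \<and> \<omega> n - pd n a - rt_remainder n A B f n = 0"
proof -
  have H: "a \<in> rat_funs (Suc n)" "A \<in> polys_over (rat_funs n)" "B \<in> polys_over (rat_funs n)" "B \<noteq> 0"
    "A = 0 \<or> degree A < degree B" "squarefree_in (polys_over (rat_funs n)) B"
    "\<omega> n = pd n a + quotient_at n A B"
    using hr unfolding hermite_reduction_def Let_def by simp_all
  interpret rt_setup n A B by standard (rule H)+
  interpret K: subfield_set "rat_funs (Suc n) :: 'a rat_fun set" by standard (rule is_subfield_rat_funs)
  \<comment> \<open>The form without the exact Hermite part. It is still closed, and its last
    coefficient is the proper fraction \<open>quotient_at n A B\<close>.\<close>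
  define u where "u i = \<omega> i - pd i a" for i
  have \<omega>_in: "\<omega> i \<in> rat_funs (Suc n)" if "i < n" for i using closed that by (simp add: closed_form_def)
  have u_in: "u i \<in> rat_funs (Suc n)" if "i < n" for i
    unfolding u_def by (intro K.diff \<omega>_in that pd_in_rat_funs H(1))
  have u_curl: "pd j (u i) = pd i (u j)" if "i \<le> n" "j \<le> n" for i j
  proof -
    have "pd j (\<omega> i) = pd i (\<omega> j)" using closed that by (simp add: closed_form_def)
    then show ?thesis unfolding u_def ring_deriv.diff[OF ring_deriv_pd] pd_commute[of i j a] by simp
  qed
  have un: "u n = quotient_at n A B" unfolding u_def H(7) by simp
  have u_n: "pd n (u i) = pd i (quotient_at n A B)" if "i < n" for i using u_curl[of i n] that un by simp
  \<comment> \<open>Closedness is used for the variables below \<open>n\<close>; the residues are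
    free of the others because they are algebraic over F.\<close>
  have const: "res \<beta> \<in> constants" if b: "\<beta> \<in> roots B'" for \<beta>
    unfolding constants_iff
  proof
    fix i
    show "pd_ac i (res \<beta>) = 0"
    proof (cases "i < n")
      case True
      then show ?thesis using split_off_residues(1)[OF True u_in[OF True] u_n[OF True]] b by blast
    next
      case False
      then show ?thesis using res_in[OF b] by (simp add: constants_above_iff)
    qed
  qed
  have "\<forall>i. \<exists>w. i < n \<longrightarrow> w \<in> rat_funs n \<and> to_ac (u i) = h i + to_ac w"
    using split_off_residues(2)[OF _ u_in u_n] by blast
  then obtain w where w: "\<And>i. i < n \<Longrightarrow> w i \<in> rat_funs n \<and> to_ac (u i) = h i + to_ac (w i)" by metis
  have h_eq: "h i = to_ac (u i - w i)" if "i < n" for i using w[OF that] by simp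
  show "rt_valid n A B"
    unfolding rt_valid_def
  proof (intro conjI ballI)
    show "finite (rt_roots A B)" unfolding rt_roots_eq using P.fin by simp
    show "to_ac (quotient_at n A B) = log_deriv_sum n n (rt_roots A B) (rt_gcd A B)"
      unfolding log_deriv_sum_eq h_n ..
    fix c assume c: "c \<in> rt_roots A B"
    show "c \<in> k_bar" using c const unfolding rt_roots_eq k_bar_eq by blast
    show "rt_gcd A B c \<in> polys_over (adjoin (rat_funs n) c)" by (rule rt_gcd_in_adjoin)
    show "lead_coeff (rt_gcd A B c) = 1" by (rule lead_coeff_rt_gcd)
    show "0 < degree (rt_gcd A B c)" using c degree_rt_gcd[of c] unfolding rt_roots_eq by simp
  qed
  have "rt_pick n A B (\<lambda>i. u i - w i)"
    unfolding rt_pick_def log_deriv_sum_eq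
  proof (intro allI impI conjI)
    fix i assume i: "i < n"
    show "u i - w i \<in> rat_funs (Suc n)"
      by (intro K.diff u_in i rat_funs_mono[of n "Suc n" "w i"]) (simp_all add: w i)
    show "to_ac (u i - w i) = h i" by (rule h_eq[OF i, symmetric])
  qed
  then show "\<exists>f. rt_pick n A B f" by (rule exI[of _ "\<lambda>i. u i - w i"])
  have rem: "to_ac (rt_remainder n A B f i) = h i" if f: "rt_pick n A B f" for f i
  proof -
    consider "i < n" | "i = n" | "n < i" by linarith
    then show ?thesis
    proof cases
      case 1
      then show ?thesis using f by (simp add: rt_pick_def log_deriv_sum_eq rt_remainder_def)
    next
      case 2
      then show ?thesis by (simp add: rt_remainder_def h_n)
    next
      case 3
      then show ?thesis by (simp add: rt_remainder_def h_above)
    qed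
  qed
  obtain us where us: "log_data us" "\<And>i. log_form us i = h i" using log_data_exists const by metis
  show "\<exists>us. log_data us \<and> (\<forall>f. rt_pick n A B f \<longrightarrow> (\<forall>i. to_ac (rt_remainder n A B f i) = log_form us i))"
    using us rem by metis
  fix f assume f: "rt_pick n A B f"
  let ?\<omega> = "\<lambda>i. \<omega> i - pd i a - rt_remainder n A B f i"
  have \<omega>': "?\<omega> i = w i" if "i < n" for i
  proof -
    have "to_ac (rt_remainder n A B f i) = to_ac (u i - w i)" unfolding rem[OF f] h_eq[OF that] ..
    then have "rt_remainder n A B f i = u i - w i" by (simp only: to_ac_eq_iff)
    then show ?thesis by (simp add: u_def)
  qed
  have h_sym: "pd_ac j (h i) = pd_ac i (h j)" for i j
  proof -
    have "pd_ac j (res \<beta> * (pd_ac i (x - \<beta>) / (x - \<beta>))) = pd_ac i (res \<beta> * (pd_ac j (x - \<beta>) / (x - \<beta>)))"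
      if b: "\<beta> \<in> roots B'" for \<beta>
      using log_term_curl[OF x_minus_root[OF b], of j "res \<beta>" i] const[OF b] by (simp add: constants_iff)
    then show ?thesis unfolding h_def ring_deriv.sum[OF ring_deriv_pd_ac] by (rule sum.cong[OF refl])
  qed
  \<comment> \<open>Below \<open>n\<close> the form \<open>w\<close> is the difference of
    \<open>u\<close>, closed by assumption, and \<open>h\<close>, closed because its residues are
    constants.\<close>
  have w_sym: "pd i (w j) = pd j (w i)" if "i < n" "j < n" for i j
  proof -
    have "to_ac (pd i (u j) - pd i (w j)) = to_ac (pd j (u i) - pd j (w i))"
      using h_sym[of i j] unfolding h_eq[OF that(1)] h_eq[OF that(2)] pd_ac_to_ac
        ring_deriv.diff[OF ring_deriv_pd] by simp
    then have "pd i (u j) - pd i (w j) = pd j (u i) - pd j (w i)" by (simp only: to_ac_eq_iff)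
    then show ?thesis using u_curl[of i j] that by simp
  qed
  have "closed_form n ?\<omega>"
    unfolding closed_form_def
  proof (intro conjI allI impI)
    fix i assume i: "i < n"
    show "?\<omega> i \<in> rat_funs n" unfolding \<omega>'[OF i] using w[OF i] by (rule conjunct1)
    fix j assume j: "j < n"
    show "pd i (?\<omega> j) = pd j (?\<omega> i)" unfolding \<omega>'[OF i] \<omega>'[OF j] by (rule w_sym[OF i j])
  qed
  moreover have "?\<omega> n = 0" unfolding H(7) rt_remainder_def by simp
  ultimately show "closed_form n ?\<omega> \<and> ?\<omega> n = 0" ..
qed

lemma log_form_simple:
  assumes "closed_form m r" "log_data us" "\<And>i. to_ac (r i) = log_form us i"
  shows "simple_form m r"
  unfolding simple_form_def
proof (intro conjI allI impI assms(1))
  fix i assume "i < m"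
  then have "r i \<in> rat_funs m" using assms(1) by (simp add: closed_form_def)
  then obtain a b where ab: "reduced_fraction m (r i) a b" by (rule reduced_fraction_exists)
  note * = log_form_reduced_fraction[OF assms(2,3) ab]
  show "proper_in m i (r i)" unfolding proper_in_def using ab *(1) by blast
  show "\<exists>a b. reduced_fraction m (r i) a b \<and> squarefree_in (mpols m) b" using ab *(2) by blast
qed

lemma closed_form_remainder:
  assumes "closed_form m \<omega>" "g \<in> rat_funs m" "decomposes m \<omega> g r"
  shows "closed_form m r"
proof -
  interpret subfield_set "rat_funs m :: 'a rat_fun set" by standard (rule is_subfield_rat_funs)
  have r: "r i = \<omega> i - pd i g" if "i < m" for i using assms(3) that by (simp add: decomposes_def)
  have "r i \<in> rat_funs m" if "i < m" for i
    unfolding r[OF that] using assms(1,2) that by (intro diff pd_in_rat_funs) (simp_all add: closed_form_def)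
  moreover have "pd i (r j) = pd j (r i)" if "i < m" "j < m" for i j
    unfolding r[OF that(1)] r[OF that(2)] ring_deriv.diff[OF ring_deriv_pd] pd_commute[of i j g]
    using assms(1) that by (simp add: closed_form_def)
  ultimately show ?thesis unfolding closed_form_def by blast
qed

text \<open>Being a logarithmic form is what makes the result of the recursion simple: unlike simplicity
  itself, it is visibly preserved when the two remainders are added.\<close>
definition correct_outcome :: "nat \<Rightarrow> 'a::field_char_0 one_form \<Rightarrow> ('a rat_fun \<times> 'a one_form) option \<Rightarrow> bool" where
  "correct_outcome m \<omega> out \<longleftrightarrow> (\<exists>g r. out = Some (g, r) \<and> g \<in> rat_funs m \<and> simple_form m r \<and>
     decomposes m \<omega> g r \<and> (\<forall>i\<ge>m. r i = 0) \<and>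
     (\<exists>us. log_data us \<and> (\<forall>i. to_ac (r i) = log_form us i)))"

lemma correct_outcomeI:
  assumes "closed_form m \<omega>" "g \<in> rat_funs m" "decomposes m \<omega> g r" "\<And>i. m \<le> i \<Longrightarrow> r i = 0"
    "log_data us" "\<And>i. to_ac (r i) = log_form us i"
  shows "correct_outcome m \<omega> (Some (g, r))"
  unfolding correct_outcome_def
  using assms log_form_simple[OF closed_form_remainder[OF assms(1-3)] assms(5,6)] by blast

text \<open>Nonemptiness is carried along with the property of outcomes, as the latter would hold
  vacuously for a program without outcomes. \<open>None\<close> is excluded through the choice of
  \<open>Q\<close>.\<close>

lemma pick_correct:
  assumes "\<exists>x. P x" "\<And>x. P x \<Longrightarrow> k x \<noteq> {} \<and> (\<forall>out\<in>k x. Q out)"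
  shows "pick P k \<noteq> {} \<and> (\<forall>out\<in>pick P k. Q out)"
proof -
  have eq: "pick P k = (\<Union>x\<in>{x. P x}. k x)" using assms(1) by (simp only: pick_def if_True)
  obtain x where x: "P x" using assms(1) by blast
  then have "k x \<subseteq> pick P k" unfolding eq by blast
  moreover have "k x \<noteq> {}" using assms(2)[OF x] by (rule conjunct1)
  ultimately have "pick P k \<noteq> {}" by blast
  moreover have "Q out" if out: "out \<in> pick P k" for out
  proof -
    obtain y where y: "P y" "out \<in> k y" using out unfolding eq by blast
    then show ?thesis using assms(2)[OF y(1)] by simp
  qed
  ultimately show ?thesis by simp
qed

lemma call_correct:
  assumes "p \<noteq> {}" "\<And>out. out \<in> p \<Longrightarrow> \<exists>y. out = Some y \<and> k y \<noteq> {} \<and> (\<forall>o'\<in>k y. Q o')"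
  shows "call p k \<noteq> {} \<and> (\<forall>out\<in>call p k. Q out)"
proof -
  obtain out where out: "out \<in> p" using assms(1) by blast
  obtain y where y: "out = Some y" "k y \<noteq> {}" using assms(2)[OF out] by auto
  have "k y \<subseteq> call p k" unfolding call_def using out y(1) by force
  then have "call p k \<noteq> {}" using y(2) by auto
  moreover have "Q o'" if o': "o' \<in> call p k" for o'
  proof -
    obtain out where out: "out \<in> p" "o' \<in> (case out of None \<Rightarrow> {None} | Some y \<Rightarrow> k y)"
      using o' unfolding call_def by (rule UN_E)
    obtain y where y: "out = Some y" "\<forall>o'\<in>k y. Q o'" using assms(2)[OF out(1)] by auto
    then show ?thesis using out(2) by simp
  qed
  ultimately show ?thesis by simp
qed

lemma ensure_True: "P \<Longrightarrow> ensure P k = k"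
  by (simp add: ensure_def)

lemma hermite_one_form_correct:
  assumes "m \<ge> 1" "closed_form m \<omega>"
  shows "hermite_one_form m \<omega> \<noteq> {} \<and> (\<forall>out\<in>hermite_one_form m \<omega>. correct_outcome m \<omega> out)"
  using assms
proof (induction m arbitrary: \<omega>)
  case (Suc n)
  note closed = Suc.prems(2)
  have \<omega>n: "\<omega> n \<in> rat_funs (Suc n)" using closed by (simp add: closed_form_def)
  have ex: "\<exists>y. hermite_reduction n (\<omega> n) y" by (rule hermite_reduction_exists[OF \<omega>n])
  show ?case
  proof (cases "n = 0")
    case True
    define k0 :: "'a rat_fun \<times> 'a rat_fun poly \<times> 'a rat_fun poly \<Rightarrow> ('a rat_fun \<times> 'a one_form) program"
      where "k0 = (\<lambda>(g, A, B). {Some (g, \<lambda>i. if i = 0 then quotient_at 0 A B else 0)})"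
    have "hermite_one_form (Suc n) \<omega> = pick (hermite_reduction 0 (\<omega> 0)) k0"
      using True unfolding k0_def by simp
    moreover have "pick (hermite_reduction 0 (\<omega> 0)) k0 \<noteq> {} \<and>
      (\<forall>out\<in>pick (hermite_reduction 0 (\<omega> 0)) k0. correct_outcome (Suc n) \<omega> out)"
    proof (rule pick_correct[where Q = "correct_outcome (Suc n) \<omega>"])
      show "\<exists>y. hermite_reduction 0 (\<omega> 0) y" using ex True by simp
      fix y assume y: "hermite_reduction 0 (\<omega> 0) y"
      obtain g A B where gAB: "y = (g, A, B)" by (cases y)
      have hr: "hermite_reduction n (\<omega> n) (g, A, B)" using y gAB True by simp
      let ?r = "\<lambda>i. if i = 0 then quotient_at 0 A B else 0"
      have r: "rt_remainder n A B f = ?r" for f using True by (simp add: rt_remainder_def)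
      \<comment> \<open>In one variable there are no lower coefficients to pick, so every
        \<open>f\<close> qualifies. The base case thus obtains its logarithmic data from the same
        lemma as the recursive case.\<close>
      have "rt_pick n A B f" for f using True by (simp add: rt_pick_def)
      then obtain us where us: "log_data us" "\<And>i. to_ac (?r i) = log_form us i"
        using closed_form_step(3)[OF closed hr] unfolding r by blast
      have g: "g \<in> rat_funs (Suc n)" "\<omega> 0 = pd 0 g + quotient_at 0 A B"
        using hr True unfolding hermite_reduction_def Let_def by simp_all
      have "correct_outcome (Suc n) \<omega> (Some (g, ?r))"
        by (rule correct_outcomeI[OF closed g(1) _ _ us]) (use g(2) True in \<open>simp_all add: decomposes_def\<close>)
      then show "k0 y \<noteq> {} \<and> (\<forall>out\<in>k0 y. correct_outcome (Suc n) \<omega> out)"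
        unfolding k0_def gAB by simp
    qed
    ultimately show ?thesis by simp
  next
    case n0: False
    \<comment> \<open>The program after the choice of \<open>f\<close>, separated so that the rules
      for \<open>pick\<close> and \<open>call\<close> can be applied in turn.\<close>
    define rest where "rest a A B f = (let r_last = rt_remainder n A B f; \<omega>' = (\<lambda>i. \<omega> i - pd i a - r_last i) in
       ensure (closed_form n \<omega>' \<and> \<omega>' n = 0) (
       call (hermite_one_form n \<omega>') (\<lambda>(g', r').
       ensure (g' \<in> rat_funs n \<and> simple_form n r' \<and> decomposes n \<omega>' g' r')
       {Some (a + g', \<lambda>i. r_last i + r' i)})))" for a A B f
    define body where "body y = (case y of (a, A, B) \<Rightarrow>
       ensure (rt_valid n A B) (pick (rt_pick n A B) (rest a A B)))" for y
    have unfold: "hermite_one_form (Suc n) \<omega> = pick (hermite_reduction n (\<omega> n)) body"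
      using n0 unfolding body_def rest_def rt_valid_def rt_pick_def rt_remainder_def
      by (simp add: Let_def)
    have rest: "rest a A B f \<noteq> {} \<and> (\<forall>out\<in>rest a A B f. correct_outcome (Suc n) \<omega> out)"
      if hr: "hermite_reduction n (\<omega> n) (a, A, B)" and f: "rt_pick n A B f" for a A B f
    proof -
      define r where "r = rt_remainder n A B f"
      define \<omega>' where "\<omega>' = (\<lambda>i. \<omega> i - pd i a - r i)"
      have closed': "closed_form n \<omega>'" and \<omega>'n: "\<omega>' n = 0"
        using closed_form_step(4)[OF closed hr f] unfolding \<omega>'_def r_def by simp_all
      have IH: "hermite_one_form n \<omega>' \<noteq> {}" "\<And>out. out \<in> hermite_one_form n \<omega>' \<Longrightarrow> correct_outcome n \<omega>' out"
        using Suc.IH[OF _ closed'] n0 by simp_all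
      have a: "a \<in> rat_funs (Suc n)" using hr unfolding hermite_reduction_def Let_def by simp
      obtain us where us: "log_data us" "\<And>i. to_ac (r i) = log_form us i"
        using closed_form_step(3)[OF closed hr] f unfolding r_def by blast
      have rest_eq: "rest a A B f = call (hermite_one_form n \<omega>') (\<lambda>(g', r').
         ensure (g' \<in> rat_funs n \<and> simple_form n r' \<and> decomposes n \<omega>' g' r')
         {Some (a + g', \<lambda>i. r i + r' i)})"
        unfolding rest_def Let_def r_def[symmetric] \<omega>'_def[symmetric]
        by (rule ensure_True[OF conjI[OF closed' \<omega>'n[unfolded \<omega>'_def]]])
      show ?thesis
        unfolding rest_eq
      proof (rule call_correct[OF IH(1)])
        fix out assume "out \<in> hermite_one_form n \<omega>'"
        then have "correct_outcome n \<omega>' out" by (rule IH(2))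
        then obtain g' r' vs where o: "out = Some (g', r')" "g' \<in> rat_funs n" "simple_form n r'"
          "decomposes n \<omega>' g' r'" "\<And>i. n \<le> i \<Longrightarrow> r' i = 0" "log_data vs" "\<And>i. to_ac (r' i) = log_form vs i"
          unfolding correct_outcome_def by blast
        interpret K: subfield_set "rat_funs (Suc n) :: 'a rat_fun set" by standard (rule is_subfield_rat_funs)
        have "correct_outcome (Suc n) \<omega> (Some (a + g', \<lambda>i. r i + r' i))"
        proof (rule correct_outcomeI[OF closed])
          show "a + g' \<in> rat_funs (Suc n)"
            by (rule K.add[OF a rat_funs_mono[OF _ o(2)]]) simp
          show "decomposes (Suc n) \<omega> (a + g') (\<lambda>i. r i + r' i)"
            unfolding decomposes_def
          proof (intro allI impI)
            fix i assume "i < Suc n"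
            \<comment> \<open>The recursive call guarantees this below \<open>n\<close>. At
              \<open>n\<close> all three terms are 0: \<open>g'\<close> is free of that variable,
              and \<open>correct_outcome\<close> makes \<open>r'\<close> vanish from index
              \<open>n\<close> on.\<close>
            have "\<omega>' i = pd i g' + r' i"
            proof (cases "i < n")
              case True
              then show ?thesis using o(4) by (simp add: decomposes_def)
            next
              case False
              then have "i = n" using \<open>i < Suc n\<close> by simp
              then show ?thesis using \<omega>'n o(5)[of n] pd_rat_funs_0[OF o(2), of n] by simp
            qed
            then show "\<omega> i = pd i (a + g') + (r i + r' i)"
              unfolding \<omega>'_def ring_deriv.add[OF ring_deriv_pd] by (simp add: algebra_simps)
          qed
          show "r i + r' i = 0" if "Suc n \<le> i" for i
            using that o(5)[of i] by (simp add: r_def rt_remainder_def)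
          show "log_data (us @ vs)" using us(1) o(6) by (auto simp: log_data_def)
          show "to_ac (r i + r' i) = log_form (us @ vs) i" for i
            by (simp add: log_form_append us(2) o(7))
        qed
        then show "\<exists>y. out = Some y \<and>
          (case y of (g', r') \<Rightarrow> ensure (g' \<in> rat_funs n \<and> simple_form n r' \<and> decomposes n \<omega>' g' r')
            {Some (a + g', \<lambda>i. r i + r' i)}) \<noteq> {} \<and>
          (\<forall>o'\<in>(case y of (g', r') \<Rightarrow> ensure (g' \<in> rat_funs n \<and> simple_form n r' \<and> decomposes n \<omega>' g' r')
            {Some (a + g', \<lambda>i. r i + r' i)}). correct_outcome (Suc n) \<omega> o')"
          using o(2-4) by (intro exI[of _ "(g', r')"]) (simp add: o(1) ensure_def)
      qed
    qed
    show ?thesis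
      unfolding unfold
    proof (rule pick_correct[OF ex])
      fix y assume y: "hermite_reduction n (\<omega> n) y"
      obtain a A B where aAB: "y = (a, A, B)" by (cases y)
      have hr: "hermite_reduction n (\<omega> n) (a, A, B)" using y aAB by simp
      have "body y = pick (rt_pick n A B) (rest a A B)"
        using closed_form_step(1)[OF closed hr] by (simp add: body_def aAB ensure_def)
      then show "body y \<noteq> {} \<and> (\<forall>out\<in>body y. correct_outcome (Suc n) \<omega> out)"
        using pick_correct[OF closed_form_step(2)[OF closed hr] rest[OF hr]] by simp
    qed
  qed
qed simp

theorem theorem3p8:
  fixes m :: nat and \<omega> :: "'a::field_char_0 one_form"
  assumes "m \<ge> 1" and "closed_form m \<omega>"
  shows "hermite_one_form m \<omega> \<noteq> {} \<and>
    (\<forall>out \<in> hermite_one_form m \<omega>. \<exists>g r. out = Some (g, r) \<and>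
       g \<in> rat_funs m \<and> simple_form m r \<and> decomposes m \<omega> g r)"
  using hermite_one_form_correct[OF assms] unfolding correct_outcome_def by blast

end
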